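(* Let $(\rho_0,\rho_0v_0)\in\mathcal V_2(\mathbb R)$, let $(\rho_t,\rho_tv_t)=\mathscr S_t(\rho_0,\rho_0v_0)\in\mathcal V_2(\mathbb R)$ be the solution of the sticky particle system, and let $\tilde\rho_\varepsilon:=(\mathsf i+\varepsilon v_0)_\#\rho_0$ for $\varepsilon>0$, where $\mathsf i(x)=x$. Then for every $t>0$ $$\rho_t=\lim_{\varepsilon\downarrow0}\mathscr G^{\rho_0}_{\log(t/\varepsilon)}(\tilde\rho_\varepsilon)\quad\text{in }\mathcal P_2(\mathbb R).$$ Moreover, if for some $\varepsilon_0>0$ the map $\mathsf i+\varepsilon_0v_0$ is $\rho_0$-essentially nondecreasing, then $$\rho_\varepsilon=\tilde\rho_\varepsilon,\qquad\rho_t=\mathscr G^{\rho_0}_{\log(t/\varepsilon)}(\tilde\rho_\varepsilon)\qquad\forall\,\varepsilon\in(0,\varepsilon_0],\ t\ge\varepsilon.$$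
   Context: $\mathcal P_2(\mathbb R)$ is the set of Borel probability measures with finite second moment with the $L^2$-Wasserstein distance $W_2$; $\#$ denotes push-forward. $L^2_\rho(\mathbb R)=L^2(\mathbb R,\rho)$. For $\sigma\in\mathcal P_2(\mathbb R)$, $\phi^\sigma(\rho):=-\frac12W_2^2(\rho,\sigma)$. $\mathscr G^\sigma_\tau:\mathcal P_2(\mathbb R)\to\mathcal P_2(\mathbb R)$, $\tau\ge0$, is the (Wasserstein gradient flow) semigroup of $\phi^\sigma$: by the theory of Ambrosio–Gigli–Savaré, it is the unique continuous semigroup, expanding distances at most by the factor $e^\tau$, whose locally Lipschitz trajectories $\hat\rho_\tau=\mathscr G^\sigma_\tau(\rho)$ are uniquely characterized by $\hat\rho_0=\rho$ and $\frac12\frac{d}{d\tau}W_2^2(\hat\rho_\tau,\eta)-\frac12W_2^2(\hat\rho_\tau,\eta)\le\phi^\sigma(\eta)-\phi^\sigma(\hat\rho_\tau)$ for a.e. $\tau>0$ and all $\eta\in\mathcal P_2(\mathbb R)$. For a Borel probability measure $\rho$ on $\mathbb R$, $X_\rho(w):=\inf\{x:\rho((-\infty,x])>w\}$, $w\in(0,1)$. $\mathcal M(\mathbb R)$ is the space of signed Borel measures with finite total variation; weak convergence is in duality with bounded continuous functions. $\mathcal V_2(\mathbb R):=\{\mu=(\rho,\rho v)\in\mathcal P_2(\mathbb R)\times\mathcal M(\mathbb R):v\in L^2_\rho(\mathbb R)\}$ with the distance $D_2^2(\mu^1,\mu^2):=W_2^2(\rho^1,\rho^2)+\int_0^1|v^1(X_{\rho^1}(w))-v^2(X_{\rho^2}(w))|^2\,dw$.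 Semigroup $\mathscr S_t$. On the $D_2$-dense set $\hat{\mathcal V}(\mathbb R)$ of discrete data $\mu=(\sum_{i=1}^Nm_i\delta_{x_i},\sum_{i=1}^Nm_iv_i\delta_{x_i})$ ($m_i>0$, $\sum m_i=1$, $x_1<\dots<x_N$, $v_i\in\mathbb R$), $\mathscr S_t[\mu]:=(\sum_im_i\delta_{x_i(t)},\sum_im_iv_i(t)\delta_{x_i(t)})$, where $x_i(t)$ are continuous, piecewise linear, ordered trajectories with right-continuous piecewise constant velocities $v_i(t)$ (right derivatives of $x_i$), $x_i(0)=x_i$, $v_i(0)=v_i$; the sets $J_i(t):=\{j:x_j(t)=x_i(t)\}$ are nondecreasing in $t$; velocities are constant between the finitely many collision times $t_k$ (times at which some $J_i$ grows), and $v_i(t_k+)=\sum_{j\in J_i(t_k)}m_jv_j(t_k-)/\sum_{j\in J_i(t_k)}m_j$. On $\mathcal V_2(\mathbb R)$, $\mathscr S_t$ is the unique extension which is strongly-weakly continuous, i.e. such that if $D_2(\mu^n,\mu)\to0$, $\mathscr S_t[\mu^n]=(\rho^n_t,\rho^n_tv^n_t)$, $\mathscr S_t[\mu]=(\rho_t,\rho_tv_t)$, then $W_2(\rho^n_t,\rho_t)\to0$ and $\rho^n_tv^n_t\rightharpoonup\rho_tv_t$ weakly in $\mathcal M(\mathbb R)$. *)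

theory Defs
  imports "HOL-Probability.Probability"
begin

definition P2 :: "real measure set" where
  "P2 = {\<rho>. prob_space \<rho> \<and> sets \<rho> = sets borel \<and> integrable \<rho> (\<lambda>x. x\<^sup>2)}"

definition couplings :: "real measure \<Rightarrow> real measure \<Rightarrow> (real \<times> real) measure set" where
  "couplings \<rho> \<sigma> = {\<gamma>. sets \<gamma> = sets borel \<and> distr \<gamma> borel fst = \<rho> \<and> distr \<gamma> borel snd = \<sigma>}"

definition W2 :: "real measure \<Rightarrow> real measure \<Rightarrow> real" where
  "W2 \<rho> \<sigma> = sqrt (enn2real (INF \<gamma>\<in>couplings \<rho> \<sigma>. \<integral>\<^sup>+z. ennreal ((fst z - snd z)\<^sup>2) \<partial>\<gamma>))"

text \<open>Representatives; no quotient by equality almost everywhere is taken.\<close>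

definition L2 :: "real measure \<Rightarrow> (real \<Rightarrow> real) set" where
  "L2 \<rho> = {v \<in> borel_measurable borel. integrable \<rho> (\<lambda>x. (v x)\<^sup>2)}"

definition ess_nondecreasing :: "real measure \<Rightarrow> (real \<Rightarrow> real) \<Rightarrow> bool" where
  "ess_nondecreasing \<rho> f \<longleftrightarrow> (\<exists>A\<in>null_sets \<rho>. mono_on (- A) f)"


section \<open>The gradient flow of minus half the squared Wasserstein distance\<close>

definition phi :: "real measure \<Rightarrow> real measure \<Rightarrow> real" where
  "phi \<sigma> \<rho> = - (1 / 2) * (W2 \<rho> \<sigma>)\<^sup>2"

text \<open>The evolution variational inequality; differentiability of the squared distance at almost
  every time is part of it.\<close>

definition EVI :: "real measure \<Rightarrow> (real \<Rightarrow> real measure) \<Rightarrow> bool" where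
  "EVI \<sigma> r \<longleftrightarrow>
    (\<forall>\<eta>\<in>P2. AE \<tau> in lborel. \<tau> > 0 \<longrightarrow>
      (\<exists>D. ((\<lambda>s. (W2 (r s) \<eta>)\<^sup>2) has_real_derivative D) (at \<tau>) \<and>
           1 / 2 * D - 1 / 2 * (W2 (r \<tau>) \<eta>)\<^sup>2 \<le> phi \<sigma> \<eta> - phi \<sigma> (r \<tau>)))"

text \<open>\<open>G \<tau> \<rho>\<close> is the flow at time \<open>\<tau> \<ge> 0\<close> started at \<open>\<rho>\<close>. Continuity in time is
  contained in the local Lipschitz condition, continuity in \<open>\<rho>\<close> in the expansion bound.\<close>

definition gradient_flow_semigroup ::
    "real measure \<Rightarrow> (real \<Rightarrow> real measure \<Rightarrow> real measure) \<Rightarrow> bool" where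
  "gradient_flow_semigroup \<sigma> G \<longleftrightarrow>
    (\<forall>\<tau>\<ge>0. \<forall>\<rho>\<in>P2. G \<tau> \<rho> \<in> P2) \<and>
    (\<forall>\<rho>\<in>P2. G 0 \<rho> = \<rho>) \<and>
    (\<forall>s\<ge>0. \<forall>\<tau>\<ge>0. \<forall>\<rho>\<in>P2. G (s + \<tau>) \<rho> = G s (G \<tau> \<rho>)) \<and>
    (\<forall>\<tau>\<ge>0. \<forall>\<rho>\<in>P2. \<forall>\<eta>\<in>P2. W2 (G \<tau> \<rho>) (G \<tau> \<eta>) \<le> exp \<tau> * W2 \<rho> \<eta>) \<and>
    (\<forall>\<rho>\<in>P2. \<forall>T. \<exists>L. \<forall>s\<in>{0..T}. \<forall>\<tau>\<in>{0..T}. W2 (G s \<rho>) (G \<tau> \<rho>) \<le> L * \<bar>s - \<tau>\<bar>) \<and>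
    (\<forall>\<rho>\<in>P2. EVI \<sigma> (\<lambda>\<tau>. G \<tau> \<rho>))"


section \<open>The space of measures and momenta\<close>

text \<open>A signed Borel measure is a real-valued countably additive function on the Borel sets,
  extended by 0 to all other sets so that equality of functions is equality of signed measures.
  Having only finite values, it has finite total variation.\<close>

type_synonym signed_measure = "real set \<Rightarrow> real"

definition signed_measures :: "signed_measure set" where
  "signed_measures = {p. (\<forall>A. A \<notin> sets borel \<longrightarrow> p A = 0) \<and>
    (\<forall>A :: nat \<Rightarrow> real set. range A \<subseteq> sets borel \<longrightarrow> disjoint_family A \<longrightarrow>
       (\<lambda>i. p (A i)) sums p (\<Union>i. A i))}"

text \<open>The integral of a bounded Borel function, computed from any decomposition into a difference
  of finite positive measures (the value does not depend on the decomposition, and the Jordan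
  decomposition is one).\<close>

definition signed_integral :: "signed_measure \<Rightarrow> (real \<Rightarrow> real) \<Rightarrow> real" where
  "signed_integral p f = (THE I. \<exists>M N. finite_measure M \<and> finite_measure N \<and>
     sets M = sets borel \<and> sets N = sets borel \<and>
     (\<forall>A\<in>sets borel. p A = measure M A - measure N A) \<and>
     I = (\<integral>x. f x \<partial>M) - (\<integral>x. f x \<partial>N))"

definition weakly_converges :: "(nat \<Rightarrow> signed_measure) \<Rightarrow> signed_measure \<Rightarrow> bool" where
  "weakly_converges ps p \<longleftrightarrow>
    (\<forall>f. continuous_on UNIV f \<longrightarrow> bounded (range f) \<longrightarrow>
       (\<lambda>n. signed_integral (ps n) f) \<longlonglongrightarrow> signed_integral p f)"

text \<open>The signed measure \<open>\<rho>v\<close>.\<close>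

definition momentum :: "real measure \<Rightarrow> (real \<Rightarrow> real) \<Rightarrow> signed_measure" where
  "momentum \<rho> v = (\<lambda>A. if A \<in> sets borel then (LINT x:A|\<rho>. v x) else 0)"

type_synonym state = "real measure \<times> signed_measure"

definition V2 :: "state set" where
  "V2 = {(\<rho>, p). \<rho> \<in> P2 \<and> p \<in> signed_measures \<and> (\<exists>v\<in>L2 \<rho>. p = momentum \<rho> v)}"

text \<open>Determined up to \<open>\<rho>\<close>-null sets. The choice does not influence \<open>D2\<close>, because \<open>X_of \<rho>\<close>
  pushes the Lebesgue measure of the unit interval forward to \<open>\<rho>\<close>.\<close>

definition velocity :: "state \<Rightarrow> real \<Rightarrow> real" where
  "velocity \<mu> = (SOME v. v \<in> L2 (fst \<mu>) \<and> snd \<mu> = momentum (fst \<mu>) v)"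

definition X_of :: "real measure \<Rightarrow> real \<Rightarrow> real" where
  "X_of \<rho> w = Inf {x. measure \<rho> {..x} > w}"

definition D2 :: "state \<Rightarrow> state \<Rightarrow> real" where
  "D2 \<mu> \<nu> = sqrt ((W2 (fst \<mu>) (fst \<nu>))\<^sup>2 +
     (LINT w:{0<..<1}|lborel.
        \<bar>velocity \<mu> (X_of (fst \<mu>) w) - velocity \<nu> (X_of (fst \<nu>) w)\<bar>\<^sup>2))"


section \<open>Sticky particles\<close>

text \<open>\<open>(\<Sum>i<N. m i \<delta>(x i), \<Sum>i<N. m i v i \<delta>(x i))\<close>; the points \<open>x i\<close> need not be distinct.\<close>

definition discrete_state ::
    "nat \<Rightarrow> (nat \<Rightarrow> real) \<Rightarrow> (nat \<Rightarrow> real) \<Rightarrow> (nat \<Rightarrow> real) \<Rightarrow> state" where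
  "discrete_state N m x v =
    (distr (point_measure {..<N} (\<lambda>i. ennreal (m i))) borel x,
     \<lambda>A. if A \<in> sets borel then (\<Sum>i<N. m i * v i * indicator A (x i)) else 0)"

lemma emeasure_fst_discrete_state:
  assumes "A \<in> sets borel"
  shows "emeasure (fst (discrete_state N m x v)) A
       = (\<Sum>i<N. ennreal (m i) * indicator A (x i))"
proof -
  have "emeasure (fst (discrete_state N m x v)) A
      = emeasure (point_measure {..<N} (\<lambda>i. ennreal (m i))) (x -` A \<inter> {..<N})"
    using assms by (simp add: discrete_state_def emeasure_distr space_point_measure)
  also have "\<dots> = (\<Sum>i\<in>x -` A \<inter> {..<N}. ennreal (m i))"
    by (intro emeasure_point_measure_finite) auto
  also have "\<dots> = (\<Sum>i<N. ennreal (m i) * indicator A (x i))"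
    by (rule sum.mono_neutral_cong_left) (auto simp: indicator_def)
  finally show ?thesis .
qed

definition discrete_data :: "nat \<Rightarrow> (nat \<Rightarrow> real) \<Rightarrow> (nat \<Rightarrow> real) \<Rightarrow> bool" where
  "discrete_data N m x \<longleftrightarrow>
    (\<forall>i<N. 0 < m i) \<and> (\<Sum>i<N. m i) = 1 \<and> strict_mono_on {..<N} x"

definition cluster :: "nat \<Rightarrow> (nat \<Rightarrow> real \<Rightarrow> real) \<Rightarrow> nat \<Rightarrow> real \<Rightarrow> nat set" where
  "cluster N x i t = {j. j < N \<and> x j t = x i t}"

definition collision_times :: "nat \<Rightarrow> (nat \<Rightarrow> real \<Rightarrow> real) \<Rightarrow> real set" where
  "collision_times N x =
    {t. 0 < t \<and> (\<exists>i<N. \<forall>s. 0 \<le> s \<and> s < t \<longrightarrow> cluster N x i s \<subset> cluster N x i t)}"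

text \<open>\<open>x i t\<close> and \<open>v i t\<close> are position and velocity of particle \<open>i\<close> at time \<open>t \<ge> 0\<close>. The
  half-open intervals in the sixth clause make the velocities right-continuous, so that \<open>v i t\<close>
  is the velocity after the collision if \<open>t\<close> is a collision time; \<open>u\<close> are the left limits.\<close>

definition sticky_evolution ::
    "nat \<Rightarrow> (nat \<Rightarrow> real) \<Rightarrow> (nat \<Rightarrow> real) \<Rightarrow> (nat \<Rightarrow> real) \<Rightarrow>
     (nat \<Rightarrow> real \<Rightarrow> real) \<Rightarrow> (nat \<Rightarrow> real \<Rightarrow> real) \<Rightarrow> bool" where
  "sticky_evolution N m x0 v0 x v \<longleftrightarrow>
    (\<forall>i<N. x i 0 = x0 i \<and> v i 0 = v0 i \<and> continuous_on {0..} (x i)) \<and>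
    (\<forall>t\<ge>0. \<forall>i j. i \<le> j \<and> j < N \<longrightarrow> x i t \<le> x j t) \<and>
    (\<forall>t\<ge>0. \<forall>i<N. (x i has_real_derivative v i t) (at_right t)) \<and>
    (\<forall>i<N. \<forall>s t. 0 \<le> s \<and> s \<le> t \<longrightarrow> cluster N x i s \<subseteq> cluster N x i t) \<and>
    finite (collision_times N x) \<and>
    (\<forall>i<N. \<forall>s t. 0 \<le> s \<and> s \<le> t \<and> {s<..t} \<inter> collision_times N x = {} \<longrightarrow> v i s = v i t) \<and>
    (\<forall>t\<in>collision_times N x. \<exists>u. (\<forall>j<N. (v j \<longlongrightarrow> u j) (at_left t)) \<and>
       (\<forall>i<N. v i t = (\<Sum>j\<in>cluster N x i t. m j * u j) / (\<Sum>j\<in>cluster N x i t. m j)))"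

text \<open>\<open>S\<close> extends the sticky particle dynamics of discrete data to \<open>V2\<close> and is
  strongly-weakly continuous at every time. By density of discrete data this determines
  \<open>S t\<close> on \<open>V2\<close> for all \<open>t \<ge> 0\<close>.\<close>

definition sticky_semigroup :: "(real \<Rightarrow> state \<Rightarrow> state) \<Rightarrow> bool" where
  "sticky_semigroup S \<longleftrightarrow>
    (\<forall>t\<ge>0. \<forall>\<mu>\<in>V2. S t \<mu> \<in> V2) \<and>
    (\<forall>N m x0 v0. discrete_data N m x0 \<longrightarrow>
      (\<exists>x v. sticky_evolution N m x0 v0 x v \<and>
        (\<forall>t\<ge>0. S t (discrete_state N m x0 v0)
               = discrete_state N m (\<lambda>i. x i t) (\<lambda>i. v i t)))) \<and>
    (\<forall>t\<ge>0. \<forall>\<mu>s \<mu>. range \<mu>s \<subseteq> V2 \<and> \<mu> \<in> V2 \<and> (\<lambda>n. D2 (\<mu>s n) \<mu>) \<longlonglongrightarrow> 0 \<longrightarrow>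
      (\<lambda>n. W2 (fst (S t (\<mu>s n))) (fst (S t \<mu>))) \<longlonglongrightarrow> 0 \<and>
      weakly_converges (\<lambda>n. snd (S t (\<mu>s n))) (snd (S t \<mu>)))"

end

theory Submission
  imports Defs
begin

text \<open>
  Write \<open>X\<close> for the quantile function of a measure (\<open>X_of\<close>). On the line the quantile coupling is optimal,
  so that \<open>\<rho> \<mapsto> X\<close> is an isometry of \<open>P2\<close> with \<open>W2\<close> onto the nondecreasing functions in the Hilbert
  space \<open>L\<^sup>2(0,1)\<close> (\<open>W2_eq\<close>). Let \<open>X\<^sub>t\<close> belong to the sticky particle solution and let
  \<open>V = v0 \<circ> X\<^sub>0\<close>.

  For finitely many particles, collisions preserve the moments of the velocities against weights that
  are constant on clusters and raise those against nondecreasing weights, because the particles of a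
  cluster arrive with velocities that are nonincreasing from left to right (\<open>momentum_le\<close>). Moments of
  the positions are therefore affine in time up to \<open>t\<close> for weights constant on the clusters of time
  \<open>t\<close>, and convex in time for nondecreasing weights. This has two consequences.

  The first one is that \<open>X\<^sub>t\<close> is the projection of the free motion \<open>X\<^sub>0 + t V\<close> onto the cone of
  nondecreasing functions. If \<open>X\<^sub>0 + t V\<close> is itself nondecreasing, then \<open>X\<^sub>t = X\<^sub>0 + t V\<close>, which gives
  \<open>\<rho> \<epsilon> = \<rho>' \<epsilon>\<close> (\<open>sticky_eq_free_transport\<close>).

  The second one is that \<open>\<tau> \<mapsto> \<rho> (\<epsilon> exp \<tau>)\<close> satisfies the evolution variational inequality up to
  an error quadratic in the time increment (\<open>law_evi\<close>). In terms of \<open>s < t\<close> and \<open>a = t / s - 1\<close> this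
  amounts to the inequality
  \<open>\<langle>X\<^sub>t - X\<^sub>s - a (X\<^sub>s - X\<^sub>0), X\<^sub>t - Z\<rangle> \<le> 0\<close> for nondecreasing \<open>Z\<close>, which combines affinity (the
  weight \<open>X\<^sub>t\<close>) with convexity (the weight \<open>Z\<close>: the quotient \<open>\<langle>X\<^sub>t - X\<^sub>0, Z\<rangle> / t\<close> is
  nondecreasing).

  Both statements pass from discrete data to all data, as discrete data are \<open>D2\<close>-dense
  (\<open>discrete_approximation\<close>) and the estimates are uniform (\<open>sticky_limit\<close>). Doubling of variables shows
  that a curve with such an approximate inequality coincides with the gradient flow
  (\<open>EVI_uniqueness\<close>); hence \<open>\<rho> t = G (ln (t / \<epsilon>)) (\<rho> \<epsilon>)\<close> for every initial velocity
  (\<open>sticky_eq_gradient_flow\<close>), and the second part of the theorem follows.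

  For the first part replace \<open>v0\<close> by a Lipschitz function \<open>v\<close> close to it in \<open>L\<^sup>2(\<rho>0)\<close>. For small
  \<open>\<epsilon>\<close> the map \<open>x + \<epsilon> v x\<close> is nondecreasing and the second part applies to \<open>v\<close>. The
  replacement moves \<open>\<rho>' \<epsilon>\<close> by at most \<open>\<epsilon> \<parallel>v0 - v\<parallel>\<close>, which the flow expands by at most
  \<open>exp (ln (t / \<epsilon>)) = t / \<epsilon>\<close>, so that the total error is at most \<open>t \<parallel>v0 - v\<parallel>\<close>, uniformly in
  \<open>\<epsilon>\<close>; the sticky solution at time \<open>t\<close> depends continuously on the velocity by assumption.
\<close>

section \<open>Increments and one-sided derivatives\<close>

text \<open>The points up to which \<open>f\<close> has stayed below \<open>f a\<close> form an interval: continuity closes it on the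
  right, and the local hypothesis extends it beyond any of its points before \<open>b\<close>.\<close>

lemma nonincreasing_if_locally_right:
  fixes f :: "real \<Rightarrow> real"
  assumes cont: "continuous_on {a..b} f" and "a \<le> b"
    and loc: "\<And>x. a \<le> x \<Longrightarrow> x < b \<Longrightarrow> eventually (\<lambda>y. f y \<le> f x) (at_right x)"
  shows "f b \<le> f a"
proof -
  define A where "A = {x\<in>{a..b}. \<forall>y\<in>{a..x}. f y \<le> f a}"
  define s where "s = Sup A"
  have aA: "a \<in> A" using \<open>a \<le> b\<close> by (auto simp: A_def)
  have bdd: "bdd_above A" by (auto simp: A_def bdd_above_def)
  have sab: "a \<le> s" "s \<le> b"
  proof -
    show "a \<le> s" unfolding s_def by (rule cSup_upper[OF aA bdd])
    show "s \<le> b" unfolding s_def by (rule cSup_least) (use aA in \<open>auto simp: A_def\<close>)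
  qed
  have below: "f y \<le> f a" if y: "a \<le> y" "y < s" for y
  proof -
    obtain x where "x \<in> A" "y < x"
      by (rule less_cSupE[of y A]) (use aA y in \<open>auto simp: s_def\<close>)
    then show ?thesis using y by (auto simp: A_def)
  qed
  have fs: "f s \<le> f a"
  proof (cases "a = s")
    case False
    with sab have "a < s" by simp
    have "(f \<longlongrightarrow> f s) (at s within {a..s})"
      using cont sab by (auto simp: continuous_on_def intro: tendsto_within_subset[of f _ s "{a..b}"])
    then have "(f \<longlongrightarrow> f s) (at_left s)"
      using \<open>a < s\<close> at_within_Icc_at_left by metis
    moreover have "eventually (\<lambda>y. f y \<le> f a) (at_left s)"
      using eventually_at_left_real[OF \<open>a < s\<close>] by eventually_elim (auto intro: below)
    ultimately show ?thesis by (intro tendsto_upperbound[of f "f s" "at_left s"]) auto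
  qed simp
  show ?thesis
  proof (cases "s = b")
    case False
    with sab have "s < b" by simp
    obtain c where c: "c > s" "\<And>y. s < y \<Longrightarrow> y < c \<Longrightarrow> f y \<le> f s"
      using loc[OF sab(1) \<open>s < b\<close>] unfolding eventually_at_right_field by blast
    define d where "d = min ((s + c) / 2) b"
    have "s < d" "d \<le> b" "d < c" using c \<open>s < b\<close> by (auto simp: d_def min_def field_simps)
    have "d \<in> A"
      unfolding A_def
    proof (intro CollectI conjI ballI)
      show "d \<in> {a..b}" using \<open>s < d\<close> \<open>d \<le> b\<close> sab by auto
      fix y assume y: "y \<in> {a..d}"
      consider "y < s" | "y = s" | "s < y" by linarith
      then show "f y \<le> f a"
        by cases (use y fs below c(2)[of y] \<open>d < c\<close> in auto)
    qed
    then have "d \<le> s" unfolding s_def by (intro cSup_upper bdd)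
    with \<open>s < d\<close> show ?thesis by simp
  qed (use fs in simp)
qed

text \<open>Subtracting a line of slope slightly above \<open>c\<close> makes the function decrease to the right of every point.\<close>

lemma increment_le_if_right_derivative_le:
  fixes f :: "real \<Rightarrow> real"
  assumes cont: "continuous_on {a..b} f" and "a \<le> b"
    and der: "\<And>x. a \<le> x \<Longrightarrow> x < b \<Longrightarrow> (f has_real_derivative f' x) (at_right x)"
    and le: "\<And>x. a \<le> x \<Longrightarrow> x < b \<Longrightarrow> f' x \<le> c"
  shows "f b - f a \<le> c * (b - a)"
proof -
  have "f b - f a \<le> c * (b - a) + e * (b - a)" if "e > 0" for e
  proof -
    let ?g = "\<lambda>x. f x - (c + e) * x"
    have "?g b \<le> ?g a"
    proof (rule nonincreasing_if_locally_right[where f = ?g])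
      show "continuous_on {a..b} ?g" by (intro continuous_intros cont)
      fix x assume x: "a \<le> x" "x < b"
      have "((\<lambda>y. (f y - f x) / (y - x)) \<longlongrightarrow> f' x) (at_right x)"
        using der[OF x] by (simp add: has_field_derivative_iff)
      then have "eventually (\<lambda>y. (f y - f x) / (y - x) < c + e) (at_right x)"
        using le[OF x] \<open>e > 0\<close> by (intro order_tendstoD) auto
      with eventually_at_right_less[of x]
      show "eventually (\<lambda>y. ?g y \<le> ?g x) (at_right x)"
        by eventually_elim (simp add: field_simps)
    qed (use \<open>a \<le> b\<close> in auto)
    then show ?thesis by (simp add: algebra_simps)
  qed
  then have "f b - f a \<le> c * (b - a) + d" if "d > 0" for d
    using \<open>a \<le> b\<close> that
    by (cases "a = b") (auto dest: meta_spec[of _ "d / (b - a)"])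
  then show ?thesis by (rule field_le_epsilon)
qed

text \<open>The evolution variational inequality holds at almost every time only. The exceptional points are put
  into an open set \<open>U\<close> of small measure, and a large multiple of the length of \<open>U \<inter> {a..x}\<close> is
  subtracted from \<open>f\<close>. Inside \<open>U\<close> this correction outweighs the Lipschitz constant; outside of it the
  derivative decides. In total the correction is negligible.\<close>

lemma increment_le_if_AE_derivative_le:
  fixes f :: "real \<Rightarrow> real"
  assumes "a \<le> b"
    and lip: "\<And>x y. x \<in> {a..b} \<Longrightarrow> y \<in> {a..b} \<Longrightarrow> \<bar>f x - f y\<bar> \<le> L * \<bar>x - y\<bar>"
    and ae: "AE x in lborel. a < x \<and> x < b \<longrightarrow> (\<exists>D. (f has_real_derivative D) (at x) \<and> D \<le> c)"
  shows "f b - f a \<le> c * (b - a)"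
proof (rule field_le_epsilon)
  fix d :: real assume "d > 0"
  define L' where "L' = \<bar>L\<bar> + \<bar>c\<bar> + 1"
  have "L' > 0" by (simp add: L'_def)
  define e where "e = d / (1 + (b - a))"
  have "e > 0" using \<open>d > 0\<close> \<open>a \<le> b\<close> by (simp add: e_def)
  define q where "q = e / L'"
  have "q > 0" using \<open>e > 0\<close> \<open>L' > 0\<close> by (simp add: q_def)
  define P where "P = (\<lambda>x. a < x \<and> x < b \<longrightarrow> (\<exists>D. (f has_real_derivative D) (at x) \<and> D \<le> c))"
  have "AE x in lborel. P x" using ae unfolding P_def .
  then obtain N where N0: "N \<in> null_sets lborel" and "{x \<in> space lborel. \<not> P x} \<subseteq> N"
    unfolding eventually_ae_filter by blast
  then have N: "P x" if "x \<notin> N" for x using that by auto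
  define B where "B = insert a N"
  have B: "B \<in> null_sets lborel"
  proof -
    have "{a} \<union> N \<in> null_sets lborel"
      by (intro null_sets.Un finite_imp_null_set_lborel N0) auto
    then show ?thesis by (simp add: B_def)
  qed
  obtain U where U: "open U" "B \<subseteq> U" "emeasure lborel (U - B) < ennreal q"
    using outer_regular_lborel[of B q] null_setsD2[OF B] \<open>q > 0\<close> unfolding sets_lborel by metis
  have Ub: "U \<in> sets borel" using U by auto
  have Um: "emeasure lborel U < ennreal q"
    using U(3) emeasure_Diff_null_set[OF B, of U] Ub by simp
  define u where "u = (\<lambda>x. measure lborel (U \<inter> {a..x}))"
  have icc: "{x..y} \<in> fmeasurable lborel" for x y :: real
    by (auto simp: fmeasurable_def emeasure_lborel_Icc_eq)
  have fin: "U \<inter> {a..x} \<in> fmeasurable lborel" for x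
    by (rule fmeasurableI2[of "{a..x}"]) (use Ub in \<open>auto simp: fmeasurable_def emeasure_lborel_Icc_eq\<close>)
  have u_mono: "u x \<le> u y" if "x \<le> y" for x y
    unfolding u_def using that by (intro measure_mono_fmeasurable fin fmeasurableD) auto
  have u_q: "u x \<le> q" for x
  proof -
    have "emeasure lborel (U \<inter> {a..x}) \<le> emeasure lborel U"
      using Ub by (intro emeasure_mono) auto
    then have "emeasure lborel (U \<inter> {a..x}) \<le> ennreal q" using Um by simp
    then show ?thesis unfolding u_def measure_def
      using \<open>q > 0\<close> by (intro enn2real_leI) auto
  qed
  have u_incr: "u y - u x \<le> y - x" if "a \<le> x" "x \<le> y" for x y
  proof -
    have "u y \<le> measure lborel ((U \<inter> {a..x}) \<union> {x..y})"
      unfolding u_def using that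
      by (intro measure_mono_fmeasurable fmeasurableD fin fmeasurable.Un icc) auto
    also have "\<dots> \<le> u x + measure lborel {x..y}"
      unfolding u_def by (intro measure_Un_le fmeasurableD fin icc)
    finally show ?thesis using that by simp
  qed
  have u_incr_eq: "u y - u x = y - x" if "a \<le> x" "x < y" "{x..y} \<subseteq> U" for x y
  proof -
    have eq: "U \<inter> {a..y} = (U \<inter> {a..x}) \<union> {x<..y}" using that by auto
    have "measure lborel ((U \<inter> {a..x}) \<union> {x<..y}) = measure lborel (U \<inter> {a..x}) + measure lborel {x<..y}"
      using fin[of x] Ub that by (intro measure_Union) (auto simp: fmeasurable_def emeasure_lborel_Ioc)
    then show ?thesis using that unfolding u_def eq by simp
  qed
  \<comment> \<open>nonincreasing to the right of every point, at a total cost of at most \<open>L' * q = e\<close>\<close>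
  define g where "g = (\<lambda>x. f x - (c + e) * x - L' * u x)"
  have contu: "continuous_on {a..b} u"
  proof (rule lipschitz_on_continuous_on[of 1], rule lipschitz_onI)
    fix x y assume "x \<in> {a..b}" "y \<in> {a..b}"
    then show "dist (u x) (u y) \<le> 1 * dist x y"
      using u_incr[of x y] u_incr[of y x] u_mono[of x y] u_mono[of y x]
      by (cases "x \<le> y") (auto simp: dist_real_def)
  qed simp
  have contf: "continuous_on {a..b} f"
  proof (rule lipschitz_on_continuous_on[of "\<bar>L\<bar>"], rule lipschitz_onI)
    fix x y assume "x \<in> {a..b}" "y \<in> {a..b}"
    then have "\<bar>f x - f y\<bar> \<le> L * \<bar>x - y\<bar>" by (rule lip)
    also have "\<dots> \<le> \<bar>L\<bar> * \<bar>x - y\<bar>" by (intro mult_right_mono) auto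
    finally show "dist (f x) (f y) \<le> \<bar>L\<bar> * dist x y" by (simp add: dist_real_def)
  qed simp
  have "g b \<le> g a"
  proof (rule nonincreasing_if_locally_right[where f = g])
    show "continuous_on {a..b} g" unfolding g_def by (intro continuous_intros contf contu)
    fix x assume x: "a \<le> x" "x < b"
    show "eventually (\<lambda>y. g y \<le> g x) (at_right x)"
    proof (cases "x \<in> B")
      case True
      then have "x \<in> U" using U by auto
      then obtain r where r: "r > 0" "ball x r \<subseteq> U" using U(1) open_contains_ball by blast
      have "eventually (\<lambda>y. y < min b (x + r)) (at_right x)"
        using x r by (intro eventually_at_right_field[THEN iffD2]) (auto intro!: exI[of _ "min b (x + r)"])
      with eventually_at_right_less[of x] show ?thesis
      proof eventually_elim
        case (elim y)
        have "{x..y} \<subseteq> U" using r elim by (auto simp: subset_iff dist_real_def)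
        then have "u y - u x = y - x" using u_incr_eq[of x y] x elim by simp
        moreover have "f y - f x \<le> \<bar>L\<bar> * (y - x)"
        proof -
          have "f y - f x \<le> \<bar>f y - f x\<bar>" by simp
          also have "\<dots> \<le> L * \<bar>y - x\<bar>" using x elim by (intro lip) auto
          also have "\<dots> \<le> \<bar>L\<bar> * \<bar>y - x\<bar>" by (intro mult_right_mono) auto
          finally show ?thesis using elim by simp
        qed
        moreover have "- c * (y - x) \<le> \<bar>c\<bar> * (y - x)"
          using elim by (intro mult_right_mono) auto
        moreover have "e * (y - x) \<ge> 0" using elim \<open>e > 0\<close> by simp
        moreover have "L' * (y - x) = \<bar>L\<bar> * (y - x) + \<bar>c\<bar> * (y - x) + (y - x)"
          by (simp add: L'_def algebra_simps)
        moreover have "L' * (y - x) = L' * u y - L' * u x"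
          using calculation(1) by (simp add: right_diff_distrib[symmetric])
        moreover have "(c + e) * (y - x) = - (- c * (y - x)) + e * (y - x)"
          by (simp add: algebra_simps)
        moreover have "g y - g x = (f y - f x) - (c + e) * (y - x) - (L' * u y - L' * u x)"
          by (simp add: g_def algebra_simps)
        ultimately show ?case using elim by linarith
      qed
    next
      case False
      then have "a < x" "x \<notin> N" using x by (auto simp: B_def)
      then obtain D where D: "(f has_real_derivative D) (at x)" "D \<le> c"
        using N[of x] x unfolding P_def by blast
      have "((\<lambda>y. (f y - f x) / (y - x)) \<longlongrightarrow> D) (at_right x)"
        using has_field_derivative_at_within[OF D(1)] by (simp add: has_field_derivative_iff)
      then have "eventually (\<lambda>y. (f y - f x) / (y - x) < c + e) (at_right x)"
        using D(2) \<open>e > 0\<close> by (intro order_tendstoD) auto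
      with eventually_at_right_less[of x] show ?thesis
      proof eventually_elim
        case (elim y)
        then have "f y - f x \<le> (c + e) * (y - x)" by (simp add: field_simps)
        moreover have "L' * u x \<le> L' * u y" using u_mono[of x y] elim \<open>L' > 0\<close> by simp
        ultimately show ?case by (simp add: g_def algebra_simps)
      qed
    qed
  qed (use \<open>a \<le> b\<close> in auto)
  then have "f b - f a \<le> c * (b - a) + e * (b - a) + L' * (u b - u a)"
    by (simp add: g_def algebra_simps)
  also have "L' * (u b - u a) \<le> L' * q"
  proof -
    have "u a \<ge> 0" by (simp add: u_def)
    then show ?thesis using u_q[of b] \<open>L' > 0\<close> by (intro mult_left_mono) auto
  qed
  also have "L' * q = e" using \<open>L' > 0\<close> by (simp add: q_def)
  also have "c * (b - a) + e * (b - a) + e = c * (b - a) + d"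
  proof -
    have "e * (1 + (b - a)) = d" using \<open>a \<le> b\<close> by (simp add: e_def)
    then show ?thesis by (simp add: algebra_simps)
  qed
  finally show "f b - f a \<le> c * (b - a) + d" by simp
qed


section \<open>Moments of sticky particles\<close>

text \<open>The effect of averaging \<open>u\<close> over clusters on a weighted moment, written as a double sum that is
  symmetric in the two particles. Every summand vanishes if \<open>z\<close> is constant on clusters, and is
  nonnegative if \<open>u\<close> and \<open>z\<close> are oppositely ordered on clusters.\<close>

lemma sum_average_deviation:
  fixes m u z :: "nat \<Rightarrow> real" and x :: "nat \<Rightarrow> real \<Rightarrow> real"
  assumes m: "\<And>i. i < N \<Longrightarrow> 0 < m i"
  shows "(\<Sum>i<N. m i * ((\<Sum>j\<in>cluster N x i t. m j * u j) / (\<Sum>j\<in>cluster N x i t. m j) - u i) * z i)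
    = (\<Sum>i<N. \<Sum>j\<in>cluster N x i t. m i * m j * (u j - u i) * (z i - z j) / (\<Sum>j\<in>cluster N x i t. m j)) / 2"
proof -
  define M where "M = (\<lambda>i. \<Sum>j\<in>cluster N x i t. m j)"
  have fin: "finite (cluster N x i t)" for i by (auto simp: cluster_def)
  have Mpos: "M i > 0" if "i < N" for i
    unfolding M_def using that m by (intro sum_pos fin) (auto simp: cluster_def)
  have Meq: "M i = M j" if "j \<in> cluster N x i t" for i j
    using that by (auto simp: M_def cluster_def)
  define h where "h = (\<lambda>i j. m i * m j * (u j - u i) / M i)"
  have swap: "(\<Sum>i<N. \<Sum>j\<in>cluster N x i t. h i j * z i) = (\<Sum>i<N. \<Sum>j\<in>cluster N x i t. - h i j * z j)"
  proof -
    have c: "cluster N x i t = {j \<in> {..<N}. x j t = x i t}" for i by (auto simp: cluster_def)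
    have "(\<Sum>i<N. \<Sum>j\<in>cluster N x i t. h i j * z i) = (\<Sum>i<N. \<Sum>j<N. if x j t = x i t then h i j * z i else 0)"
      unfolding c sum.inter_filter[OF finite_lessThan] ..
    also have "\<dots> = (\<Sum>i<N. \<Sum>j<N. if x i t = x j t then h j i * z j else 0)"
      by (rule sum.swap)
    also have "\<dots> = (\<Sum>i<N. \<Sum>j<N. if x j t = x i t then - h i j * z j else 0)"
    proof (intro sum.cong refl)
      fix i j assume "i \<in> {..<N}" "j \<in> {..<N}"
      then show "(if x i t = x j t then h j i * z j else 0) = (if x j t = x i t then - h i j * z j else 0)"
        using Meq[of j i] by (auto simp: h_def cluster_def algebra_simps diff_divide_distrib)
    qed
    also have "\<dots> = (\<Sum>i<N. \<Sum>j\<in>cluster N x i t. - h i j * z j)"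
      unfolding c sum.inter_filter[OF finite_lessThan] ..
    finally show ?thesis .
  qed
  have "(\<Sum>i<N. m i * ((\<Sum>j\<in>cluster N x i t. m j * u j) / M i - u i) * z i)
      = (\<Sum>i<N. \<Sum>j\<in>cluster N x i t. h i j * z i)"
  proof (intro sum.cong refl)
    fix i assume "i \<in> {..<N}"
    then have Mi: "M i > 0" by (auto intro: Mpos)
    have "(\<Sum>j\<in>cluster N x i t. h i j * z i)
        = m i * z i / M i * (\<Sum>j\<in>cluster N x i t. m j * u j - m j * u i)"
      by (simp add: h_def sum_distrib_left sum_distrib_right field_simps)
    also have "(\<Sum>j\<in>cluster N x i t. m j * u j - m j * u i) = (\<Sum>j\<in>cluster N x i t. m j * u j) - M i * u i"
      by (simp add: sum_subtractf M_def sum_distrib_right)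
    finally show "m i * ((\<Sum>j\<in>cluster N x i t. m j * u j) / M i - u i) * z i = (\<Sum>j\<in>cluster N x i t. h i j * z i)"
      using Mi by (simp add: field_simps)
  qed
  also have "\<dots> = ((\<Sum>i<N. \<Sum>j\<in>cluster N x i t. h i j * z i) + (\<Sum>i<N. \<Sum>j\<in>cluster N x i t. - h i j * z j)) / 2"
    using swap by simp
  also have "\<dots> = (\<Sum>i<N. \<Sum>j\<in>cluster N x i t. m i * m j * (u j - u i) * (z i - z j) / M i) / 2"
    by (simp add: sum.distrib[symmetric] h_def algebra_simps diff_divide_distrib add_divide_distrib)
  finally show ?thesis by (simp add: M_def)
qed

locale sticky =
  fixes N :: nat and m x0 v0 :: "nat \<Rightarrow> real" and x v :: "nat \<Rightarrow> real \<Rightarrow> real"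
  assumes data: "discrete_data N m x0"
    and evolution: "sticky_evolution N m x0 v0 x v"
begin

lemma m_pos: "i < N \<Longrightarrow> 0 < m i"
  and m_sum: "(\<Sum>i<N. m i) = 1"
  using data by (auto simp: discrete_data_def)

lemma x_0: "i < N \<Longrightarrow> x i 0 = x0 i"
  and v_0: "i < N \<Longrightarrow> v i 0 = v0 i"
  and x_cont: "i < N \<Longrightarrow> continuous_on {0..} (x i)"
  and x_mono: "t \<ge> 0 \<Longrightarrow> i \<le> j \<Longrightarrow> j < N \<Longrightarrow> x i t \<le> x j t"
  and x_deriv: "t \<ge> 0 \<Longrightarrow> i < N \<Longrightarrow> (x i has_real_derivative v i t) (at_right t)"
  and stick: "i < N \<Longrightarrow> 0 \<le> s \<Longrightarrow> s \<le> t \<Longrightarrow> cluster N x i s \<subseteq> cluster N x i t"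
  and finite_collisions: "finite (collision_times N x)"
  and v_const: "i < N \<Longrightarrow> 0 \<le> s \<Longrightarrow> s \<le> t \<Longrightarrow> {s<..t} \<inter> collision_times N x = {} \<Longrightarrow> v i s = v i t"
  and collision: "t \<in> collision_times N x \<Longrightarrow> \<exists>u. (\<forall>j<N. (v j \<longlongrightarrow> u j) (at_left t)) \<and>
       (\<forall>i<N. v i t = (\<Sum>j\<in>cluster N x i t. m j * u j) / (\<Sum>j\<in>cluster N x i t. m j))"
  using evolution unfolding sticky_evolution_def by simp_all

lemma stick_eq: "i < N \<Longrightarrow> j < N \<Longrightarrow> 0 \<le> s \<Longrightarrow> s \<le> t \<Longrightarrow> x i s = x j s \<Longrightarrow> x i t = x j t"
  using stick[of i s t] by (auto simp: cluster_def)

lemma x_linear: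
  assumes "i < N" "0 \<le> s" "s \<le> t" "{s<..<t} \<inter> collision_times N x = {}"
  shows "x i t - x i s = v i s * (t - s)"
proof -
  have d: "(x i has_real_derivative v i s) (at_right r)" if "s \<le> r" "r < t" for r
  proof -
    have "{s<..r} \<inter> collision_times N x \<subseteq> {s<..<t} \<inter> collision_times N x" using that by auto
    then have "{s<..r} \<inter> collision_times N x = {}" using assms(4) by simp
    then have "v i s = v i r" using v_const[of i s r] assms that by auto
    then show ?thesis using x_deriv[of r i] that assms by simp
  qed
  have c: "continuous_on {s..t} (x i)"
    using x_cont[OF assms(1)] assms(2) by (auto elim: continuous_on_subset)
  have "x i t - x i s \<le> v i s * (t - s)"
    by (rule increment_le_if_right_derivative_le[where f' = "\<lambda>_. v i s"]) (use c d assms in auto)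
  moreover have "- x i t - - x i s \<le> - v i s * (t - s)"
    by (rule increment_le_if_right_derivative_le[where f = "\<lambda>t. - x i t" and f' = "\<lambda>_. - v i s"])
      (use c d assms in \<open>auto intro!: continuous_intros DERIV_minus\<close>)
  ultimately show ?thesis by simp
qed

text \<open>Velocities change in collisions only. Particles that meet at time \<open>c\<close> were ordered before, so their
  incoming velocities are nonincreasing in the index, and averaging them cannot lower a moment against
  weights that are nondecreasing within clusters. As the hypothesis on \<open>z\<close> is restricted to clusters,
  weights that are constant on clusters are admissible together with their negatives and yield
  conservation.\<close>

lemma momentum_le:
  assumes "0 \<le> s" "s \<le> T"
    and z: "\<And>t i j. 0 < t \<Longrightarrow> t \<le> T \<Longrightarrow> i \<le> j \<Longrightarrow> j < N \<Longrightarrow> x i t = x j t \<Longrightarrow> z i \<le> z j"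
  shows "(\<Sum>i<N. m i * v i s * z i) \<le> (\<Sum>i<N. m i * v i T * z i)"
  using assms(2,3)
proof (induction "card ({s<..T} \<inter> collision_times N x)" arbitrary: T rule: less_induct)
  case less
  let ?C = "{s<..T} \<inter> collision_times N x"
  have fin: "finite ?C" using finite_collisions by auto
  show ?case
  proof (cases "?C = {}")
    case True
    then show ?thesis using v_const[of _ s T] assms(1) less.prems(1) by auto
  next
    case False
    define c where "c = Max ?C"
    have c: "c \<in> ?C" unfolding c_def using fin False by (rule Max_in)
    have cmax: "d \<le> c" if "d \<in> ?C" for d unfolding c_def using fin that by simp
    \<comment> \<open>the time from which the motion is free until the last collision \<open>c\<close>\<close>
    define r where "r = Max (insert s ({s<..<c} \<inter> collision_times N x))"
    have finr: "finite (insert s ({s<..<c} \<inter> collision_times N x))" using finite_collisions by auto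
    have "r \<in> insert s ({s<..<c} \<inter> collision_times N x)" unfolding r_def using finr by (rule Max_in) auto
    then have r: "s \<le> r" "r < c" using c by auto
    have free: "{r<..<c} \<inter> collision_times N x = {}"
    proof (rule ccontr)
      assume "{r<..<c} \<inter> collision_times N x \<noteq> {}"
      then obtain d where d: "r < d" "d < c" "d \<in> collision_times N x" by auto
      then have "d \<le> r" unfolding r_def using finr r by (intro Max_ge) auto
      with d show False by simp
    qed
    obtain u where u: "\<And>j. j < N \<Longrightarrow> (v j \<longlongrightarrow> u j) (at_left c)"
      and vc: "\<And>i. i < N \<Longrightarrow> v i c = (\<Sum>j\<in>cluster N x i c. m j * u j) / (\<Sum>j\<in>cluster N x i c. m j)"
      using collision[of c] c by blast
    have ur: "u j = v j r" if "j < N" for j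
    proof -
      have "eventually (\<lambda>t. v j t = v j r) (at_left c)"
        using eventually_at_left_real[OF r(2)]
      proof eventually_elim
        case (elim t)
        then have "{r<..t} \<inter> collision_times N x \<subseteq> {r<..<c} \<inter> collision_times N x" by auto
        then have "{r<..t} \<inter> collision_times N x = {}" using free by simp
        then show ?case using v_const[of j r t] elim r assms(1) that by auto
      qed
      then have "(v j \<longlongrightarrow> v j r) (at_left c)" by (rule tendsto_eventually)
      with u[OF that] show ?thesis by (intro tendsto_unique[of "at_left c"]) auto
    qed
    have "(\<Sum>i<N. m i * v i s * z i) \<le> (\<Sum>i<N. m i * v i r * z i)"
    proof (rule less.hyps)
      have "c \<notin> {s<..r} \<inter> collision_times N x" using r by auto
      moreover have "{s<..r} \<inter> collision_times N x \<subseteq> ?C" using r c by auto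
      ultimately have "{s<..r} \<inter> collision_times N x \<subset> ?C" using c by blast
      then show "card ({s<..r} \<inter> collision_times N x) < card ?C"
        by (intro psubset_card_mono fin)
      show "s \<le> r" by fact
      show "z i \<le> z j" if "0 < t" "t \<le> r" "i \<le> j" "j < N" "x i t = x j t" for t i j
        using that r c by (intro less.prems(2)[of t]) auto
    qed
    also have "\<dots> \<le> (\<Sum>i<N. m i * v i c * z i)"
    proof -
      have "(\<Sum>i<N. m i * v i c * z i) - (\<Sum>i<N. m i * v i r * z i)
          = (\<Sum>i<N. m i * ((\<Sum>j\<in>cluster N x i c. m j * u j) / (\<Sum>j\<in>cluster N x i c. m j) - u i) * z i)"
        unfolding sum_subtractf[symmetric] by (intro sum.cong refl) (simp add: vc ur algebra_simps)
      also have "\<dots> = (\<Sum>i<N. \<Sum>j\<in>cluster N x i c. m i * m j * (u j - u i) * (z i - z j) / (\<Sum>j\<in>cluster N x i c. m j)) / 2"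
        using m_pos by (rule sum_average_deviation)
      also have "\<dots> \<ge> 0"
      proof (intro divide_nonneg_nonneg sum_nonneg)
        fix i j assume i: "i \<in> {..<N}" and j: "j \<in> cluster N x i c"
        have key: "(u b - u a) * (z a - z b) \<ge> 0" if ab: "a \<le> b" "b < N" "x a c = x b c" for a b
        proof -
          have c0: "0 < c" using c assms(1) by auto
          have "z a \<le> z b" using c0 c ab by (intro less.prems(2)[of c]) auto
          moreover have "u b \<le> u a"
          proof -
            have "x a c - x a r = u a * (c - r)" "x b c - x b r = u b * (c - r)"
              using x_linear[of a r c] x_linear[of b r c] ab r assms(1) free ur by auto
            then have "(u a - u b) * (c - r) = x b r - x a r" using ab by (simp add: algebra_simps)
            also have "\<dots> \<ge> 0" using x_mono[of r a b] ab r assms(1) by simp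
            finally show ?thesis using r by (simp add: zero_le_mult_iff)
          qed
          ultimately show ?thesis by (intro mult_nonpos_nonpos) auto
        qed
        have "(u j - u i) * (z i - z j) \<ge> 0"
          using key[of i j] key[of j i] i j by (cases "i \<le> j") (auto simp: cluster_def algebra_simps)
        then show "m i * m j * (u j - u i) * (z i - z j) \<ge> 0"
          using m_pos[of i] m_pos[of j] i j by (auto simp: cluster_def mult.assoc intro!: mult_nonneg_nonneg)
      next
        fix i j k assume "k \<in> cluster N x i c"
        then show "0 \<le> m k" using m_pos[of k] by (simp add: cluster_def)
      qed auto
      finally show ?thesis by simp
    qed
    also have "\<dots> = (\<Sum>i<N. m i * v i T * z i)"
    proof -
      have "{c<..T} \<inter> collision_times N x = {}"
      proof (rule ccontr)
        assume "{c<..T} \<inter> collision_times N x \<noteq> {}"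
        then obtain d where "c < d" "d \<le> T" "d \<in> collision_times N x" by auto
        then show False using cmax[of d] c by auto
      qed
      then show ?thesis using v_const[of _ c T] c assms(1) by auto
    qed
    finally show ?thesis .
  qed
qed

lemma moment_deriv:
  "t \<ge> 0 \<Longrightarrow> ((\<lambda>t. \<Sum>i<N. m i * x i t * z i) has_real_derivative (\<Sum>i<N. m i * v i t * z i)) (at_right t)"
  by (auto intro!: derivative_eq_intros x_deriv sum.cong)

lemma moment_cont: "continuous_on {0..} (\<lambda>t. \<Sum>i<N. m i * x i t * z i)"
  by (auto intro!: continuous_intros x_cont)

text \<open>The moment of the positions has a nondecreasing right derivative by \<open>momentum_le\<close>, so it is convex:
  it lies above its tangent at \<open>s\<close>, both at \<open>T\<close> and at \<open>0\<close>.\<close>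

lemma moment_tangent:
  assumes "0 \<le> s" "s \<le> T"
    and z: "\<And>t i j. 0 < t \<Longrightarrow> t \<le> T \<Longrightarrow> i \<le> j \<Longrightarrow> j < N \<Longrightarrow> x i t = x j t \<Longrightarrow> z i \<le> z j"
  shows "(\<Sum>i<N. m i * v i s * z i) * (T - s) \<le> (\<Sum>i<N. m i * x i T * z i) - (\<Sum>i<N. m i * x i s * z i)"
    and "(\<Sum>i<N. m i * x i s * z i) - (\<Sum>i<N. m i * x i 0 * z i) \<le> (\<Sum>i<N. m i * v i s * z i) * s"
proof -
  let ?q = "\<lambda>t. \<Sum>i<N. m i * x i t * z i" and ?p = "\<lambda>t. \<Sum>i<N. m i * v i t * z i"
  have p: "?p a \<le> ?p b" if "0 \<le> a" "a \<le> b" "b \<le> T" for a b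
    using that by (intro momentum_le) (auto intro: z)
  have "- ?q T - - ?q s \<le> - ?p s * (T - s)"
    by (rule increment_le_if_right_derivative_le[where f = "\<lambda>t. - ?q t" and f' = "\<lambda>t. - ?p t"])
      (use assms in \<open>auto intro!: DERIV_minus moment_deriv continuous_on_minus
         continuous_on_subset[OF moment_cont] p\<close>)
  then show "?p s * (T - s) \<le> ?q T - ?q s" by simp
  have "?q s - ?q 0 \<le> ?p s * (s - 0)"
    by (rule increment_le_if_right_derivative_le[where f = ?q and f' = ?p])
      (use assms in \<open>auto intro!: moment_deriv continuous_on_subset[OF moment_cont] p\<close>)
  then show "?q s - ?q 0 \<le> ?p s * s" by simp
qed

lemma moment_ge:
  assumes "0 \<le> t" and z: "\<And>i j. i \<le> j \<Longrightarrow> j < N \<Longrightarrow> z i \<le> z j"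
  shows "t * (\<Sum>i<N. m i * v0 i * z i) \<le> (\<Sum>i<N. m i * x i t * z i) - (\<Sum>i<N. m i * x0 i * z i)"
  using moment_tangent(1)[of 0 t z] assms by (simp add: x_0 v_0 mult.commute)

text \<open>The difference quotients at 0 of a convex function are nondecreasing.\<close>

lemma moment_quotient_le:
  assumes "0 < s" "s \<le> t" and z: "\<And>i j. i \<le> j \<Longrightarrow> j < N \<Longrightarrow> z i \<le> z j"
  shows "t * ((\<Sum>i<N. m i * x i s * z i) - (\<Sum>i<N. m i * x0 i * z i))
       \<le> s * ((\<Sum>i<N. m i * x i t * z i) - (\<Sum>i<N. m i * x0 i * z i))"
proof -
  define qt qs q0 p where "qt = (\<Sum>i<N. m i * x i t * z i)" "qs = (\<Sum>i<N. m i * x i s * z i)"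
    "q0 = (\<Sum>i<N. m i * x0 i * z i)" "p = (\<Sum>i<N. m i * v i s * z i)"
  note defs = this
  have "p * (t - s) \<le> qt - qs" "qs - q0 \<le> p * s"
    using moment_tangent[of s t z] assms by (auto simp: defs x_0)
  then have "s * (p * (t - s)) \<le> s * (qt - qs)" "(t - s) * (qs - q0) \<le> (t - s) * (p * s)"
    using assms by (auto intro!: mult_left_mono)
  then have "t * (qs - q0) \<le> s * (qt - q0)" by (simp add: algebra_simps)
  then show ?thesis by (simp add: defs)
qed

text \<open>Stickiness makes weights that are constant on the clusters of time \<open>t\<close> constant on the clusters
  of all earlier times. Up to \<open>t\<close> both \<open>z\<close> and \<open>-z\<close> have convex moments, which are thus affine.\<close>

lemma moment_eq:
  assumes "0 \<le> s" "s \<le> t" and z: "\<And>i j. i < N \<Longrightarrow> j < N \<Longrightarrow> x i t = x j t \<Longrightarrow> z i = z j"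
  shows "(\<Sum>i<N. m i * x i s * z i) - (\<Sum>i<N. m i * x0 i * z i) = s * (\<Sum>i<N. m i * v0 i * z i)"
proof -
  have z': "z i = z j" if "0 < r" "r \<le> s" "i < N" "j < N" "x i r = x j r" for r i j
    using stick_eq[of i j r t] that assms by (intro z) auto
  have z1: "z i \<le> z j" if "0 < r" "r \<le> s" "i \<le> j" "j < N" "x i r = x j r" for r i j
    using z'[of r i j] that by simp
  have z2: "- z i \<le> - z j" if "0 < r" "r \<le> s" "i \<le> j" "j < N" "x i r = x j r" for r i j
    using z'[of r i j] that by simp
  have "(\<Sum>i<N. m i * v i 0 * z i) * (s - 0) \<le> (\<Sum>i<N. m i * x i s * z i) - (\<Sum>i<N. m i * x i 0 * z i)"
    by (rule moment_tangent(1)) (use assms(1) z1 in auto)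
  moreover have "(\<Sum>i<N. m i * v i 0 * - z i) * (s - 0) \<le> (\<Sum>i<N. m i * x i s * - z i) - (\<Sum>i<N. m i * x i 0 * - z i)"
    by (rule moment_tangent(1)) (use assms(1) z2 in auto)
  ultimately show ?thesis by (simp add: x_0 v_0 sum_negf algebra_simps)
qed

end


section \<open>Square integrable functions\<close>

definition square_integrable :: "'a measure \<Rightarrow> ('a \<Rightarrow> real) \<Rightarrow> bool" where
  "square_integrable M f \<longleftrightarrow> f \<in> borel_measurable M \<and> integrable M (\<lambda>x. (f x)\<^sup>2)"

definition L2_norm :: "'a measure \<Rightarrow> ('a \<Rightarrow> real) \<Rightarrow> real" where
  "L2_norm M f = sqrt (\<integral>x. (f x)\<^sup>2 \<partial>M)"

lemma square_integrable_measurable: "square_integrable M f \<Longrightarrow> f \<in> borel_measurable M"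
  and square_integrableD: "square_integrable M f \<Longrightarrow> integrable M (\<lambda>x. (f x)\<^sup>2)"
  by (auto simp: square_integrable_def)

lemma square_integrable_mult:
  assumes "square_integrable M f" "square_integrable M g"
  shows "integrable M (\<lambda>x. f x * g x)"
proof (rule Bochner_Integration.integrable_bound)
  note [measurable] = assms[THEN square_integrable_measurable]
  show "integrable M (\<lambda>x. (f x)\<^sup>2 + (g x)\<^sup>2)"
    using assms by (auto intro: square_integrableD)
  show "(\<lambda>x. f x * g x) \<in> borel_measurable M" by measurable
  show "AE x in M. norm (f x * g x) \<le> norm ((f x)\<^sup>2 + (g x)\<^sup>2)"
  proof (intro AE_I2)
    fix x
    have "2 * (\<bar>f x\<bar> * \<bar>g x\<bar>) \<le> (f x)\<^sup>2 + (g x)\<^sup>2" using sum_squares_bound[of "\<bar>f x\<bar>" "\<bar>g x\<bar>"] by simp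
    moreover have "0 \<le> \<bar>f x\<bar> * \<bar>g x\<bar>" by simp
    ultimately have "\<bar>f x\<bar> * \<bar>g x\<bar> \<le> (f x)\<^sup>2 + (g x)\<^sup>2" by linarith
    then show "norm (f x * g x) \<le> norm ((f x)\<^sup>2 + (g x)\<^sup>2)" by (simp add: abs_mult)
  qed
qed

lemma square_integrable_add:
  assumes "square_integrable M f" "square_integrable M g"
  shows "square_integrable M (\<lambda>x. f x + g x)"
  unfolding square_integrable_def
proof
  show "(\<lambda>x. f x + g x) \<in> borel_measurable M"
    by (intro borel_measurable_add square_integrable_measurable assms)
  have "integrable M (\<lambda>x. (f x)\<^sup>2 + (g x)\<^sup>2 + 2 * (f x * g x))"
    using assms by (intro Bochner_Integration.integrable_add integrable_mult_right square_integrableD square_integrable_mult)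
  then show "integrable M (\<lambda>x. (f x + g x)\<^sup>2)" by (simp add: power2_sum mult.assoc)
qed

lemma square_integrable_cmult:
  assumes "square_integrable M f" shows "square_integrable M (\<lambda>x. c * f x)"
  using assms by (auto simp: square_integrable_def power_mult_distrib)

lemma square_integrable_diff:
  assumes "square_integrable M f" "square_integrable M g"
  shows "square_integrable M (\<lambda>x. f x - g x)"
  using square_integrable_add[OF assms(1) square_integrable_cmult[OF assms(2), of "-1"]] by simp

lemma L2_norm_nonneg: "0 \<le> L2_norm M f"
  by (simp add: L2_norm_def integral_nonneg_AE)

lemma L2_norm_square: "(L2_norm M f)\<^sup>2 = (\<integral>x. (f x)\<^sup>2 \<partial>M)"
  by (simp add: L2_norm_def integral_nonneg_AE)

lemma L2_norm_cmult: "L2_norm M (\<lambda>x. c * f x) = \<bar>c\<bar> * L2_norm M f"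
  by (simp add: L2_norm_def power_mult_distrib real_sqrt_mult)

lemma L2_norm_diff_commute: "L2_norm M (\<lambda>x. f x - g x) = L2_norm M (\<lambda>x. g x - f x)"
  by (simp add: L2_norm_def power2_commute)

lemma L2_norm_cong_AE:
  assumes "f \<in> borel_measurable M" "g \<in> borel_measurable M" "AE x in M. f x = g x"
  shows "L2_norm M f = L2_norm M g"
proof -
  have "(\<integral>x. (f x)\<^sup>2 \<partial>M) = (\<integral>x. (g x)\<^sup>2 \<partial>M)"
    using assms by (intro integral_cong_AE) auto
  then show ?thesis by (simp add: L2_norm_def)
qed

lemma L2_norm_eq_0_AE:
  assumes "square_integrable M f" "L2_norm M f = 0"
  shows "AE x in M. f x = 0"
proof -
  have "(\<integral>x. (f x)\<^sup>2 \<partial>M) = 0" using assms(2) by (simp add: L2_norm_def)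
  then have "AE x in M. (f x)\<^sup>2 = 0"
    using integral_nonneg_eq_0_iff_AE[OF square_integrableD[OF assms(1)]] by simp
  then show ?thesis by simp
qed

text \<open>If both norms are positive, this is the nonnegativity of the integral of \<open>(b f - a g)\<^sup>2\<close> for the norms
  \<open>a\<close> of \<open>f\<close> and \<open>b\<close> of \<open>g\<close>.\<close>

lemma inner_le_L2_norm:
  assumes f: "square_integrable M f" and g: "square_integrable M g"
  shows "(\<integral>x. f x * g x \<partial>M) \<le> L2_norm M f * L2_norm M g"
proof (cases "L2_norm M f = 0 \<or> L2_norm M g = 0")
  case True
  then have "AE x in M. f x * g x = 0"
  proof
    assume "L2_norm M f = 0"
    then show ?thesis using L2_norm_eq_0_AE[OF f] by auto
  next
    assume "L2_norm M g = 0"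
    then show ?thesis using L2_norm_eq_0_AE[OF g] by auto
  qed
  then have "(\<integral>x. f x * g x \<partial>M) = 0" by (rule integral_eq_zero_AE)
  then show ?thesis by (simp add: L2_norm_nonneg)
next
  case False
  define a b where "a = L2_norm M f" "b = L2_norm M g"
  have pos: "a > 0" "b > 0"
    using False L2_norm_nonneg[of M f] L2_norm_nonneg[of M g] by (auto simp: a_b_def)
  have "0 \<le> (\<integral>x. (b * f x - a * g x)\<^sup>2 \<partial>M)" by simp
  also have "\<dots> = (\<integral>x. b\<^sup>2 * (f x)\<^sup>2 + a\<^sup>2 * (g x)\<^sup>2 - 2 * a * b * (f x * g x) \<partial>M)"
    by (intro Bochner_Integration.integral_cong) (auto simp: power2_eq_square algebra_simps)
  also have "\<dots> = b\<^sup>2 * a\<^sup>2 + a\<^sup>2 * b\<^sup>2 - 2 * a * b * (\<integral>x. f x * g x \<partial>M)"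
    using f g by (simp add: square_integrableD square_integrable_mult a_b_def L2_norm_square)
  finally have "(a * b) * (\<integral>x. f x * g x \<partial>M) \<le> (a * b) * (a * b)"
    by (simp add: power2_eq_square algebra_simps)
  then have "(\<integral>x. f x * g x \<partial>M) \<le> a * b"
    using pos by (subst (asm) mult_le_cancel_left_pos) auto
  then show ?thesis by (simp add: a_b_def)
qed

lemma L2_norm_triangle:
  assumes f: "square_integrable M f" and g: "square_integrable M g"
  shows "L2_norm M (\<lambda>x. f x + g x) \<le> L2_norm M f + L2_norm M g"
proof (rule power2_le_imp_le)
  have "(L2_norm M (\<lambda>x. f x + g x))\<^sup>2 = (\<integral>x. (f x)\<^sup>2 + (g x)\<^sup>2 + 2 * (f x * g x) \<partial>M)"
    unfolding L2_norm_square by (intro Bochner_Integration.integral_cong) (auto simp: power2_eq_square algebra_simps)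
  also have "\<dots> = (L2_norm M f)\<^sup>2 + (L2_norm M g)\<^sup>2 + 2 * (\<integral>x. f x * g x \<partial>M)"
    using f g by (simp add: square_integrableD square_integrable_mult L2_norm_square)
  also have "\<dots> \<le> (L2_norm M f)\<^sup>2 + (L2_norm M g)\<^sup>2 + 2 * (L2_norm M f * L2_norm M g)"
    using inner_le_L2_norm[OF f g] by simp
  also have "\<dots> = (L2_norm M f + L2_norm M g)\<^sup>2" by (simp add: power2_sum)
  finally show "(L2_norm M (\<lambda>x. f x + g x))\<^sup>2 \<le> (L2_norm M f + L2_norm M g)\<^sup>2" .
qed (simp add: L2_norm_nonneg)

lemma L2_norm_triangle_diff:
  assumes f: "square_integrable M f" and g: "square_integrable M g" and h: "square_integrable M h"
  shows "L2_norm M (\<lambda>x. f x - h x) \<le> L2_norm M (\<lambda>x. f x - g x) + L2_norm M (\<lambda>x. g x - h x)"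
  using L2_norm_triangle[OF square_integrable_diff[OF f g] square_integrable_diff[OF g h]] by simp


section \<open>Increasing couplings are optimal\<close>

text \<open>The square of the positive part is twice the area of the triangle \<open>y \<le> s < r \<le> x\<close>. Being an integral
  of nonnegative functions, this representation needs no integrability when integrals are exchanged.\<close>

lemma nn_integral_layers:
  fixes x y :: real
  shows "(\<integral>\<^sup>+r. (\<integral>\<^sup>+s. (if y \<le> s \<and> s < r \<and> r \<le> x then 2 else 0) \<partial>lborel) \<partial>lborel) = ennreal ((max 0 (x - y))\<^sup>2)"
proof (cases "y \<le> x")
  case True
  have "(\<integral>\<^sup>+s. (if y \<le> s \<and> s < r \<and> r \<le> x then 2 else 0) \<partial>lborel) = ennreal (2 * (r - y)) * indicator {y..x} r" for r
  proof (cases "y \<le> r \<and> r \<le> x")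
    case True
    have "(\<integral>\<^sup>+s. (if y \<le> s \<and> s < r \<and> r \<le> x then 2 else 0) \<partial>lborel) = (\<integral>\<^sup>+s. 2 * indicator {y..<r} s \<partial>lborel)"
      using True by (intro nn_integral_cong) (auto simp: indicator_def)
    also have "\<dots> = 2 * ennreal (r - y)"
      using True by (subst nn_integral_cmult_indicator) auto
    also have "\<dots> = ennreal (2 * (r - y))" using True by (subst ennreal_mult) auto
    finally show ?thesis using True by simp
  next
    case False
    then have "(if y \<le> s \<and> s < r \<and> r \<le> x then 2 else 0) = (0::ennreal)" for s by auto
    then show ?thesis using False by (simp add: indicator_def)
  qed
  then have "(\<integral>\<^sup>+r. (\<integral>\<^sup>+s. (if y \<le> s \<and> s < r \<and> r \<le> x then 2 else 0) \<partial>lborel) \<partial>lborel)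
    = (\<integral>\<^sup>+r. ennreal (2 * (r - y)) * indicator {y..x} r \<partial>lborel)" by simp
  also have "\<dots> = ennreal ((x - y)\<^sup>2 - (y - y)\<^sup>2)"
    by (rule nn_integral_FTC_Icc) (use True in \<open>auto intro!: derivative_eq_intros\<close>)
  finally show ?thesis using True by simp
next
  case False
  then have "(if y \<le> s \<and> s < r \<and> r \<le> x then 2 else 0) = (0::ennreal)" for s r by auto
  then show ?thesis using False by simp
qed

text \<open>The expectation of the squared positive part of \<open>X - Y\<close>, split into layers. It sees the joint law
  only through the probabilities of \<open>Y \<le> s, r \<le> X\<close>, so that couplings can be compared layer by layer.\<close>

definition excess_layers :: "'a measure \<Rightarrow> ('a \<Rightarrow> real) \<Rightarrow> ('a \<Rightarrow> real) \<Rightarrow> ennreal" where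
  "excess_layers M X Y = (\<integral>\<^sup>+p. (if snd p < fst p then 2 else 0) *
      emeasure M {\<omega>\<in>space M. Y \<omega> \<le> snd p \<and> fst p \<le> X \<omega>} \<partial>(lborel \<Otimes>\<^sub>M lborel))"

lemma nn_integral_excess_square:
  assumes "prob_space M" and [measurable]: "X \<in> borel_measurable M" "Y \<in> borel_measurable M"
  shows "(\<integral>\<^sup>+\<omega>. ennreal ((max 0 (X \<omega> - Y \<omega>))\<^sup>2) \<partial>M) = excess_layers M X Y"
proof -
  interpret prob_space M by fact
  interpret L: pair_sigma_finite "lborel :: real measure" "lborel :: real measure" ..
  interpret prod: pair_sigma_finite M "(lborel :: real measure) \<Otimes>\<^sub>M (lborel :: real measure)" ..
  let ?f = "\<lambda>\<omega> p. if Y \<omega> \<le> snd p \<and> snd p < fst p \<and> fst p \<le> X \<omega> then 2 else (0::ennreal)"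
  have "ennreal ((max 0 (X \<omega> - Y \<omega>))\<^sup>2) = (\<integral>\<^sup>+p. ?f \<omega> p \<partial>(lborel \<Otimes>\<^sub>M lborel))" for \<omega>
    unfolding nn_integral_layers[symmetric]
    by (subst lborel.nn_integral_fst[symmetric]) auto
  then have "(\<integral>\<^sup>+\<omega>. ennreal ((max 0 (X \<omega> - Y \<omega>))\<^sup>2) \<partial>M) = (\<integral>\<^sup>+\<omega>. (\<integral>\<^sup>+p. ?f \<omega> p \<partial>(lborel \<Otimes>\<^sub>M lborel)) \<partial>M)"
    by simp
  also have "\<dots> = (\<integral>\<^sup>+p. (\<integral>\<^sup>+\<omega>. ?f \<omega> p \<partial>M) \<partial>(lborel \<Otimes>\<^sub>M lborel))"
    by (rule prod.Fubini'[symmetric]) measurable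
  also have "\<dots> = excess_layers M X Y"
    unfolding excess_layers_def
  proof (intro nn_integral_cong)
    fix p :: "real \<times> real"
    have "(\<integral>\<^sup>+\<omega>. ?f \<omega> p \<partial>M) = (\<integral>\<^sup>+\<omega>. (if snd p < fst p then 2 else 0) * indicator {\<omega>\<in>space M. Y \<omega> \<le> snd p \<and> fst p \<le> X \<omega>} \<omega> \<partial>M)"
      by (intro nn_integral_cong) (auto simp: indicator_def)
    then show "(\<integral>\<^sup>+\<omega>. ?f \<omega> p \<partial>M) = (if snd p < fst p then 2 else 0) * emeasure M {\<omega>\<in>space M. Y \<omega> \<le> snd p \<and> fst p \<le> X \<omega>}"
      by (simp add: nn_integral_cmult_indicator)
  qed
  finally show ?thesis .
qed

lemma nn_integral_square_layers:
  assumes "prob_space M" and [measurable]: "X \<in> borel_measurable M" "Y \<in> borel_measurable M"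
  shows "(\<integral>\<^sup>+\<omega>. ennreal ((X \<omega> - Y \<omega>)\<^sup>2) \<partial>M) = excess_layers M X Y + excess_layers M Y X"
proof -
  have "ennreal ((X \<omega> - Y \<omega>)\<^sup>2) = ennreal ((max 0 (X \<omega> - Y \<omega>))\<^sup>2) + ennreal ((max 0 (Y \<omega> - X \<omega>))\<^sup>2)" for \<omega>
    by (subst ennreal_plus[symmetric]) (auto simp: max_def power2_commute)
  then show ?thesis
    using assms by (simp add: nn_integral_add nn_integral_excess_square)
qed

definition unif :: "real measure" where
  "unif = restrict_space lborel {0<..<1}"

lemma space_unif: "space unif = {0<..<1}"
  by (simp add: unif_def space_restrict_space)

lemma prob_space_unif: "prob_space unif"
  unfolding unif_def by (rule prob_space_restrict_space) auto

interpretation unif: prob_space unif by (rule prob_space_unif)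

text \<open>Monotonicity off a null set, as a representative of an \<open>L\<^sup>2\<close> function is monotone no better than that.\<close>

definition ae_increasing :: "(real \<Rightarrow> real) \<Rightarrow> bool" where
  "ae_increasing X \<longleftrightarrow> X \<in> borel_measurable unif \<and> (\<exists>A\<in>null_sets unif. mono_on ({0<..<1} - A) X)"

lemma ae_increasing_measurable: "ae_increasing X \<Longrightarrow> X \<in> borel_measurable unif"
  by (simp add: ae_increasing_def)

text \<open>For two increasing functions the events \<open>Y \<le> s\<close> and \<open>X < r\<close> are nested up to a null set. Hence the
  probability of the former without the latter is the positive part of the difference of their
  probabilities, which is the least value that the two marginals permit.\<close>

lemma comonotone_layer_le:
  assumes X: "ae_increasing X" and Y: "ae_increasing Y"
    and M: "prob_space M" and [measurable]: "U \<in> borel_measurable M" "V \<in> borel_measurable M"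
    and dX: "distr M borel U = distr unif borel X" and dY: "distr M borel V = distr unif borel Y"
  shows "emeasure unif {\<omega>\<in>space unif. Y \<omega> \<le> s \<and> r \<le> X \<omega>} \<le> emeasure M {\<omega>\<in>space M. V \<omega> \<le> s \<and> r \<le> U \<omega>}"
proof -
  interpret M: prob_space M by fact
  note [measurable] = ae_increasing_measurable[OF X] ae_increasing_measurable[OF Y]
  obtain A B where A: "A \<in> null_sets unif" "mono_on ({0<..<1} - A) X"
    and B: "B \<in> null_sets unif" "mono_on ({0<..<1} - B) Y"
    using X Y by (auto simp: ae_increasing_def)
  have AE: "AE \<omega> in unif. \<omega> \<in> {0<..<1} - A - B"
    using AE_not_in[OF A(1)] AE_not_in[OF B(1)] AE_space[of unif] by eventually_elim (auto simp: space_unif)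
  define P where "P = {\<omega>\<in>space unif. Y \<omega> \<le> s}"
  define Q where "Q = {\<omega>\<in>space unif. X \<omega> < r}"
  have [measurable]: "P \<in> sets unif" "Q \<in> sets unif" unfolding P_def Q_def by measurable
  have eq: "{\<omega>\<in>space unif. Y \<omega> \<le> s \<and> r \<le> X \<omega>} = P - Q" by (auto simp: P_def Q_def)
  have mP: "measure unif P = measure M {\<omega>\<in>space M. V \<omega> \<le> s}"
  proof -
    have "measure (distr unif borel Y) {..s} = measure (distr M borel V) {..s}" by (simp add: dY)
    then show ?thesis by (simp add: measure_distr P_def vimage_def Int_def conj_commute)
  qed
  have mQ: "measure unif Q = measure M {\<omega>\<in>space M. U \<omega> < r}"
  proof -
    have "measure (distr unif borel X) {..<r} = measure (distr M borel U) {..<r}" by (simp add: dX)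
    then show ?thesis by (simp add: measure_distr Q_def vimage_def Int_def conj_commute)
  qed
  have low: "measure unif P - measure unif Q \<le> measure M {\<omega>\<in>space M. V \<omega> \<le> s \<and> r \<le> U \<omega>}"
  proof -
    have "measure M {\<omega>\<in>space M. V \<omega> \<le> s} \<le> measure M ({\<omega>\<in>space M. V \<omega> \<le> s \<and> r \<le> U \<omega>} \<union> {\<omega>\<in>space M. U \<omega> < r})"
      by (intro M.finite_measure_mono) auto
    also have "\<dots> \<le> measure M {\<omega>\<in>space M. V \<omega> \<le> s \<and> r \<le> U \<omega>} + measure M {\<omega>\<in>space M. U \<omega> < r}"
      by (intro measure_Un_le) auto
    finally show ?thesis by (simp add: mP mQ)
  qed
  have "measure unif (P - Q) \<le> max 0 (measure unif P - measure unif Q)"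
  proof (cases "\<exists>a\<in>P - Q. a \<in> {0<..<1} - A - B")
    case False
    have "AE \<omega> in unif. \<omega> \<notin> P - Q" using AE by eventually_elim (use False in auto)
    then have "P - Q \<in> null_sets unif" by (subst AE_iff_null_sets) auto
    then have "measure unif (P - Q) = 0" by (rule measure_eq_0_null_sets)
    then show ?thesis by simp
  next
    case True
    then obtain a where a: "a \<in> P" "a \<notin> Q" "a \<in> {0<..<1} - A - B" by auto
    \<comment> \<open>Points of \<open>Q\<close> lie to the left of \<open>a\<close>, and \<open>P\<close> contains what is to the left of \<open>a\<close>.\<close>
    have "AE \<omega> in unif. \<omega> \<in> Q \<longrightarrow> \<omega> \<in> P"
      using AE
    proof eventually_elim
      case (elim b)
      show ?case
      proof
        assume "b \<in> Q"
        then have "X b < X a" using a by (auto simp: Q_def P_def)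
        then have "b \<le> a" using mono_onD[OF A(2), of a b] a elim by (cases "a \<le> b") auto
        then have "Y b \<le> Y a" using mono_onD[OF B(2), of b a] a elim by auto
        then show "b \<in> P" using a elim by (auto simp: P_def space_unif)
      qed
    qed
    then have "measure unif (Q \<inter> P) = measure unif Q"
      by (intro unif.finite_measure_eq_AE) auto
    moreover have "measure unif (P - Q) = measure unif P - measure unif (P \<inter> Q)"
      by (simp add: unif.finite_measure_Diff')
    ultimately show ?thesis by (simp add: Int_commute)
  qed
  also have "\<dots> \<le> measure M {\<omega>\<in>space M. V \<omega> \<le> s \<and> r \<le> U \<omega>}" using low by simp
  finally show ?thesis
    unfolding eq by (simp add: unif.emeasure_eq_measure M.emeasure_eq_measure)
qed

lemma comonotone_cost_le:
  assumes X: "ae_increasing X" and Y: "ae_increasing Y"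
    and M: "prob_space M" and UV: "U \<in> borel_measurable M" "V \<in> borel_measurable M"
    and "distr M borel U = distr unif borel X" and "distr M borel V = distr unif borel Y"
  shows "(\<integral>\<^sup>+\<omega>. ennreal ((X \<omega> - Y \<omega>)\<^sup>2) \<partial>unif) \<le> (\<integral>\<^sup>+\<omega>. ennreal ((U \<omega> - V \<omega>)\<^sup>2) \<partial>M)"
  unfolding nn_integral_square_layers[OF prob_space_unif ae_increasing_measurable[OF X] ae_increasing_measurable[OF Y]]
    nn_integral_square_layers[OF M UV] excess_layers_def
  using assms by (intro add_mono nn_integral_mono mult_left_mono comonotone_layer_le) auto

text \<open>The joint law of \<open>X\<close> and \<open>Y\<close> is a coupling, and every layer of its cost is minimal by
  \<open>comonotone_layer_le\<close>.\<close>

lemma W2_comonotone: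
  assumes X: "ae_increasing X" and Y: "ae_increasing Y"
    and "square_integrable unif X" "square_integrable unif Y"
  shows "W2 (distr unif borel X) (distr unif borel Y) = L2_norm unif (\<lambda>w. X w - Y w)"
proof -
  note [measurable] = ae_increasing_measurable[OF X] ae_increasing_measurable[OF Y]
  let ?C = "couplings (distr unif borel X) (distr unif borel Y)"
  let ?c = "\<lambda>\<gamma>. \<integral>\<^sup>+z. ennreal ((fst z - snd z)\<^sup>2) \<partial>\<gamma>"
  let ?I = "\<integral>\<^sup>+\<omega>. ennreal ((X \<omega> - Y \<omega>)\<^sup>2) \<partial>unif"
  let ?\<gamma> = "distr unif (borel :: (real \<times> real) measure) (\<lambda>w. (X w, Y w))"
  have [measurable]: "(\<lambda>w. (X w, Y w)) \<in> unif \<rightarrow>\<^sub>M borel" by (rule borel_measurable_Pair) measurable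
  have "(INF \<gamma>\<in>?C. ?c \<gamma>) = ?I"
  proof (rule antisym)
    have [measurable]: "fst \<in> borel_measurable (borel :: (real \<times> real) measure)"
       "snd \<in> borel_measurable (borel :: (real \<times> real) measure)"
      by (auto intro!: borel_measurable_continuous_onI continuous_intros)
    have "?\<gamma> \<in> ?C" by (simp add: couplings_def distr_distr comp_def)
    moreover have "?c ?\<gamma> = ?I" by (subst nn_integral_distr) auto
    ultimately show "(INF \<gamma>\<in>?C. ?c \<gamma>) \<le> ?I" by (intro INF_lower2[of ?\<gamma>]) auto
    show "?I \<le> (INF \<gamma>\<in>?C. ?c \<gamma>)"
    proof (rule INF_greatest)
      fix \<gamma> assume g: "\<gamma> \<in> ?C"
      then have [simp, measurable_cong]: "sets \<gamma> = sets borel" by (simp add: couplings_def)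
      have m: "fst \<in> borel_measurable \<gamma>" "snd \<in> borel_measurable \<gamma>" by measurable
      have "prob_space (distr \<gamma> borel fst)"
        using g by (simp add: couplings_def unif.prob_space_distr)
      then have "prob_space \<gamma>" using m(1) by (rule prob_space_distrD[rotated])
      then show "?I \<le> ?c \<gamma>" using g m X Y by (intro comonotone_cost_le) (auto simp: couplings_def)
    qed
  qed
  moreover have "?I = ennreal (\<integral>w. (X w - Y w)\<^sup>2 \<partial>unif)"
    using square_integrable_diff[OF assms(3,4)] by (intro nn_integral_eq_integral) (auto simp: square_integrable_def)
  ultimately show ?thesis by (simp add: W2_def L2_norm_def)
qed


section \<open>The isometry given by quantile functions\<close>

lemma P2D:
  assumes "\<rho> \<in> P2"
  shows "prob_space \<rho>" "sets \<rho> = sets borel" "space \<rho> = UNIV" "integrable \<rho> (\<lambda>x. x\<^sup>2)" "real_distribution \<rho>"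
proof -
  show a: "prob_space \<rho>" "sets \<rho> = sets borel" "integrable \<rho> (\<lambda>x. x\<^sup>2)" using assms by (auto simp: P2_def)
  show b: "space \<rho> = UNIV" using sets_eq_imp_space_eq[OF a(2)] by simp
  show "real_distribution \<rho>" using a b by (auto simp: real_distribution_def real_distribution_axioms_def)
qed

text \<open>As \<open>X_of\<close> is the right-continuous inverse of the distribution function, the two implications differ in
  strictness. For given \<open>r\<close> they leave only the level \<open>w = measure \<rho> {..r}\<close> undecided, which is a null set.\<close>

lemma X_of_level:
  assumes "real_distribution \<rho>" and w: "0 < w" "w < 1"
  shows "w < measure \<rho> {..r} \<Longrightarrow> X_of \<rho> w \<le> r" and "X_of \<rho> w \<le> r \<Longrightarrow> w \<le> measure \<rho> {..r}"
    and "{x. w < measure \<rho> {..x}} \<noteq> {}" and "bdd_below {x. w < measure \<rho> {..x}}"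
proof -
  interpret real_distribution \<rho> by fact
  let ?S = "{x. w < measure \<rho> {..x}}"
  have "eventually (\<lambda>x. w < cdf \<rho> x) at_top" using cdf_lim_at_top_prob w by (intro order_tendstoD) auto
  then show ne: "?S \<noteq> {}" by (auto simp: eventually_at_top_linorder cdf_def)
  have "eventually (\<lambda>x. cdf \<rho> x < w) at_bot" using cdf_lim_at_bot w by (intro order_tendstoD) auto
  then obtain b where b: "\<And>x. x \<le> b \<Longrightarrow> measure \<rho> {..x} < w" by (auto simp: eventually_at_bot_linorder cdf_def)
  have bb: "b \<le> x" if "x \<in> ?S" for x using b[of x] that by (cases "x \<le> b") auto
  then show bdd: "bdd_below ?S" by (rule bdd_belowI)
  show "X_of \<rho> w \<le> r" if "w < measure \<rho> {..r}" unfolding X_of_def by (rule cInf_lower) (use that bdd in auto)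
  show "w \<le> measure \<rho> {..r}" if "X_of \<rho> w \<le> r"
  proof -
    have "w \<le> cdf \<rho> x" if "r < x" for x
    proof -
      have "X_of \<rho> w < x" using \<open>X_of \<rho> w \<le> r\<close> that by simp
      then obtain y where "y \<in> ?S" "y < x" using cInf_lessD[OF ne, of x] by (auto simp: X_of_def)
      then show ?thesis using cdf_nondecreasing[of y x] by (auto simp: cdf_def)
    qed
    then have "eventually (\<lambda>x. w \<le> cdf \<rho> x) (at_right r)"
      by (auto simp: eventually_at_right_field intro: exI[of _ "r + 1"])
    moreover have "(cdf \<rho> \<longlongrightarrow> cdf \<rho> r) (at_right r)" using cdf_is_right_cont[of r] by (simp add: continuous_within)
    ultimately have "w \<le> cdf \<rho> r" by (intro tendsto_lowerbound[of "cdf \<rho>" "cdf \<rho> r" "at_right r"]) auto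
    then show ?thesis by (simp add: cdf_def)
  qed
qed

lemma X_of_mono:
  assumes "real_distribution \<rho>" shows "mono_on {0<..<1} (X_of \<rho>)"
proof (rule mono_onI)
  fix v w :: real assume "v \<in> {0<..<1}" "w \<in> {0<..<1}" "v \<le> w"
  then show "X_of \<rho> v \<le> X_of \<rho> w"
    unfolding X_of_def using X_of_level[OF assms, of v] X_of_level[OF assms, of w]
    by (intro cInf_superset_mono) auto
qed

lemma X_of_increasing:
  assumes "real_distribution \<rho>" shows "ae_increasing (X_of \<rho>)"
proof -
  have "X_of \<rho> \<in> borel_measurable (restrict_space borel {0<..<1})"
    by (rule borel_measurable_mono_on_fnc[OF X_of_mono[OF assms]])
  moreover have "sets unif = sets (restrict_space borel {0<..<1::real})"
    unfolding unif_def by (rule sets_restrict_space_cong) simp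
  ultimately have "X_of \<rho> \<in> borel_measurable unif" by (simp cong: measurable_cong_sets)
  then show ?thesis using X_of_mono[OF assms] by (auto simp: ae_increasing_def intro!: bexI[of _ "{}"])
qed

lemma distr_X_of:
  assumes "real_distribution \<rho>" shows "distr unif borel (X_of \<rho>) = \<rho>"
proof (rule cdf_unique)
  interpret real_distribution \<rho> by fact
  note [measurable] = ae_increasing_measurable[OF X_of_increasing[OF assms]]
  show "real_distribution (distr unif borel (X_of \<rho>))" by (rule unif.real_distribution_distr) measurable
  show "real_distribution \<rho>" by fact
  show "cdf (distr unif borel (X_of \<rho>)) = cdf \<rho>"
  proof
    fix r
    let ?F = "measure \<rho> {..r}"
    let ?E = "{w. 0 < w \<and> w < 1 \<and> X_of \<rho> w \<le> r}"
    have "?E = {w \<in> space unif. X_of \<rho> w \<le> r}" by (auto simp: space_unif)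
    also have "\<dots> \<in> sets unif" by measurable
    finally have E: "?E \<in> sets unif" .
    then have E': "?E \<in> sets lborel" by (simp add: unif_def sets_restrict_space_iff)
    have "cdf (distr unif borel (X_of \<rho>)) r = measure unif ?E"
      unfolding cdf_def by (subst measure_distr) (auto simp: space_unif intro!: arg_cong[of _ _ "measure unif"])
    also have "\<dots> = measure lborel ?E"
      unfolding unif_def by (rule measure_restrict_space) auto
    also have "\<dots> = ?F"
    proof (rule antisym)
      have "?E \<subseteq> {0<..?F}" using X_of_level(2)[OF assms] by auto
      then have "measure lborel ?E \<le> measure lborel {0<..?F}"
        using E' by (intro measure_mono_fmeasurable) (auto simp: fmeasurable_def)
      then show "measure lborel ?E \<le> ?F" by simp
      have sub: "{0<..<?F} \<subseteq> ?E" 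
      proof
        fix w assume w: "w \<in> {0<..<?F}"
        then have "w < ?F" by simp
        then have "w < 1" by (rule less_le_trans) (rule prob_le_1)
        then show "w \<in> ?E" using w X_of_level(1)[OF assms, of w r] by auto
      qed
      have "measure lborel {0<..<?F} \<le> measure lborel ?E"
      proof (rule measure_mono_fmeasurable[OF sub])
        show "?E \<in> fmeasurable lborel" by (rule fmeasurableI2[of "{0..1}"]) (use E' in \<open>auto simp: fmeasurable_def\<close>)
      qed simp
      then show "?F \<le> measure lborel ?E" by simp
    qed
    finally show "cdf (distr unif borel (X_of \<rho>)) r = cdf \<rho> r" by (simp add: cdf_def)
  qed
qed

lemma measurable_X_of [measurable]: "\<rho> \<in> P2 \<Longrightarrow> X_of \<rho> \<in> borel_measurable unif"
  by (intro ae_increasing_measurable X_of_increasing P2D)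

lemma square_integrable_comp_X_of:
  assumes r: "\<rho> \<in> P2" and v: "v \<in> borel_measurable borel"
  shows "square_integrable unif (\<lambda>w. v (X_of \<rho> w)) \<longleftrightarrow> integrable \<rho> (\<lambda>x. (v x)\<^sup>2)"
    and "L2_norm unif (\<lambda>w. v (X_of \<rho> w)) = L2_norm \<rho> v"
    and "distr unif borel (\<lambda>w. v (X_of \<rho> w)) = distr \<rho> borel v"
proof -
  note [measurable] = measurable_X_of[OF r] v
  have d: "distr unif borel (X_of \<rho>) = \<rho>" by (rule distr_X_of[OF P2D(5)[OF r]])
  have "integrable \<rho> (\<lambda>x. (v x)\<^sup>2) = integrable (distr unif borel (X_of \<rho>)) (\<lambda>x. (v x)\<^sup>2)" by (simp add: d)
  also have "\<dots> = integrable unif (\<lambda>w. (v (X_of \<rho> w))\<^sup>2)" by (rule integrable_distr_eq) measurable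
  finally show "square_integrable unif (\<lambda>w. v (X_of \<rho> w)) \<longleftrightarrow> integrable \<rho> (\<lambda>x. (v x)\<^sup>2)"
    by (simp add: square_integrable_def)
  have "(\<integral>x. (v x)\<^sup>2 \<partial>\<rho>) = (\<integral>x. (v x)\<^sup>2 \<partial>distr unif borel (X_of \<rho>))" by (simp add: d)
  also have "\<dots> = (\<integral>w. (v (X_of \<rho> w))\<^sup>2 \<partial>unif)" by (rule integral_distr) measurable
  finally show "L2_norm unif (\<lambda>w. v (X_of \<rho> w)) = L2_norm \<rho> v" by (simp add: L2_norm_def)
  have "distr unif borel (\<lambda>w. v (X_of \<rho> w)) = distr (distr unif borel (X_of \<rho>)) borel v"
    by (subst distr_distr) (auto simp: comp_def)
  then show "distr unif borel (\<lambda>w. v (X_of \<rho> w)) = distr \<rho> borel v" by (simp add: d)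
qed

lemma square_integrable_X_of: "\<rho> \<in> P2 \<Longrightarrow> square_integrable unif (X_of \<rho>)"
  using square_integrable_comp_X_of(1)[of \<rho> "\<lambda>x. x"] by (simp add: P2D)

lemma distr_in_P2:
  assumes "prob_space M" "square_integrable M X"
  shows "distr M borel X \<in> P2"
  using assms by (auto simp: P2_def square_integrable_def integrable_distr_eq intro: prob_space.prob_space_distr)

text \<open>The isometry with a subset of \<open>L\<^sup>2(0,1)\<close>, from which \<open>W2\<close> inherits the properties of a metric.\<close>

lemma W2_eq:
  assumes "\<rho> \<in> P2" "\<sigma> \<in> P2"
  shows "W2 \<rho> \<sigma> = L2_norm unif (\<lambda>w. X_of \<rho> w - X_of \<sigma> w)"
  using W2_comonotone[OF X_of_increasing[OF P2D(5)[OF assms(1)]] X_of_increasing[OF P2D(5)[OF assms(2)]]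
    square_integrable_X_of[OF assms(1)] square_integrable_X_of[OF assms(2)]]
  by (simp add: distr_X_of P2D assms)

lemma W2_le_L2_norm:
  assumes M: "prob_space M" and U: "square_integrable M U" and V: "square_integrable M V"
  shows "W2 (distr M borel U) (distr M borel V) \<le> L2_norm M (\<lambda>\<omega>. U \<omega> - V \<omega>)"
proof -
  let ?r = "distr M borel U" and ?s = "distr M borel V"
  have r: "?r \<in> P2" and s: "?s \<in> P2" using assms by (auto intro: distr_in_P2)
  have "(\<integral>\<^sup>+w. ennreal ((X_of ?r w - X_of ?s w)\<^sup>2) \<partial>unif) \<le> (\<integral>\<^sup>+\<omega>. ennreal ((U \<omega> - V \<omega>)\<^sup>2) \<partial>M)"
    using assms r s by (intro comonotone_cost_le)
      (auto simp: distr_X_of P2D square_integrable_measurable intro!: X_of_increasing)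
  moreover have "(\<integral>\<^sup>+w. ennreal ((X_of ?r w - X_of ?s w)\<^sup>2) \<partial>unif) = ennreal (\<integral>w. (X_of ?r w - X_of ?s w)\<^sup>2 \<partial>unif)"
    using square_integrable_diff[OF square_integrable_X_of[OF r] square_integrable_X_of[OF s]]
    by (intro nn_integral_eq_integral square_integrableD) auto
  moreover have "(\<integral>\<^sup>+\<omega>. ennreal ((U \<omega> - V \<omega>)\<^sup>2) \<partial>M) = ennreal (\<integral>\<omega>. (U \<omega> - V \<omega>)\<^sup>2 \<partial>M)"
    using square_integrable_diff[OF U V] by (intro nn_integral_eq_integral square_integrableD) auto
  ultimately show ?thesis unfolding W2_eq[OF r s] L2_norm_def by (simp add: ennreal_le_iff)
qed

lemma W2_nonneg: "0 \<le> W2 \<rho> \<sigma>"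
  by (simp add: W2_def)

lemma W2_commute: "\<rho> \<in> P2 \<Longrightarrow> \<sigma> \<in> P2 \<Longrightarrow> W2 \<rho> \<sigma> = W2 \<sigma> \<rho>"
  by (simp add: W2_eq) (rule L2_norm_diff_commute)

lemma W2_triangle:
  assumes "\<rho> \<in> P2" "\<sigma> \<in> P2" "\<eta> \<in> P2"
  shows "W2 \<rho> \<eta> \<le> W2 \<rho> \<sigma> + W2 \<sigma> \<eta>"
  unfolding W2_eq[OF assms(1,3)] W2_eq[OF assms(1,2)] W2_eq[OF assms(2,3)]
  using assms by (intro L2_norm_triangle_diff square_integrable_X_of)

lemma W2_self: "\<rho> \<in> P2 \<Longrightarrow> W2 \<rho> \<rho> = 0"
  by (simp add: W2_eq L2_norm_def)

lemma W2_eq_0: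
  assumes "\<rho> \<in> P2" "\<sigma> \<in> P2" "W2 \<rho> \<sigma> = 0"
  shows "\<rho> = \<sigma>"
proof -
  have "AE w in unif. X_of \<rho> w - X_of \<sigma> w = 0"
    using assms by (intro L2_norm_eq_0_AE square_integrable_diff square_integrable_X_of) (simp_all add: W2_eq)
  then have "distr unif borel (X_of \<rho>) = distr unif borel (X_of \<sigma>)"
    using assms(1,2) by (intro distr_cong_AE) auto
  then show ?thesis using assms by (simp add: distr_X_of P2D)
qed

lemma W2_diff_le:
  assumes "\<rho> \<in> P2" "\<rho>' \<in> P2" "\<eta> \<in> P2"
  shows "\<bar>W2 \<rho> \<eta> - W2 \<rho>' \<eta>\<bar> \<le> W2 \<rho> \<rho>'"
  using W2_triangle[of \<rho> \<rho>' \<eta>] W2_triangle[of \<rho>' \<rho> \<eta>] W2_commute[of \<rho> \<rho>'] assms by (simp add: abs_le_iff)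

lemma tendsto_W2:
  assumes P: "\<And>n. \<rho>s n \<in> P2" "\<rho> \<in> P2" "\<And>n. \<sigma>s n \<in> P2" "\<sigma> \<in> P2"
    and "(\<lambda>n. W2 (\<rho>s n) \<rho>) \<longlonglongrightarrow> 0" "(\<lambda>n. W2 (\<sigma>s n) \<sigma>) \<longlonglongrightarrow> 0"
  shows "(\<lambda>n. W2 (\<rho>s n) (\<sigma>s n)) \<longlonglongrightarrow> W2 \<rho> \<sigma>"
proof -
  have "(\<lambda>n. W2 (\<rho>s n) (\<sigma>s n) - W2 \<rho> \<sigma>) \<longlonglongrightarrow> 0"
  proof (rule Lim_null_comparison)
    show "(\<lambda>n. W2 (\<rho>s n) \<rho> + W2 (\<sigma>s n) \<sigma>) \<longlonglongrightarrow> 0" using tendsto_add[OF assms(5,6)] by simp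
    show "eventually (\<lambda>n. norm (W2 (\<rho>s n) (\<sigma>s n) - W2 \<rho> \<sigma>) \<le> W2 (\<rho>s n) \<rho> + W2 (\<sigma>s n) \<sigma>) sequentially"
    proof (intro always_eventually allI)
      fix n
      have "\<bar>W2 (\<rho>s n) (\<sigma>s n) - W2 \<rho> (\<sigma>s n)\<bar> \<le> W2 (\<rho>s n) \<rho>" "\<bar>W2 (\<sigma>s n) \<rho> - W2 \<sigma> \<rho>\<bar> \<le> W2 (\<sigma>s n) \<sigma>"
        using P by (auto intro: W2_diff_le)
      then show "norm (W2 (\<rho>s n) (\<sigma>s n) - W2 \<rho> \<sigma>) \<le> W2 (\<rho>s n) \<rho> + W2 (\<sigma>s n) \<sigma>"
        using P W2_commute[of "\<sigma>s n" \<rho>] W2_commute[of \<sigma> \<rho>] by simp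
    qed
  qed
  then show ?thesis by (simp add: LIM_zero_iff)
qed

text \<open>Both functions are increasing, so that their \<open>L\<^sup>2\<close> distance is the distance \<open>W2\<close> of their laws, which
  agree.\<close>

lemma X_of_unique:
  assumes "ae_increasing X" "square_integrable unif X"
  shows "AE w in unif. X_of (distr unif borel X) w = X w"
proof -
  let ?r = "distr unif borel X"
  have r: "?r \<in> P2" using assms prob_space_unif by (auto intro: distr_in_P2)
  have "L2_norm unif (\<lambda>w. X_of ?r w - X w) = W2 (distr unif borel (X_of ?r)) (distr unif borel X)"
    using r assms by (intro W2_comonotone[symmetric] X_of_increasing square_integrable_X_of P2D)
  also have "\<dots> = 0" using r by (simp add: distr_X_of P2D W2_self)
  finally have "AE w in unif. X_of ?r w - X w = 0"
    by (intro L2_norm_eq_0_AE square_integrable_diff square_integrable_X_of assms r)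
  then show ?thesis by simp
qed


section \<open>Lipschitz functions are dense\<close>

text \<open>By approximation with simple functions it suffices to treat a set. It is approximated from inside by a
  compact set \<open>K\<close>, whose indicator is the pointwise limit of \<open>max 0 (1 - n d(x,K))\<close>.\<close>

lemma lipschitz_dense_in_L1:
  fixes \<rho> :: "real measure"
  assumes "finite_measure \<rho>" and sets: "sets \<rho> = sets borel" and "integrable \<rho> f"
  shows "\<forall>e>0. \<exists>g L. L-lipschitz_on UNIV g \<and> bounded (range g) \<and> (\<integral>x. \<bar>f x - g x\<bar> \<partial>\<rho>) < (e::real)"
  using \<open>integrable \<rho> f\<close>
proof (induction rule: integrable_induct)
  interpret finite_measure \<rho> by fact
  note [measurable_cong] = sets
  have bdd_int: "integrable \<rho> g" if g: "L-lipschitz_on UNIV g" "bounded (range g)" for g :: "real \<Rightarrow> real" and L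
  proof -
    have "continuous_on UNIV g" using g(1) by (rule lipschitz_on_continuous_on)
    then have [measurable]: "g \<in> borel_measurable borel" by (rule borel_measurable_continuous_onI)
    obtain B where "\<And>x. \<bar>g x\<bar> \<le> B" using g(2) by (auto simp: bounded_iff)
    then show ?thesis by (intro integrable_const_bound[of _ B]) auto
  qed
  {
    case (base A c)
    show ?case
    proof (intro allI impI)
      fix e :: real assume "e > 0"
      define d where "d = e / (2 * (\<bar>c\<bar> + 1))"
      have "d > 0" using \<open>e > 0\<close> by (simp add: d_def)
      have A: "A \<in> sets borel" using base sets by simp
      have "\<exists>K. K \<subseteq> A \<and> compact K \<and> measure \<rho> A < measure \<rho> K + d"
      proof (rule ccontr)
        assume "\<not> ?thesis"
        then have K: "measure \<rho> K + d \<le> measure \<rho> A" if "K \<subseteq> A" "compact K" for K using that by force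
        have "emeasure \<rho> A = (SUP K \<in> {K. K \<subseteq> A \<and> compact K}. emeasure \<rho> K)"
          by (rule inner_regular[OF sets _ A]) simp
        also have "\<dots> \<le> ennreal (measure \<rho> A - d)"
        proof (rule SUP_least)
          fix K assume "K \<in> {K. K \<subseteq> A \<and> compact K}"
          then have "measure \<rho> K \<le> measure \<rho> A - d" using K[of K] by simp
          then show "emeasure \<rho> K \<le> ennreal (measure \<rho> A - d)" by (simp add: emeasure_eq_measure ennreal_leI)
        qed
        finally have "measure \<rho> A \<le> measure \<rho> A - d"
          using K[of "{}"] by (simp add: emeasure_eq_measure)
        with \<open>d > 0\<close> show False by simp
      qed
      then obtain K where K: "K \<subseteq> A" "compact K" "measure \<rho> A < measure \<rho> K + d" by blast
      have Kb [measurable]: "K \<in> sets borel" using K(2) by (simp add: borel_compact)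
      define g where "g = (\<lambda>n x. if K = {} then 0 else max 0 (1 - real n * infdist x K))"
      have lip: "(real n)-lipschitz_on UNIV (g n)" for n
      proof (rule lipschitz_onI)
        fix x y :: real
        have "\<bar>g n x - g n y\<bar> \<le> real n * \<bar>infdist x K - infdist y K\<bar>"
        proof -
          have "\<bar>max 0 (1 - a) - max 0 (1 - b)\<bar> \<le> \<bar>a - b\<bar>" for a b :: real by (auto simp: max_def)
          from this[of "real n * infdist x K" "real n * infdist y K"] show ?thesis
            by (simp add: g_def right_diff_distrib[symmetric] abs_mult)
        qed
        also have "\<dots> \<le> real n * dist x y" by (intro mult_left_mono infdist_triangle_abs) auto
        finally show "dist (g n x) (g n y) \<le> real n * dist x y" by (simp add: dist_real_def)
      qed simp
      have g01: "0 \<le> g n x" "g n x \<le> 1" for n x by (auto simp: g_def max_def infdist_nonneg)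
      have bdd: "bounded (range (g n))" for n using g01 by (auto simp: bounded_iff intro!: exI[of _ 1])
      have gm [measurable]: "g n \<in> borel_measurable borel" for n
        by (rule borel_measurable_continuous_onI[OF lipschitz_on_continuous_on[OF lip]])
      have "(\<lambda>n. \<integral>x. \<bar>indicator K x - g n x\<bar> \<partial>\<rho>) \<longlonglongrightarrow> (\<integral>x. 0 \<partial>\<rho>)"
      proof (rule integral_dominated_convergence[where w = "\<lambda>_. 1"])
        show "AE x in \<rho>. norm \<bar>indicator K x - g n x\<bar> \<le> 1" for n
        proof (rule AE_I2)
          fix x show "norm \<bar>indicator K x - g n x\<bar> \<le> 1"
            using g01[of n x] by (simp add: indicator_def abs_le_iff)
        qed
        show "AE x in \<rho>. (\<lambda>n. \<bar>indicator K x - g n x\<bar>) \<longlonglongrightarrow> 0"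
        proof (rule AE_I2)
          fix x
          show "(\<lambda>n. \<bar>indicator K x - g n x\<bar>) \<longlonglongrightarrow> 0"
          proof (cases "x \<in> K \<or> K = {}")
            case True
            then have "indicator K x = g n x" for n by (cases "K = {}") (auto simp: g_def)
            then show ?thesis by simp
          next
            case False
            then have "infdist x K > 0"
              using K(2) by (metis compact_imp_closed in_closed_iff_infdist_zero infdist_nonneg less_le)
            obtain m where m: "1 / infdist x K < real m" using reals_Archimedean2 by blast
            have "eventually (\<lambda>n. \<bar>indicator K x - g n x\<bar> = 0) sequentially"
              using eventually_ge_at_top[of m]
            proof eventually_elim
              case (elim n)
              have "1 < real m * infdist x K" using m \<open>infdist x K > 0\<close> by (simp add: field_simps)
              also have "\<dots> \<le> real n * infdist x K" using elim \<open>infdist x K > 0\<close> by (intro mult_right_mono) auto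
              finally show ?case using False by (simp add: g_def)
            qed
            then show ?thesis by (rule tendsto_eventually)
          qed
        qed
      qed auto
      then have "eventually (\<lambda>n. (\<integral>x. \<bar>indicator K x - g n x\<bar> \<partial>\<rho>) < d) sequentially"
        using \<open>d > 0\<close> by (intro order_tendstoD) auto
      then obtain n where n: "(\<integral>x. \<bar>indicator K x - g n x\<bar> \<partial>\<rho>) < d" by (auto simp: eventually_sequentially)
      have [measurable]: "A \<in> sets \<rho>" "K \<in> sets \<rho>" using base Kb sets by auto
      have ind: "integrable \<rho> (indicator B :: real \<Rightarrow> real)" if "B \<in> sets \<rho>" for B
        using that by (intro integrable_real_indicator) (auto simp: emeasure_eq_measure)
      have gn: "integrable \<rho> (g n)" by (rule bdd_int[OF lip bdd])
      have int: "integrable \<rho> (\<lambda>x. \<bar>indicator K x - g n x\<bar>)" "integrable \<rho> (indicator (A - K) :: real \<Rightarrow> real)"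
        by (intro integrable_abs Bochner_Integration.integrable_diff ind gn; measurable)+
      have "(\<integral>x. \<bar>indicator A x *\<^sub>R c - c * g n x\<bar> \<partial>\<rho>) \<le> (\<integral>x. \<bar>c\<bar> * (indicator (A - K) x + \<bar>indicator K x - g n x\<bar>) \<partial>\<rho>)"
      proof (rule integral_mono)
        show "integrable \<rho> (\<lambda>x. \<bar>indicator A x *\<^sub>R c - c * g n x\<bar>)"
          by (intro integrable_abs Bochner_Integration.integrable_diff integrable_scaleR_left integrable_mult_right ind gn) measurable
        fix x
        have "\<bar>indicator A x *\<^sub>R c - c * g n x\<bar> = \<bar>c\<bar> * \<bar>indicator A x - g n x\<bar>"
          by (simp add: abs_mult[symmetric] algebra_simps)
        also have "\<bar>indicator A x - g n x\<bar> \<le> indicator (A - K) x + \<bar>indicator K x - g n x\<bar>"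
          using K(1) by (auto simp: indicator_def)
        finally show "\<bar>indicator A x *\<^sub>R c - c * g n x\<bar> \<le> \<bar>c\<bar> * (indicator (A - K) x + \<bar>indicator K x - g n x\<bar>)"
          by (simp add: mult_left_mono)
      qed (use int in auto)
      also have "\<dots> = \<bar>c\<bar> * (measure \<rho> (A - K) + (\<integral>x. \<bar>indicator K x - g n x\<bar> \<partial>\<rho>))"
        using int by simp
      also have "\<dots> \<le> \<bar>c\<bar> * (d + d)"
        using K n by (intro mult_left_mono add_mono) (auto simp: finite_measure_Diff)
      also have "\<dots> < (\<bar>c\<bar> + 1) * (d + d)" using \<open>d > 0\<close> by (intro mult_strict_right_mono) auto
      also have "\<dots> = e"
      proof -
        have "d * (2 * (\<bar>c\<bar> + 1)) = e" unfolding d_def by (rule nonzero_eq_divide_eq[THEN iffD1]) auto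
        then show ?thesis by (simp add: algebra_simps)
      qed
      finally have "(\<integral>x. \<bar>indicator A x *\<^sub>R c - c * g n x\<bar> \<partial>\<rho>) < e" .
      moreover have "(\<bar>c\<bar> * real n)-lipschitz_on UNIV (\<lambda>x. c * g n x)"
        using lip by (intro lipschitz_on_cmult_real)
      moreover have "bounded (range (\<lambda>x. c * g n x))" using bounded_scaling[OF bdd[of n], of c] by (simp add: image_image)
      ultimately show "\<exists>g L. L-lipschitz_on UNIV g \<and> bounded (range g) \<and> (\<integral>x. \<bar>indicator A x *\<^sub>R c - g x\<bar> \<partial>\<rho>) < e"
        by blast
    qed
  next
    case (add f f')
    show ?case
    proof (intro allI impI)
      fix e :: real assume "e > 0"
      then obtain g L g' L' where g: "L-lipschitz_on UNIV g" "bounded (range g)" "(\<integral>x. \<bar>f x - g x\<bar> \<partial>\<rho>) < e / 2"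
        and g': "L'-lipschitz_on UNIV g'" "bounded (range g')" "(\<integral>x. \<bar>f' x - g' x\<bar> \<partial>\<rho>) < e / 2"
        using add.IH[THEN spec, of "e / 2"] by auto
      have int: "integrable \<rho> (\<lambda>x. \<bar>f x - g x\<bar>)" "integrable \<rho> (\<lambda>x. \<bar>f' x - g' x\<bar>)"
        using add bdd_int[OF g(1,2)] bdd_int[OF g'(1,2)] by auto
      have "(\<integral>x. \<bar>f x + f' x - (g x + g' x)\<bar> \<partial>\<rho>) \<le> (\<integral>x. \<bar>f x - g x\<bar> + \<bar>f' x - g' x\<bar> \<partial>\<rho>)"
        using add bdd_int[OF g(1,2)] bdd_int[OF g'(1,2)] by (intro integral_mono) auto
      also have "\<dots> < e" using int g g' by simp
      finally have "(\<integral>x. \<bar>f x + f' x - (g x + g' x)\<bar> \<partial>\<rho>) < e" .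
      moreover have "bounded (range (\<lambda>x. g x + g' x))"
      proof -
        obtain B B' where "\<And>x. \<bar>g x\<bar> \<le> B" "\<And>x. \<bar>g' x\<bar> \<le> B'" using g(2) g'(2) by (auto simp: bounded_iff)
        then have "\<bar>g x + g' x\<bar> \<le> B + B'" for x by (meson abs_triangle_ineq add_mono order_trans)
        then show ?thesis by (auto simp: bounded_iff)
      qed
      moreover have "(L + L')-lipschitz_on UNIV (\<lambda>x. g x + g' x)" by (intro lipschitz_on_add g g')
      ultimately show "\<exists>g L. L-lipschitz_on UNIV g \<and> bounded (range g) \<and> (\<integral>x. \<bar>f x + f' x - g x\<bar> \<partial>\<rho>) < e"
        by (intro exI[of _ "\<lambda>x. g x + g' x"] exI[of _ "L + L'"]) auto
    qed
  next
    case (lim f s)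
    show ?case
    proof (intro allI impI)
      fix e :: real assume "e > 0"
      note [measurable] = borel_measurable_integrable[OF lim.hyps(1)] borel_measurable_integrable[OF lim.hyps(4)]
      have "(\<lambda>n. \<integral>x. \<bar>f x - s n x\<bar> \<partial>\<rho>) \<longlonglongrightarrow> (\<integral>x. 0 \<partial>\<rho>)"
      proof (rule integral_dominated_convergence[where w = "\<lambda>x. 3 * \<bar>f x\<bar>"])
        show "integrable \<rho> (\<lambda>x. 3 * \<bar>f x\<bar>)" using lim.hyps(4) by auto
        show "AE x in \<rho>. (\<lambda>n. \<bar>f x - s n x\<bar>) \<longlonglongrightarrow> 0"
        proof (rule AE_I2)
          fix x assume "x \<in> space \<rho>"
          then have "(\<lambda>n. f x - s n x) \<longlonglongrightarrow> f x - f x" by (intro tendsto_intros lim.hyps)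
          then show "(\<lambda>n. \<bar>f x - s n x\<bar>) \<longlonglongrightarrow> 0" using tendsto_rabs_zero by auto
        qed
        show "AE x in \<rho>. norm \<bar>f x - s n x\<bar> \<le> 3 * \<bar>f x\<bar>" for n
        proof (rule AE_I2)
          fix x assume "x \<in> space \<rho>"
          then show "norm \<bar>f x - s n x\<bar> \<le> 3 * \<bar>f x\<bar>" using lim.hyps(3)[of x n] by simp
        qed
      qed auto
      then have "eventually (\<lambda>n. (\<integral>x. \<bar>f x - s n x\<bar> \<partial>\<rho>) < e / 2) sequentially"
        using \<open>e > 0\<close> by (intro order_tendstoD) auto
      then obtain n where n: "(\<integral>x. \<bar>f x - s n x\<bar> \<partial>\<rho>) < e / 2" by (auto simp: eventually_sequentially)
      obtain g L where g: "L-lipschitz_on UNIV g" "bounded (range g)" "(\<integral>x. \<bar>s n x - g x\<bar> \<partial>\<rho>) < e / 2"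
        using lim.IH[of n] \<open>e > 0\<close> by (meson half_gt_zero)
      have int: "integrable \<rho> f" "integrable \<rho> (s n)" "integrable \<rho> g"
        using lim.hyps bdd_int[OF g(1,2)] by auto
      have "(\<integral>x. \<bar>f x - g x\<bar> \<partial>\<rho>) \<le> (\<integral>x. \<bar>f x - s n x\<bar> + \<bar>s n x - g x\<bar> \<partial>\<rho>)"
        using int by (intro integral_mono) auto
      also have "\<dots> < e" using int n g by simp
      finally show "\<exists>g L. L-lipschitz_on UNIV g \<and> bounded (range g) \<and> (\<integral>x. \<bar>f x - g x\<bar> \<partial>\<rho>) < e"
        using g by blast
    qed
  }
qed

text \<open>Truncation reduces this to a bounded function with values in \<open>[-n, n]\<close>. There the squared \<open>L\<^sup>2\<close>
  distance is at most \<open>2 n\<close> times the \<open>L\<^sup>1\<close> distance, provided that the approximating function is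
  truncated as well, which preserves its Lipschitz constant.\<close>

lemma lipschitz_dense_in_L2:
  fixes \<rho> :: "real measure"
  assumes "finite_measure \<rho>" and sets: "sets \<rho> = sets borel" and f: "square_integrable \<rho> f" and "e > 0"
  obtains g L where "L-lipschitz_on UNIV g" "bounded (range g)" "L2_norm \<rho> (\<lambda>x. f x - g x) < e"
proof -
  interpret finite_measure \<rho> by fact
  note [measurable_cong] = sets
  note [measurable] = square_integrable_measurable[OF f]
  define clip where "clip = (\<lambda>(c::real) y::real. max (- c) (min c y))"
  have [measurable]: "clip c \<in> borel_measurable borel" for c unfolding clip_def by measurable
  have "(\<lambda>n. \<integral>x. (f x - clip (real n) (f x))\<^sup>2 \<partial>\<rho>) \<longlonglongrightarrow> (\<integral>x. 0 \<partial>\<rho>)"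
  proof (rule integral_dominated_convergence[where w = "\<lambda>x. (f x)\<^sup>2"])
    show "AE x in \<rho>. (\<lambda>n. (f x - clip (real n) (f x))\<^sup>2) \<longlonglongrightarrow> 0"
    proof (rule AE_I2)
      fix x
      obtain m where m: "\<bar>f x\<bar> < real m" using reals_Archimedean2 by blast
      have "eventually (\<lambda>n. (f x - clip (real n) (f x))\<^sup>2 = 0) sequentially"
        using eventually_ge_at_top[of m] by eventually_elim (use m in \<open>auto simp: clip_def\<close>)
      then show "(\<lambda>n. (f x - clip (real n) (f x))\<^sup>2) \<longlonglongrightarrow> 0" by (rule tendsto_eventually)
    qed
    show "AE x in \<rho>. norm ((f x - clip (real n) (f x))\<^sup>2) \<le> (f x)\<^sup>2" for n
      by (rule AE_I2) (auto simp: clip_def abs_le_square_iff[symmetric])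
    show "integrable \<rho> (\<lambda>x. (f x)\<^sup>2)" by (rule square_integrableD[OF f])
  qed measurable
  then have "eventually (\<lambda>n. (\<integral>x. (f x - clip (real n) (f x))\<^sup>2 \<partial>\<rho>) < (e / 2)\<^sup>2) sequentially"
    using \<open>e > 0\<close> by (intro order_tendstoD) auto
  then obtain n where "(\<integral>x. (f x - clip (real n) (f x))\<^sup>2 \<partial>\<rho>) < (e / 2)\<^sup>2" by (auto simp: eventually_sequentially)
  then have n: "L2_norm \<rho> (\<lambda>x. f x - clip (real n) (f x)) < e / 2"
    unfolding L2_norm_def using \<open>e > 0\<close> by (intro real_less_lsqrt) auto
  let ?c = "real n" and ?h = "\<lambda>x. clip (real n) (f x)"
  have clip_le: "\<bar>clip ?c y\<bar> \<le> ?c" for y by (auto simp: clip_def)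
  have clip_lip: "\<bar>clip ?c y - clip ?c z\<bar> \<le> \<bar>y - z\<bar>" for y z by (auto simp: clip_def)
  have h: "integrable \<rho> ?h" by (rule integrable_const_bound[of _ ?c]) (auto simp: clip_le)
  \<comment> \<open>the summand 1 keeps the factor positive if \<open>n = 0\<close>\<close>
  define d where "d = (e / 2)\<^sup>2 / (2 * ?c + 1)"
  have "d > 0" using \<open>e > 0\<close> by (simp add: d_def)
  obtain g L where g: "L-lipschitz_on UNIV g" "bounded (range g)" "(\<integral>x. \<bar>?h x - g x\<bar> \<partial>\<rho>) < d"
    using lipschitz_dense_in_L1[OF \<open>finite_measure \<rho>\<close> sets h] \<open>d > 0\<close> by blast
  have [measurable]: "g \<in> borel_measurable borel"
    by (rule borel_measurable_continuous_onI[OF lipschitz_on_continuous_on[OF g(1)]])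
  have ig: "integrable \<rho> (\<lambda>x. \<bar>?h x - g x\<bar>)"
  proof -
    obtain B where "\<And>x. \<bar>g x\<bar> \<le> B" using g(2) by (auto simp: bounded_iff)
    then have "integrable \<rho> g" by (intro integrable_const_bound[of _ B]) auto
    then show ?thesis using h by auto
  qed
  define k where "k = (\<lambda>x. clip ?c (g x))"
  have [measurable]: "k \<in> borel_measurable borel" unfolding k_def by measurable
  have sq: "square_integrable \<rho> ?h" "square_integrable \<rho> k"
    unfolding square_integrable_def k_def
    by (auto intro!: integrable_const_bound[of _ "?c\<^sup>2"] AE_I2 power_mono[of _ _ 2, OF clip_le, simplified])
  have "(\<integral>x. (?h x - k x)\<^sup>2 \<partial>\<rho>) \<le> (\<integral>x. (2 * ?c + 1) * \<bar>?h x - g x\<bar> \<partial>\<rho>)"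
  proof (rule integral_mono)
    show "integrable \<rho> (\<lambda>x. (?h x - k x)\<^sup>2)" by (intro square_integrableD square_integrable_diff sq)
    show "integrable \<rho> (\<lambda>x. (2 * ?c + 1) * \<bar>?h x - g x\<bar>)" using ig by auto
    fix x
    have "clip ?c (f x) = clip ?c (?h x)" by (auto simp: clip_def)
    then have "\<bar>?h x - k x\<bar> \<le> \<bar>?h x - g x\<bar>" using clip_lip[of "?h x" "g x"] by (simp add: k_def)
    moreover have "\<bar>?h x - k x\<bar> \<le> 2 * ?c + 1" using clip_le[of "f x"] clip_le[of "g x"] by (simp add: k_def)
    ultimately have "\<bar>?h x - k x\<bar> * \<bar>?h x - k x\<bar> \<le> (2 * ?c + 1) * \<bar>?h x - g x\<bar>"
      by (intro mult_mono) auto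
    then show "(?h x - k x)\<^sup>2 \<le> (2 * ?c + 1) * \<bar>?h x - g x\<bar>" by (simp add: power2_eq_square abs_mult[symmetric])
  qed
  also have "\<dots> < (2 * ?c + 1) * d" using g(3) by simp
  also have "\<dots> = (e / 2)\<^sup>2"
  proof -
    have "d * (2 * ?c + 1) = (e / 2)\<^sup>2" unfolding d_def by (rule nonzero_eq_divide_eq[THEN iffD1]) auto
    then show ?thesis by (simp add: mult.commute)
  qed
  finally have "L2_norm \<rho> (\<lambda>x. ?h x - k x) < e / 2"
    unfolding L2_norm_def using \<open>e > 0\<close> by (intro real_less_lsqrt) auto
  then have "L2_norm \<rho> (\<lambda>x. f x - k x) < e"
    using L2_norm_triangle_diff[OF f sq(1) sq(2)] n by simp
  moreover have "L-lipschitz_on UNIV k"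
  proof (rule lipschitz_onI)
    fix x y
    have "dist (k x) (k y) \<le> dist (g x) (g y)" using clip_lip by (simp add: k_def dist_real_def)
    also have "\<dots> \<le> L * dist x y" using g(1) by (rule lipschitz_onD) auto
    finally show "dist (k x) (k y) \<le> L * dist x y" .
  qed (rule lipschitz_on_nonneg[OF g(1)])
  moreover have "bounded (range k)" using clip_le by (auto simp: bounded_iff k_def)
  ultimately show ?thesis by (rule that[rotated 2])
qed


section \<open>Density of discrete data\<close>

lemma L2_iff: "v \<in> L2 \<rho> \<longleftrightarrow> v \<in> borel_measurable borel \<and> integrable \<rho> (\<lambda>x. (v x)\<^sup>2)"
  by (simp add: L2_def)

lemma L2_square_integrable:
  assumes "\<rho> \<in> P2" "v \<in> L2 \<rho>"
  shows "square_integrable \<rho> v" "square_integrable unif (\<lambda>w. v (X_of \<rho> w))"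
proof -
  have "v \<in> borel_measurable \<rho>"
    using assms measurable_cong_sets[OF P2D(2)[OF assms(1)] refl] by (auto simp: L2_iff)
  then show "square_integrable \<rho> v" using assms by (auto simp: L2_iff square_integrable_def)
  show "square_integrable unif (\<lambda>w. v (X_of \<rho> w))"
    using assms by (subst square_integrable_comp_X_of) (auto simp: L2_iff)
qed

lemma square_integrable_imp_integrable:
  assumes "prob_space M" "square_integrable M f"
  shows "integrable M f"
proof -
  interpret prob_space M by fact
  have "square_integrable M (\<lambda>_. 1)" by (simp add: square_integrable_def)
  from square_integrable_mult[OF assms(2) this] show ?thesis by simp
qed

lemma AE_X_of:
  assumes "\<rho> \<in> P2" "AE x in \<rho>. P x"
  shows "AE w in unif. P (X_of \<rho> w)"
proof (rule AE_distrD[of "X_of \<rho>" unif borel])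
  show "AE x in distr unif borel (X_of \<rho>). P x"
    unfolding distr_X_of[OF P2D(5)[OF assms(1)]] by (rule assms(2))
qed (rule measurable_X_of[OF assms(1)])

lemma momentum_signed_measure:
  assumes "\<rho> \<in> P2" "v \<in> L2 \<rho>"
  shows "momentum \<rho> v \<in> signed_measures"
  unfolding signed_measures_def
proof (intro CollectI conjI allI impI)
  show "momentum \<rho> v A = 0" if "A \<notin> sets borel" for A using that by (simp add: momentum_def)
  fix A :: "nat \<Rightarrow> real set" assume A: "range A \<subseteq> sets borel" "disjoint_family A"
  note [simp] = P2D(2)[OF assms(1)]
  have int: "integrable \<rho> v" using square_integrable_imp_integrable[OF P2D(1) L2_square_integrable(1)] assms by auto
  have si: "set_integrable \<rho> B v" if "B \<in> sets borel" for B
    unfolding set_integrable_def using int that by (intro integrable_mult_indicator) auto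
  have "(\<lambda>n. LINT x:(\<Union>i<n. A i)|\<rho>. v x) \<longlonglongrightarrow> (LINT x:(\<Union>n. \<Union>i<n. A i)|\<rho>. v x)"
    using A by (intro set_integral_cont_up si) (auto simp: incseq_def intro: less_le_trans)
  moreover have "(\<Union>n. \<Union>i<n. A i) = (\<Union>i. A i)" by auto
  moreover have "(LINT x:(\<Union>i<n. A i)|\<rho>. v x) = (\<Sum>i<n. LINT x:A i|\<rho>. v x)" for n
    using A by (intro set_integral_finite_Union si) (auto simp: disjoint_family_on_def)
  moreover have "(\<Union>i. A i) \<in> sets borel" "A i \<in> sets borel" for i using A by auto
  ultimately show "(\<lambda>i. momentum \<rho> v (A i)) sums momentum \<rho> v (\<Union>i. A i)"
    by (simp add: sums_def momentum_def)
qed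

lemma momentum_in_V2:
  assumes "\<rho> \<in> P2" "v \<in> L2 \<rho>" shows "(\<rho>, momentum \<rho> v) \<in> V2"
  using assms momentum_signed_measure by (auto simp: V2_def)

text \<open>The momentum measure determines its density almost everywhere, so the choice made in \<open>velocity\<close> does
  not matter and \<open>D2\<close> can be computed with any given representative.\<close>

lemma velocity_momentum:
  assumes "\<rho> \<in> P2" "v \<in> L2 \<rho>"
  shows "velocity (\<rho>, momentum \<rho> v) \<in> L2 \<rho>" "AE x in \<rho>. velocity (\<rho>, momentum \<rho> v) x = v x"
proof -
  define u where "u = velocity (\<rho>, momentum \<rho> v)"
  have "\<exists>u. u \<in> L2 \<rho> \<and> momentum \<rho> v = momentum \<rho> u" using assms(2) by blast
  from someI_ex[OF this] have u: "u \<in> L2 \<rho> \<and> momentum \<rho> v = momentum \<rho> u"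
    unfolding u_def velocity_def fst_conv snd_conv .
  then show "velocity (\<rho>, momentum \<rho> v) \<in> L2 \<rho>" by (simp add: u_def)
  have "AE x in \<rho>. u x = v x"
  proof (rule density_unique_real)
    show "integrable \<rho> u" "integrable \<rho> v"
      using square_integrable_imp_integrable[OF P2D(1) L2_square_integrable(1)] assms u by auto
    fix A assume "A \<in> sets \<rho>"
    then have "A \<in> sets borel" by (simp add: P2D assms)
    then show "(LINT x:A|\<rho>. u x) = (LINT x:A|\<rho>. v x)"
      using arg_cong[OF conjunct2[OF u], of "\<lambda>p. p A"] by (simp add: momentum_def)
  qed
  then show "AE x in \<rho>. velocity (\<rho>, momentum \<rho> v) x = v x" by (simp add: u_def)
qed

lemma D2_momentum:
  assumes r: "\<rho> \<in> P2" "f \<in> L2 \<rho>" and s: "\<sigma> \<in> P2" "g \<in> L2 \<sigma>"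
  shows "D2 (\<rho>, momentum \<rho> f) (\<sigma>, momentum \<sigma> g)
    = sqrt ((W2 \<rho> \<sigma>)\<^sup>2 + (L2_norm unif (\<lambda>w. f (X_of \<rho> w) - g (X_of \<sigma> w)))\<^sup>2)"
proof -
  let ?f = "velocity (\<rho>, momentum \<rho> f)" and ?g = "velocity (\<sigma>, momentum \<sigma> g)"
  have m [measurable]: "f \<in> borel_measurable borel" "g \<in> borel_measurable borel"
    "?f \<in> borel_measurable borel" "?g \<in> borel_measurable borel"
    using r s velocity_momentum(1)[OF r] velocity_momentum(1)[OF s] by (auto simp: L2_iff)
  note [measurable] = measurable_X_of[OF r(1)] measurable_X_of[OF s(1)]
  have "(LINT w:{0<..<1}|lborel. \<bar>?f (X_of \<rho> w) - ?g (X_of \<sigma> w)\<bar>\<^sup>2) = (\<integral>w. (?f (X_of \<rho> w) - ?g (X_of \<sigma> w))\<^sup>2 \<partial>unif)"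
    unfolding unif_def by (subst integral_restrict_space) (auto simp: set_lebesgue_integral_def)
  also have "\<dots> = (\<integral>w. (f (X_of \<rho> w) - g (X_of \<sigma> w))\<^sup>2 \<partial>unif)"
  proof (rule integral_cong_AE)
    show "AE w in unif. (?f (X_of \<rho> w) - ?g (X_of \<sigma> w))\<^sup>2 = (f (X_of \<rho> w) - g (X_of \<sigma> w))\<^sup>2"
      using AE_X_of[OF r(1) velocity_momentum(2)[OF r]] AE_X_of[OF s(1) velocity_momentum(2)[OF s]]
      by eventually_elim simp
  qed measurable
  finally show ?thesis by (simp add: D2_def L2_norm_square)
qed

lemma L2_lipschitz:
  assumes "\<rho> \<in> P2" "L-lipschitz_on UNIV (v :: real \<Rightarrow> real)" "bounded (range v)"
  shows "v \<in> L2 \<rho>"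
proof -
  interpret prob_space \<rho> by (rule P2D(1)[OF assms(1)])
  note [measurable_cong] = P2D(2)[OF assms(1)]
  have [measurable]: "v \<in> borel_measurable borel"
    by (rule borel_measurable_continuous_onI[OF lipschitz_on_continuous_on[OF assms(2)]])
  obtain B where B: "\<And>x. \<bar>v x\<bar> \<le> B" using assms(3) by (auto simp: bounded_iff)
  have "(v x)\<^sup>2 \<le> B\<^sup>2" for x using power_mono[OF B[of x] abs_ge_zero, of 2] by simp
  then have "integrable \<rho> (\<lambda>x. (v x)\<^sup>2)" by (intro integrable_const_bound[of _ "B\<^sup>2"]) auto
  then show ?thesis by (simp add: L2_iff)
qed

lemma sum_discrete_state:
  assumes "discrete_data N m x" and [measurable]: "f \<in> borel_measurable borel"
  shows "(\<integral>y. f y \<partial>fst (discrete_state N m x v)) = (\<Sum>i<N. m i * f (x i) :: real)"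
    and "integrable (fst (discrete_state N m x v)) f"
proof -
  let ?M = "point_measure {..<N} (\<lambda>i. ennreal (m i))"
  have [measurable]: "x \<in> borel_measurable ?M" by (simp add: measurable_point_measure_eq1)
  have m: "m i \<ge> 0" if "i < N" for i using assms that by (auto simp: discrete_data_def less_imp_le)
  have "(\<integral>y. f y \<partial>fst (discrete_state N m x v)) = (\<integral>i. f (x i) \<partial>?M)"
    unfolding discrete_state_def fst_conv by (rule integral_distr) measurable
  also have "\<dots> = (\<Sum>i<N. m i * f (x i))"
    using m by (subst lebesgue_integral_point_measure_finite) auto
  finally show "(\<integral>y. f y \<partial>fst (discrete_state N m x v)) = (\<Sum>i<N. m i * f (x i) :: real)" .
  have "integrable ?M (\<lambda>i. f (x i))" using m by (intro integrable_point_measure_finite) auto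
  then show "integrable (fst (discrete_state N m x v)) f"
    unfolding discrete_state_def fst_conv by (subst integrable_distr_eq) auto
qed

lemma discrete_state_P2:
  assumes "\<And>i. i < N \<Longrightarrow> 0 < m i" "(\<Sum>i<N. m i) = 1"
  shows "fst (discrete_state N m x v) \<in> P2"
proof -
  let ?\<rho> = "fst (discrete_state N m x v)"
  let ?M = "point_measure {..<N} (\<lambda>i. ennreal (m i))"
  have sp: "sets ?\<rho> = sets borel" by (simp add: discrete_state_def)
  then have "emeasure ?\<rho> (space ?\<rho>) = (\<Sum>i<N. ennreal (m i))"
    by (simp add: emeasure_fst_discrete_state sets_eq_imp_space_eq[OF sp])
  also have "\<dots> = ennreal (\<Sum>i<N. m i)" using assms by (intro sum_ennreal) (auto simp: less_imp_le)
  finally have "prob_space ?\<rho>" using assms by (intro prob_spaceI) simp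
  moreover have "integrable ?\<rho> (\<lambda>x. x\<^sup>2)"
    unfolding discrete_state_def fst_conv using assms
    by (subst integrable_distr_eq)
      (auto simp: measurable_point_measure_eq1 less_imp_le intro!: integrable_point_measure_finite)
  ultimately show ?thesis using sp by (simp add: P2_def)
qed

lemma discrete_state_eq_momentum:
  assumes "discrete_data N m x" and [measurable]: "g \<in> borel_measurable borel" and v: "\<And>i. i < N \<Longrightarrow> v i = g (x i)"
  shows "snd (discrete_state N m x v) = momentum (fst (discrete_state N m x v)) g"
proof
  fix A
  show "snd (discrete_state N m x v) A = momentum (fst (discrete_state N m x v)) g A"
  proof (cases "A \<in> sets borel")
    case True
    then have "(LINT y:A|fst (discrete_state N m x v). g y) = (\<Sum>i<N. m i * (indicator A (x i) * g (x i)))"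
      unfolding set_lebesgue_integral_def
      using sum_discrete_state(1)[OF assms(1), of "\<lambda>y. indicator A y * g y" v] by simp
    also have "\<dots> = (\<Sum>i<N. m i * v i * indicator A (x i))" by (intro sum.cong) (auto simp: v)
    finally show ?thesis using True by (simp add: momentum_def) (simp add: discrete_state_def)
  qed (simp add: momentum_def discrete_state_def)
qed

text \<open>The values that \<open>q\<close> takes with positive probability, in increasing order, are the positions; values
  of probability zero are discarded to obtain positive masses.\<close>

lemma finite_range_discrete:
  fixes q :: "real \<Rightarrow> real"
  assumes r: "real_distribution \<rho>" and [measurable]: "q \<in> borel_measurable borel" and fin: "finite (range q)"
  obtains N m x where "discrete_data N m x" "\<And>v. fst (discrete_state N m x v) = distr \<rho> borel q"
proof -
  interpret real_distribution \<rho> by fact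
  define p where "p = (\<lambda>r. prob (q -` {r}))"
  define R where "R = {r\<in>range q. 0 < p r}"
  have finR: "finite R" using fin by (simp add: R_def)
  define xs where "xs = sorted_list_of_set R"
  define N where "N = length xs"
  define x where "x = (\<lambda>i. xs ! i)"
  define m where "m = (\<lambda>i. p (x i))"
  have xs: "set xs = R" "distinct xs" using finR by (auto simp: xs_def)
  have bij: "bij_betw x {..<N} R"
    unfolding x_def N_def using xs by (intro bij_betw_nth) auto
  have p0: "0 \<le> p r" for r by (simp add: p_def)
  have preimage: "q -` B \<in> events" if "B \<in> sets borel" for B
    using measurable_sets[of q \<rho> borel B] that by simp
  have eq: "(\<Sum>i<N. ennreal (m i) * indicator A (x i)) = emeasure (distr \<rho> borel q) A" if A [measurable]: "A \<in> sets borel" for A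
  proof -
    have "(\<Sum>i<N. ennreal (m i) * indicator A (x i)) = (\<Sum>r\<in>R. ennreal (p r) * indicator A r)"
      unfolding m_def using bij by (rule sum.reindex_bij_betw)
    also have "\<dots> = (\<Sum>r\<in>range q. ennreal (p r) * indicator A r)"
      using fin p0 by (intro sum.mono_neutral_left) (auto simp: R_def not_less intro: antisym)
    also have "\<dots> = (\<Sum>r\<in>range q. emeasure \<rho> (q -` ({r} \<inter> A)))"
    proof (intro sum.cong refl)
      fix r
      have "{r} \<inter> A = (if r \<in> A then {r} else {})" by auto
      then show "ennreal (p r) * indicator A r = emeasure \<rho> (q -` ({r} \<inter> A))"
        by (simp add: p_def emeasure_eq_measure del: vimage_Int)
    qed
    also have "\<dots> = emeasure \<rho> (\<Union>r\<in>range q. q -` ({r} \<inter> A))"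
    proof (rule sum_emeasure)
      show "(\<lambda>r. q -` ({r} \<inter> A)) ` range q \<subseteq> events"
        using A by (intro image_subsetI preimage sets.Int) auto
      show "disjoint_family_on (\<lambda>r. q -` ({r} \<inter> A)) (range q)"
        unfolding disjoint_family_on_def by blast
    qed (rule fin)
    also have "(\<Union>r\<in>range q. q -` ({r} \<inter> A)) = q -` A" by auto
    also have "emeasure \<rho> (q -` A) = emeasure (distr \<rho> borel q) A" by (subst emeasure_distr) auto
    finally show ?thesis .
  qed
  have "discrete_data N m x"
    unfolding discrete_data_def
  proof (intro conjI allI impI)
    show "0 < m i" if "i < N" for i
      using bij that by (auto simp: m_def R_def bij_betw_def)
    have "ennreal (\<Sum>i<N. m i) = (\<Sum>i<N. ennreal (m i))" using p0 by (intro sum_ennreal[symmetric]) (simp add: m_def)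
    also have "\<dots> = emeasure (distr \<rho> borel q) UNIV" using eq[of UNIV] by simp
    also have "\<dots> = 1" using prob_space.emeasure_space_1[OF prob_space_distr[of q borel]] by simp
    finally show "(\<Sum>i<N. m i) = 1" using p0 by (simp add: m_def sum_nonneg)
    show "strict_mono_on {..<N} x"
      unfolding x_def N_def xs_def
      by (intro strict_mono_onI) (auto intro!: sorted_wrt_nth_less[of "(<)"])
  qed
  moreover have "fst (discrete_state N m x v) = distr \<rho> borel q" for v
  proof (rule measure_eqI)
    have sets: "sets (fst (discrete_state N m x v)) = sets borel" by (simp add: discrete_state_def)
    then show "sets (fst (discrete_state N m x v)) = sets (distr \<rho> borel q)" by simp
    fix A assume "A \<in> sets (fst (discrete_state N m x v))"
    then have "A \<in> sets borel" unfolding sets .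
    then show "emeasure (fst (discrete_state N m x v)) A = emeasure (distr \<rho> borel q) A"
      by (simp only: emeasure_fst_discrete_state eq)
  qed
  ultimately show ?thesis by (rule that)
qed

text \<open>Rounding down to multiples of \<open>1 / (n + 1)\<close> on \<open>[-n, n]\<close>, with value 0 outside, converges in
  \<open>L\<^sup>2(\<rho>)\<close> by dominated convergence.\<close>

lemma finite_range_approximation:
  assumes r: "\<rho> \<in> P2" and "e > 0"
  obtains q :: "real \<Rightarrow> real" where "q \<in> borel_measurable borel" "finite (range q)" "square_integrable \<rho> q"
    "L2_norm \<rho> (\<lambda>x. q x - x) < e"
proof -
  interpret prob_space \<rho> by (rule P2D(1)[OF r])
  note [measurable_cong] = P2D(2)[OF r]
  define q where "q = (\<lambda>(n::nat) x::real. if \<bar>x\<bar> \<le> n then \<lfloor>(real n + 1) * x\<rfloor> / (real n + 1) else 0)"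
  have [measurable]: "q n \<in> borel_measurable borel" for n unfolding q_def by measurable
  have diff: "\<bar>q n x - x\<bar> \<le> 1 / (real n + 1)" if "\<bar>x\<bar> \<le> n" for n x
  proof -
    have "\<bar>real_of_int \<lfloor>(real n + 1) * x\<rfloor> - (real n + 1) * x\<bar> \<le> 1" by linarith
    moreover have "(real n + 1) * q n x = \<lfloor>(real n + 1) * x\<rfloor>" using that by (simp add: q_def)
    ultimately have "\<bar>(real n + 1) * (q n x - x)\<bar> \<le> 1" by (simp only: right_diff_distrib)
    then have "(real n + 1) * \<bar>q n x - x\<bar> \<le> 1" by (simp only: abs_mult)
    then show ?thesis by (simp add: pos_le_divide_eq mult.commute)
  qed
  have diff': "\<bar>q n x - x\<bar> \<le> 1 + \<bar>x\<bar>" for n x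
  proof (cases "\<bar>x\<bar> \<le> n")
    case True
    have "1 / (real n + 1) \<le> 1" by simp
    then show ?thesis using diff[OF True] by linarith
  qed (simp add: q_def)
  have "(\<lambda>n. \<integral>x. (q n x - x)\<^sup>2 \<partial>\<rho>) \<longlonglongrightarrow> (\<integral>x. 0 \<partial>\<rho>)"
  proof (rule integral_dominated_convergence[where w = "\<lambda>x. 2 + 2 * x\<^sup>2"])
    show "integrable \<rho> (\<lambda>x. 2 + 2 * x\<^sup>2)" using P2D(4)[OF r] by auto
    show "AE x in \<rho>. (\<lambda>n. (q n x - x)\<^sup>2) \<longlonglongrightarrow> 0"
    proof (rule AE_I2)
      fix x
      have "(\<lambda>n. q n x - x) \<longlonglongrightarrow> 0"
      proof (rule Lim_null_comparison)
        obtain k where k: "\<bar>x\<bar> \<le> real k" using real_arch_simple by blast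
        show "eventually (\<lambda>n. norm (q n x - x) \<le> 1 / (real n + 1)) sequentially"
          using eventually_ge_at_top[of k] by eventually_elim (use k in \<open>auto intro!: diff\<close>)
        show "(\<lambda>n. 1 / (real n + 1)) \<longlonglongrightarrow> 0"
          using LIMSEQ_inverse_real_of_nat by (simp add: inverse_eq_divide add.commute)
      qed
      then show "(\<lambda>n. (q n x - x)\<^sup>2) \<longlonglongrightarrow> 0" using tendsto_power[of _ 0 _ 2] by force
    qed
    show "AE x in \<rho>. norm ((q n x - x)\<^sup>2) \<le> 2 + 2 * x\<^sup>2" for n
    proof (rule AE_I2)
      fix x
      have "(q n x - x)\<^sup>2 \<le> (1 + \<bar>x\<bar>)\<^sup>2" using power_mono[OF diff'[of n x], of 2] by simp
      also have "\<dots> \<le> 2 + 2 * x\<^sup>2" using sum_squares_bound[of 1 "\<bar>x\<bar>"] by (simp add: power2_sum)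
      finally show "norm ((q n x - x)\<^sup>2) \<le> 2 + 2 * x\<^sup>2" by simp
    qed
  qed measurable
  then have "eventually (\<lambda>n. (\<integral>x. (q n x - x)\<^sup>2 \<partial>\<rho>) < e\<^sup>2) sequentially"
    using \<open>e > 0\<close> by (intro order_tendstoD) auto
  then obtain n where "(\<integral>x. (q n x - x)\<^sup>2 \<partial>\<rho>) < e\<^sup>2" by (auto simp: eventually_sequentially)
  then have "L2_norm \<rho> (\<lambda>x. q n x - x) < e"
    unfolding L2_norm_def using \<open>e > 0\<close> by (intro real_less_lsqrt) auto
  moreover have fin: "finite (range (q n))"
  proof (rule finite_subset)
    let ?k = "int (n * (n + 1)) + 1"
    show "range (q n) \<subseteq> insert 0 ((\<lambda>k. real_of_int k / (real n + 1)) ` {- ?k..?k})"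
    proof
      fix y assume "y \<in> range (q n)"
      then obtain x where y: "y = q n x" by auto
      show "y \<in> insert 0 ((\<lambda>k. real_of_int k / (real n + 1)) ` {- ?k..?k})"
      proof (cases "\<bar>x\<bar> \<le> n")
        case True
        have "\<bar>(real n + 1) * x\<bar> \<le> (real n + 1) * real n" using True by (simp add: abs_mult mult_left_mono)
        then have "real_of_int (- ?k) \<le> \<lfloor>(real n + 1) * x\<rfloor>" "\<lfloor>(real n + 1) * x\<rfloor> \<le> real_of_int ?k"
          by (simp_all add: abs_le_iff algebra_simps) linarith+
        then have "\<lfloor>(real n + 1) * x\<rfloor> \<in> {- ?k..?k}" by (simp only: of_int_le_iff atLeastAtMost_iff)
        then show ?thesis using True by (auto simp: y q_def)
      qed (simp add: y q_def)
    qed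
  qed auto
  moreover have "square_integrable \<rho> (q n)"
  proof -
    have "bounded (range (q n))" using fin by (rule finite_imp_bounded)
    then obtain B where B: "\<And>x. \<bar>q n x\<bar> \<le> B" by (auto simp: bounded_iff)
    have "(q n x)\<^sup>2 \<le> B\<^sup>2" for x using power_mono[OF B[of x] abs_ge_zero, of 2] by simp
    then have "integrable \<rho> (\<lambda>x. (q n x)\<^sup>2)" by (intro integrable_const_bound[of _ "B\<^sup>2"]) auto
    then show ?thesis by (simp add: square_integrable_def)
  qed
  ultimately show ?thesis by (intro that[of "q n"]) auto
qed

text \<open>For a Lipschitz velocity \<open>g\<close> the velocity part of \<open>D2\<close> is controlled by its position part, so the
  velocity is made Lipschitz before the measure is discretized.\<close>

lemma discrete_approximation:
  assumes r: "\<rho> \<in> P2" and v: "v \<in> L2 \<rho>" and "e > 0"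
  obtains N m x g where "discrete_data N m x" "g \<in> L2 (fst (discrete_state N m x (\<lambda>i. g (x i))))"
    "D2 (discrete_state N m x (\<lambda>i. g (x i))) (\<rho>, momentum \<rho> v) < e"
proof -
  have fm: "finite_measure \<rho>" using P2D(1)[OF r] by (simp add: prob_space_def)
  have "e / 3 > 0" using \<open>e > 0\<close> by simp
  then obtain g L where g: "L-lipschitz_on UNIV g" "bounded (range g)" "L2_norm \<rho> (\<lambda>x. v x - g x) < e / 3"
    by (rule lipschitz_dense_in_L2[OF fm P2D(2)[OF r] L2_square_integrable(1)[OF r v]])
  have "0 \<le> L" by (rule lipschitz_on_nonneg[OF g(1)])
  define d where "d = e / (3 * (L + 1))"
  have d: "d > 0" "d \<le> e / 3" "L * d \<le> e / 3"
    using \<open>e > 0\<close> \<open>0 \<le> L\<close> by (auto simp: d_def field_simps)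
  obtain q where q: "q \<in> borel_measurable borel" "finite (range q)" "square_integrable \<rho> q" "L2_norm \<rho> (\<lambda>x. q x - x) < d"
    using finite_range_approximation[OF r d(1)] by blast
  obtain N m x where N: "discrete_data N m x" "\<And>v. fst (discrete_state N m x v) = distr \<rho> borel q"
    using finite_range_discrete[OF P2D(5)[OF r] q(1,2)] by blast
  let ?\<sigma> = "distr \<rho> borel q" and ?\<mu> = "discrete_state N m x (\<lambda>i. g (x i))"
  have s: "?\<sigma> \<in> P2" using q(3) P2D(1)[OF r] by (rule distr_in_P2[rotated])
  have gL: "g \<in> L2 ?\<sigma>" "g \<in> L2 \<rho>" using L2_lipschitz g(1,2) r s by blast+
  have \<mu>: "?\<mu> = (?\<sigma>, momentum ?\<sigma> g)"
    using discrete_state_eq_momentum[OF N(1), of g "\<lambda>i. g (x i)"] gL N(2) by (auto simp: L2_iff prod_eq_iff)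
  have id: "square_integrable \<rho> (\<lambda>x. x)" "distr \<rho> borel (\<lambda>x. x) = \<rho>"
    using P2D[OF r] by (auto simp: square_integrable_def distr_id2)
  have W: "W2 ?\<sigma> \<rho> < d"
    using W2_le_L2_norm[OF P2D(1)[OF r] q(3) id(1)] q(4) by (simp add: id)
  have "L2_norm unif (\<lambda>w. g (X_of ?\<sigma> w) - v (X_of \<rho> w))
      \<le> L2_norm unif (\<lambda>w. g (X_of ?\<sigma> w) - g (X_of \<rho> w)) + L2_norm unif (\<lambda>w. g (X_of \<rho> w) - v (X_of \<rho> w))"
    using L2_square_integrable(2) r s gL v by (intro L2_norm_triangle_diff) auto
  also have "L2_norm unif (\<lambda>w. g (X_of \<rho> w) - v (X_of \<rho> w)) = L2_norm \<rho> (\<lambda>x. g x - v x)"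
    using square_integrable_comp_X_of(2)[OF r, of "\<lambda>x. g x - v x"] gL v by (auto simp: L2_iff)
  also have "\<dots> < e / 3" using g(3) by (simp add: L2_norm_diff_commute[of _ g v])
  also have "L2_norm unif (\<lambda>w. g (X_of ?\<sigma> w) - g (X_of \<rho> w)) \<le> L2_norm unif (\<lambda>w. L * (X_of ?\<sigma> w - X_of \<rho> w))"
    unfolding L2_norm_def
  proof (intro real_sqrt_le_mono integral_mono)
    fix w
    have "\<bar>g (X_of ?\<sigma> w) - g (X_of \<rho> w)\<bar> \<le> \<bar>L * (X_of ?\<sigma> w - X_of \<rho> w)\<bar>"
      using lipschitz_onD[OF g(1), of "X_of ?\<sigma> w" "X_of \<rho> w"] \<open>0 \<le> L\<close> by (simp add: dist_real_def abs_mult)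
    then show "(g (X_of ?\<sigma> w) - g (X_of \<rho> w))\<^sup>2 \<le> (L * (X_of ?\<sigma> w - X_of \<rho> w))\<^sup>2"
      by (simp add: abs_le_square_iff)
  qed (use L2_square_integrable(2) square_integrable_X_of r s gL in
      \<open>intro square_integrableD square_integrable_diff square_integrable_cmult; auto\<close>)+
  also have "\<dots> = L * W2 ?\<sigma> \<rho>" using \<open>0 \<le> L\<close> by (simp only: L2_norm_cmult W2_eq[OF s r] abs_of_nonneg)
  also have "\<dots> \<le> e / 3" using W d \<open>0 \<le> L\<close> by (meson less_imp_le mult_left_mono order_trans)
  finally have V: "L2_norm unif (\<lambda>w. g (X_of ?\<sigma> w) - v (X_of \<rho> w)) < 2 * (e / 3)" by simp
  have "D2 ?\<mu> (\<rho>, momentum \<rho> v) \<le> W2 ?\<sigma> \<rho> + L2_norm unif (\<lambda>w. g (X_of ?\<sigma> w) - v (X_of \<rho> w))"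
    unfolding \<mu> D2_momentum[OF s gL(1) r v] by (intro sqrt_sum_squares_le_sum W2_nonneg L2_norm_nonneg)
  also have "\<dots> < e" using V W d by simp
  finally show ?thesis using gL N by (intro that[of N m x g]) auto
qed


section \<open>Sticky particles in the space of quantile functions\<close>

definition inner_unif :: "(real \<Rightarrow> real) \<Rightarrow> (real \<Rightarrow> real) \<Rightarrow> real" where
  "inner_unif f g = (\<integral>w. f w * g w \<partial>unif)"

lemma inner_unif_commute: "inner_unif f g = inner_unif g f"
  by (simp add: inner_unif_def mult.commute)

lemma inner_unif_add:
  assumes "square_integrable unif f" "square_integrable unif g" "square_integrable unif h"
  shows "inner_unif (\<lambda>w. f w + c * g w) h = inner_unif f h + c * inner_unif g h"
proof -
  have "inner_unif (\<lambda>w. f w + c * g w) h = (\<integral>w. f w * h w + c * (g w * h w) \<partial>unif)"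
    by (simp add: inner_unif_def algebra_simps)
  also have "\<dots> = inner_unif f h + c * inner_unif g h"
    unfolding inner_unif_def using assms by (subst Bochner_Integration.integral_add) (auto intro: square_integrable_mult)
  finally show ?thesis .
qed

lemma inner_unif_diff:
  assumes "square_integrable unif f" "square_integrable unif g" "square_integrable unif h"
  shows "inner_unif (\<lambda>w. f w - g w) h = inner_unif f h - inner_unif g h"
  using inner_unif_add[OF assms, of "-1"] by simp

lemma L2_norm_diff_square:
  assumes "square_integrable unif f" "square_integrable unif g"
  shows "(L2_norm unif (\<lambda>w. f w - g w))\<^sup>2 = inner_unif f f - 2 * inner_unif f g + inner_unif g g"
proof -
  have d: "square_integrable unif (\<lambda>w. f w - g w)" using assms by (rule square_integrable_diff)
  have "(L2_norm unif (\<lambda>w. f w - g w))\<^sup>2 = inner_unif (\<lambda>w. f w - g w) (\<lambda>w. f w - g w)"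
    unfolding L2_norm_square inner_unif_def by (simp only: power2_eq_square)
  also have "\<dots> = inner_unif f (\<lambda>w. f w - g w) - inner_unif g (\<lambda>w. f w - g w)"
    using assms d by (intro inner_unif_diff)
  also have "\<dots> = inner_unif (\<lambda>w. f w - g w) f - inner_unif (\<lambda>w. f w - g w) g"
    by (simp only: inner_unif_commute)
  also have "\<dots> = inner_unif f f - 2 * inner_unif f g + inner_unif g g"
    using assms by (simp add: inner_unif_diff inner_unif_commute[of g f])
  finally show ?thesis .
qed

context sticky
begin

lemma N_pos: "0 < N"
  using m_sum by (cases N) auto

text \<open>The particle that carries the mass coordinate \<open>w\<close>: the quantile function of the law of the index, where
  the minimum keeps the value in the index range for every real \<open>w\<close>, also outside the unit interval. Every function of the index
  becomes a function on the unit interval with the corresponding discrete law, and all times and all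
  velocities live on this one space.\<close>

definition idx :: "real \<Rightarrow> nat" where
  "idx w = min (N - 1) (nat \<lfloor>X_of (fst (discrete_state N m real (\<lambda>_. 0))) w\<rfloor>)"

lemma idx_less: "idx w < N"
  using N_pos by (auto simp: idx_def min_def)

abbreviation (input) index_law :: "real measure" where
  "index_law \<equiv> fst (discrete_state N m real (\<lambda>_. 0))"

lemma index_law_P2: "index_law \<in> P2"
  using m_pos m_sum by (rule discrete_state_P2)

lemma index_data: "discrete_data N m real"
  using m_pos m_sum by (auto simp: discrete_data_def strict_mono_on_def)

lemma idx_mono: "0 < w \<Longrightarrow> w \<le> w' \<Longrightarrow> w' < 1 \<Longrightarrow> idx w \<le> idx w'"
  unfolding idx_def
  by (intro min.mono nat_mono floor_mono mono_onD[OF X_of_mono[OF P2D(5)[OF index_law_P2]]]) auto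

lemma
  shows square_integrable_idx: "square_integrable unif (\<lambda>w. f (idx w))"
    and integral_idx: "(\<integral>w. f (idx w) \<partial>unif) = (\<Sum>i<N. m i * f i)"
    and distr_idx: "distr unif borel (\<lambda>w. f (idx w)) = fst (discrete_state N m f u)"
proof -
  let ?r = "\<lambda>y. min (N - 1) (nat \<lfloor>y\<rfloor>)"
  let ?f = "\<lambda>y::real. f (?r y)"
  have r [measurable]: "?r \<in> (borel :: real measure) \<rightarrow>\<^sub>M count_space UNIV" by measurable
  have [measurable]: "?f \<in> borel_measurable borel" by measurable
  note [measurable] = measurable_X_of[OF index_law_P2]
  have idx: "f (idx w) = ?f (X_of index_law w)" for w by (simp add: idx_def)
  have fi: "?f (real i) = f i" if "i < N" for i
  proof -
    have "i \<le> N - 1" using that by simp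
    then show ?thesis by (simp add: min_absorb2)
  qed
  have "integrable index_law (\<lambda>y. (?f y)\<^sup>2)" by (rule sum_discrete_state(2)[OF index_data]) measurable
  then show "square_integrable unif (\<lambda>w. f (idx w))"
    unfolding idx by (subst square_integrable_comp_X_of(1)[OF index_law_P2]) auto
  have "(\<integral>w. f (idx w) \<partial>unif) = (\<integral>y. ?f y \<partial>distr unif borel (X_of index_law))"
    unfolding idx by (subst integral_distr) auto
  also have "\<dots> = (\<integral>y. ?f y \<partial>index_law)" by (simp add: distr_X_of[OF P2D(5)[OF index_law_P2]])
  also have "\<dots> = (\<Sum>i<N. m i * ?f (real i))" by (rule sum_discrete_state(1)[OF index_data]) measurable
  also have "\<dots> = (\<Sum>i<N. m i * f i)" using fi by (intro sum.cong) auto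
  finally show "(\<integral>w. f (idx w) \<partial>unif) = (\<Sum>i<N. m i * f i)" .
  have "distr unif borel (\<lambda>w. f (idx w)) = distr index_law borel ?f"
    unfolding idx by (rule square_integrable_comp_X_of(3)[OF index_law_P2]) measurable
  also have "\<dots> = distr (point_measure {..<N} (\<lambda>i. ennreal (m i))) borel (?f \<circ> real)"
    unfolding discrete_state_def fst_conv by (rule distr_distr) (auto simp: measurable_point_measure_eq1)
  also have "\<dots> = distr (point_measure {..<N} (\<lambda>i. ennreal (m i))) borel f"
    using fi by (intro distr_cong) (auto simp: space_point_measure)
  finally show "distr unif borel (\<lambda>w. f (idx w)) = fst (discrete_state N m f u)" by (simp add: discrete_state_def)
qed

text \<open>Tested against functions of the index, \<open>Z\<close> acts through its averages over the cells of constant \<open>idx\<close>.\<close>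

definition cell_mean :: "(real \<Rightarrow> real) \<Rightarrow> nat \<Rightarrow> real" where
  "cell_mean Z i = (\<integral>w. (if idx w = i then Z w else 0) \<partial>unif) / m i"

lemma square_integrable_indicator_idx: "square_integrable unif (\<lambda>w. if idx w = i then 1 else 0)"
  using square_integrable_idx[of "\<lambda>j. if j = i then 1 else 0"] .

lemma integrable_cell:
  assumes "square_integrable unif Z"
  shows "integrable unif (\<lambda>w. if idx w = i then Z w else 0)"
proof -
  have "integrable unif (\<lambda>w. (if idx w = i then 1 else 0) * Z w)"
    by (rule square_integrable_mult[OF square_integrable_indicator_idx assms])
  moreover have "(\<lambda>w. (if idx w = i then 1 else 0) * Z w) = (\<lambda>w. if idx w = i then Z w else 0)" by auto
  ultimately show ?thesis by simp
qed

lemma inner_idx: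
  assumes "square_integrable unif Z"
  shows "inner_unif (\<lambda>w. f (idx w)) Z = (\<Sum>i<N. m i * f i * cell_mean Z i)"
proof -
  have "f (idx w) * Z w = (\<Sum>i<N. f i * (if idx w = i then Z w else 0))" for w
  proof -
    have "(\<Sum>i<N. f i * (if idx w = i then Z w else 0)) = (\<Sum>i<N. if idx w = i then f i * Z w else 0)"
      by (intro sum.cong) auto
    also have "\<dots> = f (idx w) * Z w" using idx_less by (simp add: sum.delta)
    finally show ?thesis by simp
  qed
  then have "inner_unif (\<lambda>w. f (idx w)) Z = (\<Sum>i<N. f i * (\<integral>w. (if idx w = i then Z w else 0) \<partial>unif))"
    unfolding inner_unif_def using integrable_cell[OF assms] by (simp add: Bochner_Integration.integral_sum)
  also have "\<dots> = (\<Sum>i<N. m i * f i * cell_mean Z i)"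
  proof (intro sum.cong refl)
    fix i assume "i \<in> {..<N}"
    then have "m i \<noteq> 0" using m_pos[of i] by simp
    then show "f i * (\<integral>w. (if idx w = i then Z w else 0) \<partial>unif) = m i * f i * cell_mean Z i"
      by (simp add: cell_mean_def)
  qed
  finally show ?thesis .
qed

text \<open>The particles occupy consecutive intervals of mass coordinates, and averages of a nondecreasing function
  over consecutive intervals are ordered.\<close>

lemma cell_mean_mono:
  assumes Z: "square_integrable unif Z" "mono_on {0<..<1} Z" and ij: "i \<le> j" "j < N"
  shows "cell_mean Z i \<le> cell_mean Z j"
proof (cases "i = j")
  case False
  define E where "E = (\<lambda>k. {w\<in>{0<..<1}. idx w = k})"
  have mass: "(\<integral>w. (if idx w = k then 1 else 0) \<partial>unif) = m k" if "k < N" for k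
    using integral_idx[of "\<lambda>l. if l = k then 1 else 0"] that by (simp add: if_distrib[of "\<lambda>x. _ * x"] cong: if_cong)
  have ne: "E k \<noteq> {}" if "k < N" for k
  proof
    assume "E k = {}"
    then have "(\<integral>w. (if idx w = k then 1 else 0) \<partial>unif) = (\<integral>w. 0 \<partial>unif :: real)"
      by (intro Bochner_Integration.integral_cong) (auto simp: E_def space_unif)
    then show False using mass[OF that] m_pos[OF that] by simp
  qed
  have le: "Z a \<le> Z b" if "a \<in> E i" "b \<in> E j" for a b
  proof -
    have "a \<le> b"
    proof (rule ccontr)
      assume "\<not> a \<le> b"
      then have "idx b \<le> idx a" using that by (intro idx_mono) (auto simp: E_def)
      then show False using that ij False by (auto simp: E_def)
    qed
    then show ?thesis using that by (intro mono_onD[OF Z(2)]) (auto simp: E_def)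
  qed
  define c where "c = Inf (Z ` E j)"
  have bdd: "bdd_below (Z ` E j)"
  proof -
    obtain a where "a \<in> E i" using ne[of i] ij by auto
    then show ?thesis by (intro bdd_belowI2[of _ "Z a"]) (rule le)
  qed
  have ci: "Z a \<le> c" if "a \<in> E i" for a
    unfolding c_def using ne[of j] ij le that by (intro cINF_greatest) auto
  have cj: "c \<le> Z b" if "b \<in> E j" for b
    unfolding c_def using that bdd by (intro cINF_lower)
  have int: "integrable unif (\<lambda>w. c * (if idx w = k then 1 else 0))" for k
    using square_integrable_mult[OF square_integrable_indicator_idx[of k] square_integrable_cmult[OF square_integrable_indicator_idx[of k], of c]]
    by (rule Bochner_Integration.integrable_cong[THEN iffD1, rotated 2]) auto
  have "(\<integral>w. (if idx w = i then Z w else 0) \<partial>unif) \<le> (\<integral>w. c * (if idx w = i then 1 else 0) \<partial>unif)"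
    by (rule integral_mono[OF integrable_cell[OF Z(1)] int]) (auto simp: space_unif E_def intro!: ci)
  then have 1: "cell_mean Z i \<le> c" using mass[of i] m_pos[of i] ij by (simp add: cell_mean_def divide_le_eq)
  have "(\<integral>w. c * (if idx w = j then 1 else 0) \<partial>unif) \<le> (\<integral>w. (if idx w = j then Z w else 0) \<partial>unif)"
    by (rule integral_mono[OF int integrable_cell[OF Z(1)]]) (auto simp: space_unif E_def intro!: cj)
  then have 2: "c \<le> cell_mean Z j" using mass[of j] m_pos[of j] ij by (simp add: cell_mean_def le_divide_eq)
  from 1 2 show ?thesis by (rule order.trans)
qed simp

abbreviation pos :: "real \<Rightarrow> real \<Rightarrow> real" where
  "pos t \<equiv> \<lambda>w. x (idx w) t"

abbreviation vel0 :: "real \<Rightarrow> real" where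
  "vel0 \<equiv> \<lambda>w. v0 (idx w)"

abbreviation law :: "real \<Rightarrow> real measure" where
  "law t \<equiv> distr unif borel (pos t)"

lemma sq_pos: "square_integrable unif (pos t)" and sq_vel0: "square_integrable unif vel0"
  by (rule square_integrable_idx)+

lemma law_eq: "law t = fst (discrete_state N m (\<lambda>i. x i t) u)"
  by (rule distr_idx)

lemma law_P2: "law t \<in> P2"
  by (rule distr_in_P2[OF prob_space_unif sq_pos])

lemma pos_mono: "t \<ge> 0 \<Longrightarrow> mono_on {0<..<1} (pos t)"
  by (intro mono_onI x_mono idx_mono idx_less) auto

lemma pos_increasing: "t \<ge> 0 \<Longrightarrow> ae_increasing (pos t)"
  using pos_mono[of t] square_integrable_measurable[OF sq_pos]
  by (auto simp: ae_increasing_def intro!: bexI[of _ "{}"])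

text \<open>The next three lemmas restate the moment estimates in \<open>L\<^sup>2(0,1)\<close>. This one together with the equation
  \<open>inner_pos_eq\<close> for \<open>s = t\<close> says that \<open>pos t\<close> is the projection of \<open>pos 0 + t vel0\<close> onto the cone of
  nondecreasing functions.\<close>

lemma inner_pos_ge:
  assumes "0 \<le> t" "square_integrable unif Z" "mono_on {0<..<1} Z"
  shows "t * inner_unif vel0 Z \<le> inner_unif (pos t) Z - inner_unif (pos 0) Z"
proof -
  have "inner_unif (pos 0) Z = (\<Sum>i<N. m i * x0 i * cell_mean Z i)"
    using assms by (subst inner_idx) (auto simp: x_0)
  then show ?thesis using moment_ge[of t "cell_mean Z"] cell_mean_mono[OF assms(2,3)] assms
    by (simp add: inner_idx[of Z v0] inner_idx[of Z "\<lambda>i. x i t"])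
qed

lemma inner_pos_quotient_le:
  assumes "0 < s" "s \<le> t" "square_integrable unif Z" "mono_on {0<..<1} Z"
  shows "t * (inner_unif (pos s) Z - inner_unif (pos 0) Z) \<le> s * (inner_unif (pos t) Z - inner_unif (pos 0) Z)"
proof -
  have "inner_unif (pos 0) Z = (\<Sum>i<N. m i * x0 i * cell_mean Z i)"
    using assms by (subst inner_idx) (auto simp: x_0)
  then show ?thesis using moment_quotient_le[of s t "cell_mean Z"] cell_mean_mono[OF assms(3,4)] assms
    by (simp add: inner_idx[of Z "\<lambda>i. x i s"] inner_idx[of Z "\<lambda>i. x i t"])
qed

lemma inner_pos_eq:
  assumes "0 \<le> s" "s \<le> t"
  shows "inner_unif (pos s) (pos t) - inner_unif (pos 0) (pos t) = s * inner_unif vel0 (pos t)"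
proof -
  have ip: "inner_unif (\<lambda>w. f (idx w)) (\<lambda>w. g (idx w)) = (\<Sum>i<N. m i * f i * g i)" for f g
    using integral_idx[of "\<lambda>i. f i * g i"] by (simp add: inner_unif_def mult.assoc)
  have "inner_unif (pos s) (pos t) = (\<Sum>i<N. m i * x i s * x i t)" "inner_unif vel0 (pos t) = (\<Sum>i<N. m i * v0 i * x i t)"
    by (rule ip)+
  moreover have "inner_unif (pos 0) (pos t) = (\<Sum>i<N. m i * x0 i * x i t)"
    by (subst ip) (auto simp: x_0)
  ultimately show ?thesis using moment_eq[of s t "\<lambda>i. x i t"] assms by simp
qed

text \<open>Projections onto convex sets are contractions, and the projected points \<open>pos 0 + t vel0\<close> move with
  constant velocity.\<close>

lemma pos_lipschitz:
  assumes "0 \<le> s" "s \<le> t"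
  shows "L2_norm unif (\<lambda>w. pos t w - pos s w) \<le> (t - s) * L2_norm unif vel0"
proof -
  let ?d = "L2_norm unif (\<lambda>w. pos t w - pos s w)"
  have "s * inner_unif vel0 (pos s) = inner_unif (pos s) (pos s) - inner_unif (pos 0) (pos s)"
    using inner_pos_eq[of s s] assms by simp
  moreover have "t * inner_unif vel0 (pos s) \<le> inner_unif (pos t) (pos s) - inner_unif (pos 0) (pos s)"
    using assms by (intro inner_pos_ge sq_pos pos_mono) auto
  moreover have "inner_unif (pos s) (pos t) - inner_unif (pos 0) (pos t) = s * inner_unif vel0 (pos t)"
    "inner_unif (pos t) (pos t) - inner_unif (pos 0) (pos t) = t * inner_unif vel0 (pos t)"
    using assms by (auto intro: inner_pos_eq)
  ultimately have "?d\<^sup>2 \<le> (t - s) * (inner_unif vel0 (pos t) - inner_unif vel0 (pos s))"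
    unfolding L2_norm_diff_square[OF sq_pos sq_pos] by (simp add: inner_unif_commute[of "pos s" "pos t"] algebra_simps)
  also have "inner_unif vel0 (pos t) - inner_unif vel0 (pos s) = inner_unif (\<lambda>w. pos t w - pos s w) vel0"
    by (simp add: inner_unif_diff sq_pos sq_vel0 inner_unif_commute[of vel0])
  also have "(t - s) * \<dots> \<le> (t - s) * (?d * L2_norm unif vel0)"
    unfolding inner_unif_def using assms
    by (intro mult_left_mono inner_le_L2_norm square_integrable_diff sq_pos sq_vel0) auto
  finally have "?d * ?d \<le> ?d * ((t - s) * L2_norm unif vel0)" by (simp add: power2_eq_square algebra_simps)
  then show ?thesis
    using L2_norm_nonneg[of unif "\<lambda>w. pos t w - pos s w"] assms
    by (cases "?d = 0") (auto simp: L2_norm_nonneg mult_le_cancel_left)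
qed

lemma law_lipschitz:
  assumes "0 \<le> s" "s \<le> t"
  shows "W2 (law t) (law s) \<le> (t - s) * L2_norm unif vel0"
  using W2_le_L2_norm[OF prob_space_unif sq_pos sq_pos, of t s] pos_lipschitz[OF assms] by simp

lemma W2_law:
  assumes "t \<ge> 0" "\<eta> \<in> P2"
  shows "W2 (law t) \<eta> = L2_norm unif (\<lambda>w. pos t w - X_of \<eta> w)"
  using W2_comonotone[OF pos_increasing[OF assms(1)] X_of_increasing[OF P2D(5)[OF assms(2)]] sq_pos square_integrable_X_of[OF assms(2)]]
  by (simp add: distr_X_of[OF P2D(5)[OF assms(2)]])

text \<open>The contraction property again, for the nondecreasing function \<open>X_of \<eta>\<close>, which is its own projection.\<close>

lemma law_projection:
  assumes "t \<ge> 0" "\<eta> \<in> P2"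
  shows "W2 (law t) \<eta> \<le> L2_norm unif (\<lambda>w. (pos 0 w + t * vel0 w) - X_of \<eta> w)"
proof (rule power2_le_imp_le)
  let ?Z = "X_of \<eta>" and ?U = "\<lambda>w. pos 0 w + t * vel0 w" and ?X = "pos t"
  have Z: "square_integrable unif ?Z" "mono_on {0<..<1} ?Z"
    using assms by (auto intro: square_integrable_X_of X_of_mono P2D)
  have U: "square_integrable unif ?U" by (intro square_integrable_add square_integrable_cmult sq_pos sq_vel0)
  have UZ: "inner_unif ?U ?Z = inner_unif (pos 0) ?Z + t * inner_unif vel0 ?Z"
    "inner_unif ?U ?X = inner_unif (pos 0) ?X + t * inner_unif vel0 ?X"
    using Z by (auto intro!: inner_unif_add sq_pos sq_vel0)
  have "0 \<le> (L2_norm unif (\<lambda>w. ?U w - ?X w))\<^sup>2" by simp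
  then have "0 \<le> inner_unif ?U ?U - 2 * inner_unif ?U ?X + inner_unif ?X ?X"
    by (simp only: L2_norm_diff_square[OF U sq_pos])
  moreover have "inner_unif ?U ?X = inner_unif ?X ?X" using inner_pos_eq[of t t] assms UZ by simp
  moreover have "inner_unif ?U ?Z \<le> inner_unif ?X ?Z" using inner_pos_ge[of t ?Z] Z assms UZ by simp
  ultimately show "(W2 (law t) \<eta>)\<^sup>2 \<le> (L2_norm unif (\<lambda>w. ?U w - ?Z w))\<^sup>2"
    unfolding W2_law[OF assms] L2_norm_diff_square[OF U Z(1)] L2_norm_diff_square[OF sq_pos Z(1)] by simp
qed (rule L2_norm_nonneg)

text \<open>The evolution variational inequality, in increments and with a quadratic error. The identity
  \<open>\<bar>y - z\<bar>\<^sup>2 / 2 + \<bar>y - o\<bar>\<^sup>2 / 2 - \<bar>o - z\<bar>\<^sup>2 / 2 = \<langle>y - o, y - z\<rangle>\<close> turns the bracket on the right into an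
  inner product, denoted by \<open>q\<close> below, and the claim into an estimate for the Euler step of length \<open>a\<close>
  from \<open>s\<close> in the direction \<open>pos s - pos 0\<close>.\<close>

lemma law_evi:
  assumes s: "0 < s" "s \<le> t" and eta: "\<eta> \<in> P2"
  defines "a \<equiv> t / s - 1"
  shows "(W2 (law t) \<eta>)\<^sup>2 / 2 - (W2 (law s) \<eta>)\<^sup>2 / 2
    \<le> a * ((W2 (law s) \<eta>)\<^sup>2 / 2 + (W2 (law s) (law 0))\<^sup>2 / 2 - (W2 (law 0) \<eta>)\<^sup>2 / 2)
      + a\<^sup>2 * (s * L2_norm unif vel0)\<^sup>2"
proof -
  let ?Z = "X_of \<eta>" and ?Y = "pos s" and ?Y' = "pos t" and ?O = "pos 0" and ?ip = inner_unif
  have Z: "square_integrable unif ?Z" "mono_on {0<..<1} ?Z"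
    using eta by (auto intro: square_integrable_X_of X_of_mono P2D)
  have a: "0 \<le> a" "t = s * (1 + a)" "a * s = t - s" using s by (auto simp: a_def field_simps)
  have W0: "W2 (law s) (law 0) = L2_norm unif (\<lambda>w. ?Y w - ?O w)"
    using s by (intro W2_comonotone pos_increasing sq_pos) auto
  \<comment> \<open>The Euler step misses \<open>pos t\<close> by a vector orthogonal to \<open>pos t\<close> (1) and of known sign against
    nondecreasing functions (2). Replacing \<open>pos t\<close> by \<open>pos s\<close> in the inner product with
    \<open>pos s - pos 0\<close> costs a quadratic error (3).\<close>
  have 1: "?ip ?Y' ?Y' - ?ip ?Y ?Y' - a * (?ip ?Y ?Y' - ?ip ?O ?Y') = 0"
    using inner_pos_eq[of s t] inner_pos_eq[of t t] s a(2) by (simp add: algebra_simps)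
  have 2: "a * (?ip ?Y ?Z - ?ip ?O ?Z) \<le> ?ip ?Y' ?Z - ?ip ?Y ?Z"
  proof -
    have "s * ((1 + a) * (?ip ?Y ?Z - ?ip ?O ?Z)) \<le> s * (?ip ?Y' ?Z - ?ip ?O ?Z)"
      using inner_pos_quotient_le[of s t ?Z] s Z a(2) by (simp add: mult.assoc)
    then have "(1 + a) * (?ip ?Y ?Z - ?ip ?O ?Z) \<le> ?ip ?Y' ?Z - ?ip ?O ?Z"
      using s by (simp add: mult_le_cancel_left_pos)
    then show ?thesis by (simp add: algebra_simps)
  qed
  have 3: "a * (?ip ?Y ?Y' - ?ip ?O ?Y' - ?ip ?Y ?Y + ?ip ?O ?Y) \<le> a\<^sup>2 * (s * L2_norm unif vel0)\<^sup>2"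
  proof -
    let ?K = "L2_norm unif vel0"
    have "?ip ?Y ?Y' - ?ip ?O ?Y' - ?ip ?Y ?Y + ?ip ?O ?Y = ?ip (\<lambda>w. ?Y w - ?O w) ?Y' - ?ip (\<lambda>w. ?Y w - ?O w) ?Y"
      by (simp add: inner_unif_diff sq_pos)
    also have "\<dots> = ?ip ?Y' (\<lambda>w. ?Y w - ?O w) - ?ip ?Y (\<lambda>w. ?Y w - ?O w)" by (simp only: inner_unif_commute)
    also have "\<dots> = ?ip (\<lambda>w. ?Y' w - ?Y w) (\<lambda>w. ?Y w - ?O w)"
      by (rule inner_unif_diff[symmetric]) (intro sq_pos square_integrable_diff)+
    also have "\<dots> \<le> L2_norm unif (\<lambda>w. ?Y' w - ?Y w) * L2_norm unif (\<lambda>w. ?Y w - ?O w)"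
      unfolding inner_unif_def by (intro inner_le_L2_norm sq_pos square_integrable_diff)
    also have "\<dots> \<le> ((t - s) * ?K) * ((s - 0) * ?K)"
      using s by (intro mult_mono pos_lipschitz mult_nonneg_nonneg L2_norm_nonneg) auto
    also have "\<dots> = a * (s * ?K)\<^sup>2" unfolding a(3)[symmetric] by (simp add: power2_eq_square)
    finally have "?ip ?Y ?Y' - ?ip ?O ?Y' - ?ip ?Y ?Y + ?ip ?O ?Y \<le> a * (s * ?K)\<^sup>2" .
    from mult_left_mono[OF this a(1)] show ?thesis by (simp add: power2_eq_square mult.assoc)
  qed
  have "0 \<le> (L2_norm unif (\<lambda>w. ?Y' w - ?Y w))\<^sup>2" by simp
  then have 4: "0 \<le> ?ip ?Y' ?Y' - 2 * ?ip ?Y ?Y' + ?ip ?Y ?Y"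
    by (simp only: L2_norm_diff_square[OF sq_pos sq_pos] inner_unif_commute[of ?Y' ?Y])
  define q where "q = ?ip ?Y ?Y - ?ip ?Y ?Z - ?ip ?O ?Y + ?ip ?O ?Z"
  have E: "(W2 (law s) \<eta>)\<^sup>2 / 2 + (W2 (law s) (law 0))\<^sup>2 / 2 - (W2 (law 0) \<eta>)\<^sup>2 / 2 = q"
    using s eta unfolding W0 by (simp add: W2_law L2_norm_diff_square sq_pos Z q_def inner_unif_commute[of ?Y ?O] field_simps)
  have "(W2 (law t) \<eta>)\<^sup>2 / 2 - (W2 (law s) \<eta>)\<^sup>2 / 2 = ?ip ?Y' ?Y' / 2 - ?ip ?Y' ?Z - ?ip ?Y ?Y / 2 + ?ip ?Y ?Z"
    using s eta by (simp add: W2_law L2_norm_diff_square sq_pos Z field_simps)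
  also have "\<dots> \<le> a * q + a\<^sup>2 * (s * L2_norm unif vel0)\<^sup>2"
    using 1 2 3 4 unfolding q_def by (simp add: algebra_simps)
  finally show ?thesis unfolding E .
qed

end


section \<open>From discrete to general data\<close>

text \<open>The estimates for discrete data that are \<open>D2\<close>-close to given ones. All constants depend only on the
  latter and on \<open>e\<close>, which makes the estimates stable in the limit.\<close>

lemma sticky_trajectory_estimates:
  assumes S: "sticky_semigroup S" and r0: "\<rho>0 \<in> P2" "v0 \<in> L2 \<rho>0"
    and data: "discrete_data N m x0" and g: "g \<in> L2 (fst (discrete_state N m x0 (\<lambda>i. g (x0 i))))"
    and close: "D2 (discrete_state N m x0 (\<lambda>i. g (x0 i))) (\<rho>0, momentum \<rho>0 v0) < e"
  defines "\<mu> \<equiv> discrete_state N m x0 (\<lambda>i. g (x0 i))"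
  defines "R \<equiv> \<lambda>t. fst (S t \<mu>)"
  defines "K \<equiv> L2_norm \<rho>0 v0 + e"
  shows "\<mu> \<in> V2" and "W2 (fst \<mu>) \<rho>0 \<le> e" and "fst \<mu> \<in> P2"
    and "\<And>s t. 0 \<le> s \<Longrightarrow> s \<le> t \<Longrightarrow> W2 (R t) (R s) \<le> (t - s) * K"
    and "\<And>t \<eta>. 0 \<le> t \<Longrightarrow> \<eta> \<in> P2 \<Longrightarrow>
      W2 (R t) \<eta> \<le> L2_norm unif (\<lambda>w. X_of \<rho>0 w + t * v0 (X_of \<rho>0 w) - X_of \<eta> w) + (1 + t) * e"
    and "\<And>s t \<eta>. 0 < s \<Longrightarrow> s \<le> t \<Longrightarrow> \<eta> \<in> P2 \<Longrightarrow>
      (W2 (R t) \<eta>)\<^sup>2 / 2 - (W2 (R s) \<eta>)\<^sup>2 / 2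
      \<le> (t / s - 1) * ((W2 (R s) \<eta>)\<^sup>2 / 2 + (W2 (R s) (fst \<mu>))\<^sup>2 / 2 - (W2 (fst \<mu>) \<eta>)\<^sup>2 / 2)
        + (t / s - 1)\<^sup>2 * (s * K)\<^sup>2"
proof -
  obtain x v where xv: "sticky_evolution N m x0 (\<lambda>i. g (x0 i)) x v"
    and St: "\<And>t. t \<ge> 0 \<Longrightarrow> S t \<mu> = discrete_state N m (\<lambda>i. x i t) (\<lambda>i. v i t)"
    using S data unfolding sticky_semigroup_def \<mu>_def by blast
  interpret sticky N m x0 "\<lambda>i. g (x0 i)" x v by standard fact+
  have R: "R t = law t" if "t \<ge> 0" for t
    using St[OF that] law_eq[of t "\<lambda>i. v i t"] by (simp add: R_def)
  let ?X = "X_of \<rho>0" and ?V = "\<lambda>w. v0 (X_of \<rho>0 w)"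
  have gb: "g \<in> borel_measurable borel" using g by (simp add: L2_iff)
  have \<mu>: "\<mu> = (fst \<mu>, momentum (fst \<mu>) g)"
    using discrete_state_eq_momentum[OF data gb, of "\<lambda>i. g (x0 i)"] by (simp add: \<mu>_def prod_eq_iff)
  have law0: "law 0 = fst \<mu>"
  proof -
    have "law 0 = distr unif borel (\<lambda>w. x0 (idx w))" by (simp add: x_0 idx_less)
    then show ?thesis unfolding \<mu>_def distr_idx[of x0 "\<lambda>i. g (x0 i)"] .
  qed
  then show s: "fst \<mu> \<in> P2" using law_P2[of 0] by simp
  have g': "g \<in> L2 (fst \<mu>)" using g by (simp add: \<mu>_def)
  show "\<mu> \<in> V2" using momentum_in_V2[OF s g'] \<mu> by simp
  have D: "sqrt ((W2 (fst \<mu>) \<rho>0)\<^sup>2 + (L2_norm unif (\<lambda>w. g (X_of (fst \<mu>) w) - ?V w))\<^sup>2) < e"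
    using close unfolding \<mu>_def[symmetric] by (subst (asm) \<mu>) (simp only: D2_momentum[OF s g' r0])
  have W: "W2 (fst \<mu>) \<rho>0 \<le> e"
    using D real_sqrt_sum_squares_ge1[of "W2 (fst \<mu>) \<rho>0"] by (meson less_imp_le order_trans)
  then show "W2 (fst \<mu>) \<rho>0 \<le> e" .
  have e: "0 \<le> e" using W W2_nonneg[of "fst \<mu>" \<rho>0] by simp
  have AE0: "AE w in unif. X_of (fst \<mu>) w = pos 0 w"
    using X_of_unique[OF pos_increasing[of 0] sq_pos] by (simp add: law0)
  have sqV: "square_integrable unif ?X" "square_integrable unif ?V"
    using r0 by (auto intro: square_integrable_X_of L2_square_integrable(2))
  have V: "L2_norm unif (\<lambda>w. vel0 w - ?V w) \<le> e"
  proof -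
    have "L2_norm unif (\<lambda>w. vel0 w - ?V w) = L2_norm unif (\<lambda>w. g (X_of (fst \<mu>) w) - ?V w)"
    proof (rule L2_norm_cong_AE)
      show "AE w in unif. vel0 w - ?V w = g (X_of (fst \<mu>) w) - ?V w"
        using AE0 by eventually_elim (simp add: x_0 idx_less)
    qed (intro square_integrable_measurable square_integrable_diff sq_vel0 sqV L2_square_integrable(2)[OF s g'])+
    also have "\<dots> \<le> e"
      using D real_sqrt_sum_squares_ge2[of "L2_norm unif (\<lambda>w. g (X_of (fst \<mu>) w) - ?V w)" "W2 (fst \<mu>) \<rho>0"]
      by (meson less_imp_le order_trans)
    finally show ?thesis .
  qed
  have X: "L2_norm unif (\<lambda>w. pos 0 w - ?X w) \<le> e"
    using W W2_law[of 0 \<rho>0] r0 by (simp add: law0)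
  have K: "L2_norm unif vel0 \<le> K"
  proof -
    have "L2_norm unif vel0 \<le> L2_norm unif (\<lambda>w. vel0 w - ?V w) + L2_norm unif ?V"
      using L2_norm_triangle[OF square_integrable_diff[OF sq_vel0 sqV(2)] sqV(2)] by simp
    also have "L2_norm unif ?V = L2_norm \<rho>0 v0"
      using r0 by (intro square_integrable_comp_X_of(2)) (auto simp: L2_iff)
    finally show ?thesis using V by (simp add: K_def)
  qed
  show "W2 (R t) (R s) \<le> (t - s) * K" if "0 \<le> s" "s \<le> t" for s t
  proof -
    have "W2 (R t) (R s) \<le> (t - s) * L2_norm unif vel0" using law_lipschitz[OF that] that by (simp add: R)
    also have "\<dots> \<le> (t - s) * K" using K that by (intro mult_left_mono) auto
    finally show ?thesis .
  qed
  show "W2 (R t) \<eta> \<le> L2_norm unif (\<lambda>w. ?X w + t * ?V w - X_of \<eta> w) + (1 + t) * e" if "0 \<le> t" "\<eta> \<in> P2" for t \<eta>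
  proof -
    let ?U = "\<lambda>w. pos 0 w + t * vel0 w" and ?U' = "\<lambda>w. ?X w + t * ?V w"
    have sq: "square_integrable unif ?U" "square_integrable unif ?U'" "square_integrable unif (X_of \<eta>)"
      using that by (auto intro!: square_integrable_add square_integrable_cmult sq_pos sq_vel0 sqV square_integrable_X_of)
    have "W2 (R t) \<eta> \<le> L2_norm unif (\<lambda>w. ?U w - X_of \<eta> w)" using law_projection[OF that] that by (simp add: R)
    also have "\<dots> \<le> L2_norm unif (\<lambda>w. ?U w - ?U' w) + L2_norm unif (\<lambda>w. ?U' w - X_of \<eta> w)"
      by (rule L2_norm_triangle_diff[OF sq])
    also have "L2_norm unif (\<lambda>w. ?U w - ?U' w) = L2_norm unif (\<lambda>w. (pos 0 w - ?X w) + t * (vel0 w - ?V w))"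
      by (simp add: algebra_simps)
    also have "\<dots> \<le> L2_norm unif (\<lambda>w. pos 0 w - ?X w) + L2_norm unif (\<lambda>w. t * (vel0 w - ?V w))"
      by (intro L2_norm_triangle square_integrable_cmult square_integrable_diff sq_pos sq_vel0 sqV)
    also have "\<dots> \<le> e + t * e"
      using X V that by (intro add_mono) (auto simp: L2_norm_cmult mult_left_mono)
    finally show ?thesis by (simp add: algebra_simps)
  qed
  show "(W2 (R t) \<eta>)\<^sup>2 / 2 - (W2 (R s) \<eta>)\<^sup>2 / 2
      \<le> (t / s - 1) * ((W2 (R s) \<eta>)\<^sup>2 / 2 + (W2 (R s) (fst \<mu>))\<^sup>2 / 2 - (W2 (fst \<mu>) \<eta>)\<^sup>2 / 2)
        + (t / s - 1)\<^sup>2 * (s * K)\<^sup>2" if "0 < s" "s \<le> t" "\<eta> \<in> P2" for s t \<eta>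
  proof -
    have "(t / s - 1)\<^sup>2 * (s * L2_norm unif vel0)\<^sup>2 \<le> (t / s - 1)\<^sup>2 * (s * K)\<^sup>2"
      using K that by (intro mult_left_mono power_mono mult_nonneg_nonneg L2_norm_nonneg) auto
    then show ?thesis using law_evi[OF that] that unfolding law0 by (simp add: R)
  qed
qed

lemma sticky_law_P2:
  assumes "sticky_semigroup S" "\<mu> \<in> V2" "0 \<le> t"
  shows "fst (S t \<mu>) \<in> P2"
proof -
  have "S t \<mu> \<in> V2" using assms unfolding sticky_semigroup_def by blast
  then show ?thesis by (auto simp: V2_def)
qed

lemma sticky_continuous:
  assumes "sticky_semigroup S" "\<And>n. \<mu>s n \<in> V2" "\<mu> \<in> V2" "(\<lambda>n. D2 (\<mu>s n) \<mu>) \<longlonglongrightarrow> 0" "0 \<le> t"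
  shows "(\<lambda>n. W2 (fst (S t (\<mu>s n))) (fst (S t \<mu>))) \<longlonglongrightarrow> 0"
proof -
  have "range \<mu>s \<subseteq> V2" using assms(2) by blast
  then show ?thesis using assms unfolding sticky_semigroup_def by blast
qed

text \<open>The laws converge in \<open>W2\<close> at every time by the continuity of \<open>S\<close>, and each of the estimates is a
  closed condition.\<close>

lemma sticky_limit:
  assumes S: "sticky_semigroup S" and r0: "\<rho>0 \<in> P2" "v0 \<in> L2 \<rho>0"
  defines "\<rho> \<equiv> \<lambda>t. fst (S t (\<rho>0, momentum \<rho>0 v0))"
  defines "K \<equiv> L2_norm \<rho>0 v0 + 1"
  shows "\<And>t. 0 \<le> t \<Longrightarrow> \<rho> t \<in> P2"
    and "\<And>s t. 0 \<le> s \<Longrightarrow> s \<le> t \<Longrightarrow> W2 (\<rho> t) (\<rho> s) \<le> (t - s) * K"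
    and "\<And>t \<eta>. 0 \<le> t \<Longrightarrow> \<eta> \<in> P2 \<Longrightarrow>
      W2 (\<rho> t) \<eta> \<le> L2_norm unif (\<lambda>w. X_of \<rho>0 w + t * v0 (X_of \<rho>0 w) - X_of \<eta> w)"
    and "\<And>s t \<eta>. 0 < s \<Longrightarrow> s \<le> t \<Longrightarrow> \<eta> \<in> P2 \<Longrightarrow>
      (W2 (\<rho> t) \<eta>)\<^sup>2 / 2 - (W2 (\<rho> s) \<eta>)\<^sup>2 / 2
      \<le> (t / s - 1) * ((W2 (\<rho> s) \<eta>)\<^sup>2 / 2 + (W2 (\<rho> s) \<rho>0)\<^sup>2 / 2 - (W2 \<rho>0 \<eta>)\<^sup>2 / 2)
        + (t / s - 1)\<^sup>2 * (s * K)\<^sup>2"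
proof -
  let ?\<mu>0 = "(\<rho>0, momentum \<rho>0 v0)"
  define e where "e = (\<lambda>n. 1 / (real n + 1))"
  have e: "0 < e n" "e n \<le> 1" for n by (auto simp: e_def)
  have e0: "e \<longlonglongrightarrow> 0"
    using LIMSEQ_inverse_real_of_nat unfolding e_def by (simp add: inverse_eq_divide add.commute)
  define good where "good = (\<lambda>n N m x g. discrete_data N m x \<and> g \<in> L2 (fst (discrete_state N m x (\<lambda>i. g (x i)))) \<and>
    D2 (discrete_state N m x (\<lambda>i. g (x i))) ?\<mu>0 < e n)"
  have "\<exists>N m x g. good n N m x g" for n
    unfolding good_def by (rule discrete_approximation[OF r0 e(1)[of n]]) blast
  then obtain N m x g where good: "\<And>n. good n (N n) (m n) (x n) (g n)" by metis
  define \<mu> where "\<mu> = (\<lambda>n. discrete_state (N n) (m n) (x n) (\<lambda>i. g n (x n i)))"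
  define R where "R = (\<lambda>n t. fst (S t (\<mu> n)))"
  have g1: "discrete_data (N n) (m n) (x n)" and g2: "g n \<in> L2 (fst (discrete_state (N n) (m n) (x n) (\<lambda>i. g n (x n i))))"
    and g3: "D2 (discrete_state (N n) (m n) (x n) (\<lambda>i. g n (x n i))) ?\<mu>0 < e n" for n
    using good[of n] by (auto simp: good_def)
  have \<mu>_fold: "discrete_state (N n) (m n) (x n) (\<lambda>i. g n (x n i)) = \<mu> n" for n by (simp add: \<mu>_def)
  have R_fold: "fst (S t (\<mu> n)) = R n t" for t n by (simp add: R_def)
  note est = sticky_trajectory_estimates[OF S r0 g1 g2 g3, unfolded \<mu>_fold R_fold]
  have mu0: "?\<mu>0 \<in> V2" by (rule momentum_in_V2[OF r0])
  have P: "\<rho> t \<in> P2" "R n t \<in> P2" if "t \<ge> 0" for t n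
    unfolding \<rho>_def R_def using that by (auto intro!: sticky_law_P2[OF S] mu0 est(1))
  then show "\<And>t. 0 \<le> t \<Longrightarrow> \<rho> t \<in> P2" by blast
  have "(\<lambda>n. D2 (\<mu> n) ?\<mu>0) \<longlonglongrightarrow> 0"
  proof (rule Lim_null_comparison[OF _ e0])
    show "eventually (\<lambda>n. norm (D2 (\<mu> n) ?\<mu>0) \<le> e n) sequentially"
    proof (intro always_eventually allI)
      fix n
      have "0 \<le> D2 (\<mu> n) ?\<mu>0"
        unfolding D2_def by (simp add: set_lebesgue_integral_def integral_nonneg_AE)
      then show "norm (D2 (\<mu> n) ?\<mu>0) \<le> e n" using g3[of n] by (simp add: \<mu>_def)
    qed
  qed
  then have conv: "(\<lambda>n. W2 (R n t) (\<rho> t)) \<longlonglongrightarrow> 0" if "t \<ge> 0" for t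
    unfolding R_def \<rho>_def using that by (intro sticky_continuous[OF S est(1) mu0])
  have conv0: "(\<lambda>n. W2 (fst (\<mu> n)) \<rho>0) \<longlonglongrightarrow> 0"
    by (rule Lim_null_comparison[OF _ e0]) (use est(2) W2_nonneg in auto)
  have lim: "(\<lambda>n. W2 (R n t) \<eta>) \<longlonglongrightarrow> W2 (\<rho> t) \<eta>" if "t \<ge> 0" "\<eta> \<in> P2" for t \<eta>
    using P that conv by (intro tendsto_W2[where \<sigma>s = "\<lambda>_. \<eta>"]) (auto simp: W2_self)
  have lim0: "(\<lambda>n. W2 (fst (\<mu> n)) \<eta>) \<longlonglongrightarrow> W2 \<rho>0 \<eta>" if "\<eta> \<in> P2" for \<eta>
    using that conv0 r0 est(3) by (intro tendsto_W2[where \<sigma>s = "\<lambda>_. \<eta>"]) (auto simp: W2_self)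
  have Ke: "L2_norm \<rho>0 v0 + e n \<le> K" "0 \<le> L2_norm \<rho>0 v0 + e n" for n
    using e[of n] L2_norm_nonneg[of \<rho>0 v0] by (auto simp: K_def)
  show "W2 (\<rho> t) (\<rho> s) \<le> (t - s) * K" if st: "0 \<le> s" "s \<le> t" for s t
  proof (rule tendsto_upperbound)
    show "(\<lambda>n. W2 (R n t) (R n s)) \<longlonglongrightarrow> W2 (\<rho> t) (\<rho> s)"
      using P conv st by (intro tendsto_W2) auto
    show "eventually (\<lambda>n. W2 (R n t) (R n s) \<le> (t - s) * K) sequentially"
    proof (intro always_eventually allI)
      fix n
      have "W2 (R n t) (R n s) \<le> (t - s) * (L2_norm \<rho>0 v0 + e n)" by (rule est(4)[OF st])
      also have "\<dots> \<le> (t - s) * K" using st Ke by (intro mult_left_mono) auto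
      finally show "W2 (R n t) (R n s) \<le> (t - s) * K" .
    qed
  qed simp
  show "W2 (\<rho> t) \<eta> \<le> L2_norm unif (\<lambda>w. X_of \<rho>0 w + t * v0 (X_of \<rho>0 w) - X_of \<eta> w)" if t: "0 \<le> t" "\<eta> \<in> P2" for t \<eta>
  proof -
    let ?B = "L2_norm unif (\<lambda>w. X_of \<rho>0 w + t * v0 (X_of \<rho>0 w) - X_of \<eta> w)"
    have "(\<lambda>n. ?B + (1 + t) * e n) \<longlonglongrightarrow> ?B + (1 + t) * 0" by (intro tendsto_intros e0)
    then have "(\<lambda>n. ?B + (1 + t) * e n) \<longlonglongrightarrow> ?B" by simp
    then show ?thesis
      by (rule tendsto_le[OF _ _ lim[OF t], rotated]) (use est(5) t in auto)
  qed
  show "(W2 (\<rho> t) \<eta>)\<^sup>2 / 2 - (W2 (\<rho> s) \<eta>)\<^sup>2 / 2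
      \<le> (t / s - 1) * ((W2 (\<rho> s) \<eta>)\<^sup>2 / 2 + (W2 (\<rho> s) \<rho>0)\<^sup>2 / 2 - (W2 \<rho>0 \<eta>)\<^sup>2 / 2)
        + (t / s - 1)\<^sup>2 * (s * K)\<^sup>2" if st: "0 < s" "s \<le> t" "\<eta> \<in> P2" for s t \<eta>
  proof (rule tendsto_le[OF sequentially_bot])
    have s0: "0 \<le> s" "0 \<le> t" using st by auto
    have limb: "(\<lambda>n. W2 (R n s) (fst (\<mu> n))) \<longlonglongrightarrow> W2 (\<rho> s) \<rho>0"
      using P s0 conv conv0 est(3) r0 by (intro tendsto_W2) auto
    show "(\<lambda>n. (W2 (R n t) \<eta>)\<^sup>2 / 2 - (W2 (R n s) \<eta>)\<^sup>2 / 2) \<longlonglongrightarrow> (W2 (\<rho> t) \<eta>)\<^sup>2 / 2 - (W2 (\<rho> s) \<eta>)\<^sup>2 / 2"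
      by (intro tendsto_intros lim s0 st) auto
    show "(\<lambda>n. (t / s - 1) * ((W2 (R n s) \<eta>)\<^sup>2 / 2 + (W2 (R n s) (fst (\<mu> n)))\<^sup>2 / 2 - (W2 (fst (\<mu> n)) \<eta>)\<^sup>2 / 2)
        + (t / s - 1)\<^sup>2 * (s * K)\<^sup>2) \<longlonglongrightarrow> (t / s - 1) * ((W2 (\<rho> s) \<eta>)\<^sup>2 / 2 + (W2 (\<rho> s) \<rho>0)\<^sup>2 / 2 - (W2 \<rho>0 \<eta>)\<^sup>2 / 2)
        + (t / s - 1)\<^sup>2 * (s * K)\<^sup>2"
      by (intro tendsto_intros lim lim0 limb s0 st) auto
    show "eventually (\<lambda>n. (W2 (R n t) \<eta>)\<^sup>2 / 2 - (W2 (R n s) \<eta>)\<^sup>2 / 2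
      \<le> (t / s - 1) * ((W2 (R n s) \<eta>)\<^sup>2 / 2 + (W2 (R n s) (fst (\<mu> n)))\<^sup>2 / 2 - (W2 (fst (\<mu> n)) \<eta>)\<^sup>2 / 2)
        + (t / s - 1)\<^sup>2 * (s * K)\<^sup>2) sequentially" (is "eventually ?ineq _")
    proof (intro always_eventually allI)
      fix n
      have "(t / s - 1)\<^sup>2 * (s * (L2_norm \<rho>0 v0 + e n))\<^sup>2 \<le> (t / s - 1)\<^sup>2 * (s * K)\<^sup>2"
        using Ke st by (intro mult_left_mono power_mono mult_nonneg_nonneg) auto
      then show "?ineq n"
        using est(6)[OF st, of n] by linarith
    qed
  qed
qed

text \<open>For \<open>t \<le> \<epsilon>0\<close> the map \<open>x + t v0 x\<close> is a convex combination of the identity and \<open>x + \<epsilon>0 v0 x\<close>, hence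
  nondecreasing off a null set. Then \<open>X_of \<rho>0 + t v0 (X_of \<rho>0)\<close> is the quantile function of its own law, and
  \<open>sticky_limit\<close> bounds the distance of the sticky solution from this law by zero.\<close>

lemma sticky_eq_free_transport:
  assumes S: "sticky_semigroup S" and r0: "\<rho>0 \<in> P2" "v0 \<in> L2 \<rho>0"
    and t: "0 < t" "t \<le> \<epsilon>0" and mono: "ess_nondecreasing \<rho>0 (\<lambda>x. x + \<epsilon>0 * v0 x)"
  shows "fst (S t (\<rho>0, momentum \<rho>0 v0)) = distr \<rho>0 borel (\<lambda>x. x + t * v0 x)"
proof -
  let ?f = "\<lambda>x. x + t * v0 x" and ?X = "X_of \<rho>0"
  have [measurable]: "v0 \<in> borel_measurable borel" using r0 by (simp add: L2_iff)
  have fm: "?f \<in> borel_measurable borel" by measurable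
  note d = square_integrable_comp_X_of(3)[OF r0(1) fm]
  have sq: "square_integrable unif (\<lambda>w. ?f (?X w))"
    using r0 by (intro square_integrable_add square_integrable_cmult square_integrable_X_of L2_square_integrable(2))
  have inc: "ae_increasing (\<lambda>w. ?f (?X w))"
  proof -
    obtain A where A: "A \<in> null_sets \<rho>0" "mono_on (- A) (\<lambda>x. x + \<epsilon>0 * v0 x)"
      using mono by (auto simp: ess_nondecreasing_def)
    have "AE x in \<rho>0. x \<notin> A" by (rule AE_not_in[OF A(1)])
    then have "AE w in unif. ?X w \<notin> A" by (rule AE_X_of[OF r0(1)])
    then obtain B where B: "B \<in> null_sets unif" "{w \<in> space unif. \<not> ?X w \<notin> A} \<subseteq> B"
      unfolding eventually_ae_filter by blast
    have XB: "?X w \<notin> A" if "w \<in> {0<..<1} - B" for w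
      using B(2) that by (auto simp: space_unif subset_iff)
    have "mono_on ({0<..<1} - B) (\<lambda>w. ?f (?X w))"
    proof (rule mono_onI)
      fix a b assume ab: "a \<in> {0<..<1} - B" "b \<in> {0<..<1} - B" "a \<le> b"
      have XA: "?X a \<notin> A" "?X b \<notin> A" using ab XB by blast+
      have Xm: "?X a \<le> ?X b" using ab mono_onD[OF X_of_mono[OF P2D(5)[OF r0(1)]], of a b] by auto
      then have m: "?X a + \<epsilon>0 * v0 (?X a) \<le> ?X b + \<epsilon>0 * v0 (?X b)" using mono_onD[OF A(2), of "?X a" "?X b"] XA by auto
      have convex: "\<epsilon>0 * ?f y = (\<epsilon>0 - t) * y + t * (y + \<epsilon>0 * v0 y)" for y by (simp add: algebra_simps)
      have "(\<epsilon>0 - t) * ?X a + t * (?X a + \<epsilon>0 * v0 (?X a)) \<le> (\<epsilon>0 - t) * ?X b + t * (?X b + \<epsilon>0 * v0 (?X b))"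
        using t by (intro add_mono[OF mult_left_mono[OF Xm] mult_left_mono[OF m]]) auto
      then have "\<epsilon>0 * ?f (?X a) \<le> \<epsilon>0 * ?f (?X b)" unfolding convex .
      then show "?f (?X a) \<le> ?f (?X b)" using t by (simp add: mult_le_cancel_left_pos)
    qed
    then show ?thesis using square_integrable_measurable[OF sq] B(1) by (auto simp: ae_increasing_def)
  qed
  let ?\<eta> = "distr \<rho>0 borel ?f"
  have eta: "?\<eta> \<in> P2" unfolding d[symmetric] by (rule distr_in_P2[OF prob_space_unif sq])
  have "AE w in unif. X_of ?\<eta> w = ?f (?X w)" using X_of_unique[OF inc sq] unfolding d .
  then have "L2_norm unif (\<lambda>w. ?f (?X w) - X_of ?\<eta> w) = L2_norm unif (\<lambda>_. 0)"
    by (intro L2_norm_cong_AE square_integrable_measurable[OF square_integrable_diff] sq square_integrable_X_of eta) auto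
  also have "\<dots> = 0" by (simp add: L2_norm_def)
  finally have "W2 (fst (S t (\<rho>0, momentum \<rho>0 v0))) ?\<eta> \<le> 0"
    using sticky_limit(3)[OF S r0, of t ?\<eta>] t eta by simp
  then show ?thesis
    using W2_nonneg[of "fst (S t (\<rho>0, momentum \<rho>0 v0))" ?\<eta>] sticky_limit(1)[OF S r0, of t] t eta
    by (intro W2_eq_0) auto
qed


section \<open>Uniqueness of the gradient flow\<close>

lemma half_square_W2_diff_le:
  assumes "\<rho> \<in> P2" "\<rho>' \<in> P2" "\<eta> \<in> P2" "W2 \<rho> \<eta> \<le> B" "W2 \<rho>' \<eta> \<le> B"
  shows "\<bar>(W2 \<rho> \<eta>)\<^sup>2 / 2 - (W2 \<rho>' \<eta>)\<^sup>2 / 2\<bar> \<le> B * W2 \<rho> \<rho>'"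
proof -
  have "\<bar>(W2 \<rho> \<eta>)\<^sup>2 / 2 - (W2 \<rho>' \<eta>)\<^sup>2 / 2\<bar> = ((W2 \<rho> \<eta> + W2 \<rho>' \<eta>) / 2) * \<bar>W2 \<rho> \<eta> - W2 \<rho>' \<eta>\<bar>"
  proof -
    have "(W2 \<rho> \<eta>)\<^sup>2 / 2 - (W2 \<rho>' \<eta>)\<^sup>2 / 2 = ((W2 \<rho> \<eta> + W2 \<rho>' \<eta>) / 2) * (W2 \<rho> \<eta> - W2 \<rho>' \<eta>)"
      by (simp add: power2_eq_square algebra_simps)
    then show ?thesis by (simp only: abs_mult) (simp add: W2_nonneg)
  qed
  also have "\<dots> \<le> B * W2 \<rho> \<rho>'"
    using assms W2_nonneg[of \<rho> \<eta>] by (intro mult_mono W2_diff_le) auto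
  finally show ?thesis .
qed

text \<open>The variational inequality integrated over a short time. The bracket on the right is evaluated at
  the initial time; its variation costs the quadratic error.\<close>

lemma EVI_increment_le:
  assumes evi: "EVI \<sigma> r" and s: "\<sigma> \<in> P2" and eta: "\<eta> \<in> P2"
    and r: "\<And>t. 0 \<le> t \<Longrightarrow> r t \<in> P2"
    and lip: "\<And>s t. s \<in> {0..T} \<Longrightarrow> t \<in> {0..T} \<Longrightarrow> W2 (r s) (r t) \<le> L * \<bar>s - t\<bar>"
    and B: "\<And>t. t \<in> {0..T} \<Longrightarrow> W2 (r t) \<eta> \<le> B" "\<And>t. t \<in> {0..T} \<Longrightarrow> W2 (r t) \<sigma> \<le> B"
    and tau: "0 \<le> \<tau>" "0 \<le> h" "\<tau> + h \<le> T" and "0 \<le> L"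
  shows "(W2 (r (\<tau> + h)) \<eta>)\<^sup>2 / 2 - (W2 (r \<tau>) \<eta>)\<^sup>2 / 2
    \<le> h * ((W2 (r \<tau>) \<eta>)\<^sup>2 / 2 + phi \<sigma> \<eta> - phi \<sigma> (r \<tau>)) + 2 * B * L * h\<^sup>2"
proof -
  let ?f = "\<lambda>t. (W2 (r t) \<eta>)\<^sup>2 / 2" and ?g = "\<lambda>t. (W2 (r t) \<sigma>)\<^sup>2 / 2"
  have B0: "0 \<le> B" using B(1)[of \<tau>] W2_nonneg[of "r \<tau>" \<eta>] tau by simp
  have lipf: "\<bar>?f a - ?f b\<bar> \<le> B * L * \<bar>a - b\<bar>" "\<bar>?g a - ?g b\<bar> \<le> B * L * \<bar>a - b\<bar>"
    if "a \<in> {0..T}" "b \<in> {0..T}" for a b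
  proof -
    have le: "B * W2 (r a) (r b) \<le> B * L * \<bar>a - b\<bar>"
      using mult_left_mono[OF lip[OF that] B0] by (simp add: mult.assoc)
    have "\<bar>?f a - ?f b\<bar> \<le> B * W2 (r a) (r b)" "\<bar>?g a - ?g b\<bar> \<le> B * W2 (r a) (r b)"
      using that B by (auto intro!: half_square_W2_diff_le r eta s)
    with le show "\<bar>?f a - ?f b\<bar> \<le> B * L * \<bar>a - b\<bar>" "\<bar>?g a - ?g b\<bar> \<le> B * L * \<bar>a - b\<bar>" by linarith+
  qed
  let ?c = "?f \<tau> + phi \<sigma> \<eta> - phi \<sigma> (r \<tau>) + 2 * B * L * h"
  have "?f (\<tau> + h) - ?f \<tau> \<le> ?c * (\<tau> + h - \<tau>)"
  proof (rule increment_le_if_AE_derivative_le[where L = "B * L" and f = ?f])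
    show "\<tau> \<le> \<tau> + h" using tau by simp
    show "\<bar>?f a - ?f b\<bar> \<le> B * L * \<bar>a - b\<bar>" if "a \<in> {\<tau>..\<tau> + h}" "b \<in> {\<tau>..\<tau> + h}" for a b
      using that tau by (intro lipf) auto
    have "AE t in lborel. t > 0 \<longrightarrow> (\<exists>D. ((\<lambda>s. (W2 (r s) \<eta>)\<^sup>2) has_real_derivative D) (at t) \<and>
           1 / 2 * D - 1 / 2 * (W2 (r t) \<eta>)\<^sup>2 \<le> phi \<sigma> \<eta> - phi \<sigma> (r t))"
      using evi eta by (auto simp: EVI_def)
    then show "AE t in lborel. \<tau> < t \<and> t < \<tau> + h \<longrightarrow> (\<exists>D. (?f has_real_derivative D) (at t) \<and> D \<le> ?c)"
    proof (rule AE_mp, intro AE_I2 impI)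
      fix t assume ev: "t > 0 \<longrightarrow> (\<exists>D. ((\<lambda>s. (W2 (r s) \<eta>)\<^sup>2) has_real_derivative D) (at t) \<and>
           1 / 2 * D - 1 / 2 * (W2 (r t) \<eta>)\<^sup>2 \<le> phi \<sigma> \<eta> - phi \<sigma> (r t))" and t: "\<tau> < t \<and> t < \<tau> + h"
      then obtain D where D: "((\<lambda>s. (W2 (r s) \<eta>)\<^sup>2) has_real_derivative D) (at t)"
        "D / 2 - ?f t \<le> phi \<sigma> \<eta> - phi \<sigma> (r t)" using tau by auto
      have "(?f has_real_derivative D / 2) (at t)" using D(1) by (rule DERIV_cdivide)
      moreover have "D / 2 \<le> ?c"
      proof -
        have "t \<in> {0..T}" "\<tau> \<in> {0..T}" using t tau by auto
        note lipf[OF this]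
        moreover have "B * L * \<bar>t - \<tau>\<bar> \<le> B * L * h" using t B0 \<open>0 \<le> L\<close> by (intro mult_left_mono) auto
        ultimately show ?thesis using D(2) unfolding phi_def by (simp add: abs_le_iff)
      qed
      ultimately show "\<exists>D. (?f has_real_derivative D) (at t) \<and> D \<le> ?c" by blast
    qed
  qed
  then show ?thesis by (simp add: power2_eq_square algebra_simps)
qed

text \<open>With \<open>n\<close> steps of length \<open>T / n\<close> the quadratic errors sum up to \<open>O(1/n)\<close>.\<close>

lemma quadratic_gronwall:
  fixes F :: "real \<Rightarrow> real"
  assumes "0 \<le> T" "F 0 = 0" "0 \<le> F T" "0 \<le> C"
    and step: "\<And>\<tau> h. 0 \<le> \<tau> \<Longrightarrow> 0 \<le> h \<Longrightarrow> h \<le> 1 \<Longrightarrow> \<tau> + h \<le> T \<Longrightarrow> F (\<tau> + h) \<le> (1 + 2 * h) * F \<tau> + C * h\<^sup>2"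
  shows "F T = 0"
proof -
  have bound: "F T \<le> (C * T\<^sup>2 * exp (2 * T)) / real n" if n: "0 < n" "T \<le> real n" for n :: nat
  proof -
    define h where "h = T / real n"
    have h: "0 \<le> h" "h \<le> 1" "real n * h = T" using n \<open>0 \<le> T\<close> by (auto simp: h_def)
    have "F (real k * h) \<le> real k * (C * h\<^sup>2) * (1 + 2 * h) ^ k" if "k \<le> n" for k
      using that
    proof (induction k)
      case (Suc k)
      have "real k * h + h \<le> T"
        using Suc.prems h mult_right_mono[of "real (Suc k)" "real n" h] by (simp add: algebra_simps)
      then have "F (real k * h + h) \<le> (1 + 2 * h) * F (real k * h) + C * h\<^sup>2"
        using h by (intro step) auto
      also have "\<dots> \<le> (1 + 2 * h) * (real k * (C * h\<^sup>2) * (1 + 2 * h) ^ k) + C * h\<^sup>2 * (1 + 2 * h) ^ Suc k"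
      proof (intro add_mono mult_left_mono)
        have "1 \<le> (1 + 2 * h) ^ Suc k" using h by (intro one_le_power) auto
        then have "C * h\<^sup>2 * 1 \<le> C * h\<^sup>2 * (1 + 2 * h) ^ Suc k" using \<open>0 \<le> C\<close> by (intro mult_left_mono) auto
        then show "C * h\<^sup>2 \<le> C * h\<^sup>2 * (1 + 2 * h) ^ Suc k" by simp
      qed (use Suc h in auto)
      also have "\<dots> = real (Suc k) * (C * h\<^sup>2) * (1 + 2 * h) ^ Suc k" by (simp add: algebra_simps)
      finally show ?case by (simp add: algebra_simps)
    qed (simp add: \<open>F 0 = 0\<close>)
    from this[of n] have "F T \<le> real n * (C * h\<^sup>2) * (1 + 2 * h) ^ n" by (simp add: h)
    also have "\<dots> \<le> real n * (C * h\<^sup>2) * exp (2 * T)"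
    proof (rule mult_left_mono)
      have "(1 + 2 * h) ^ n \<le> exp (2 * h) ^ n" using h by (intro power_mono exp_ge_add_one_self) auto
      also have "\<dots> = exp (2 * T)" using h(3) by (simp add: exp_of_nat_mult[symmetric] algebra_simps)
      finally show "(1 + 2 * h) ^ n \<le> exp (2 * T)" .
    qed (use \<open>0 \<le> C\<close> in auto)
    also have "\<dots> = (C * T\<^sup>2 * exp (2 * T)) / real n" using n by (simp add: h_def power2_eq_square)
    finally show ?thesis .
  qed
  obtain n0 :: nat where n0: "T \<le> real n0" using real_arch_simple by blast
  have "F T \<le> 0"
  proof (rule tendsto_lowerbound)
    show "(\<lambda>n. (C * T\<^sup>2 * exp (2 * T)) / real n) \<longlonglongrightarrow> 0" by (rule lim_const_over_n)
    show "eventually (\<lambda>n. F T \<le> (C * T\<^sup>2 * exp (2 * T)) / real n) sequentially"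
      using eventually_ge_at_top[of "max 1 n0"] by eventually_elim (use n0 in \<open>auto intro!: bound\<close>)
  qed simp
  with \<open>0 \<le> F T\<close> show ?thesis by simp
qed

text \<open>Doubling of variables. From \<open>(r \<tau>, q \<tau>)\<close> to \<open>(r (\<tau> + h), q (\<tau> + h))\<close> one first moves \<open>q\<close>, with the
  inequality for \<open>q\<close> tested against \<open>r \<tau>\<close>, and then \<open>r\<close>, with its inequality tested against
  \<open>q (\<tau> + h)\<close>. The contributions of \<open>phi\<close> cancel up to \<open>O(h\<^sup>2)\<close>, which leaves a Gronwall inequality for
  the squared distance.\<close>

lemma EVI_uniqueness:
  assumes evi: "EVI \<sigma> r" and s: "\<sigma> \<in> P2"
    and r: "\<And>t. 0 \<le> t \<Longrightarrow> r t \<in> P2" and q: "\<And>t. 0 \<le> t \<Longrightarrow> q t \<in> P2" and init: "r 0 = q 0"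
    and T: "0 \<le> T" and L: "0 \<le> L" and C: "0 \<le> C"
    and lipr: "\<And>s t. s \<in> {0..T} \<Longrightarrow> t \<in> {0..T} \<Longrightarrow> W2 (r s) (r t) \<le> L * \<bar>s - t\<bar>"
    and lipq: "\<And>s t. s \<in> {0..T} \<Longrightarrow> t \<in> {0..T} \<Longrightarrow> W2 (q s) (q t) \<le> L * \<bar>s - t\<bar>"
    and eviq: "\<And>\<tau> h \<eta>. 0 \<le> \<tau> \<Longrightarrow> 0 \<le> h \<Longrightarrow> h \<le> 1 \<Longrightarrow> \<tau> + h \<le> T \<Longrightarrow> \<eta> \<in> P2 \<Longrightarrow>
      (W2 (q (\<tau> + h)) \<eta>)\<^sup>2 / 2 - (W2 (q \<tau>) \<eta>)\<^sup>2 / 2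
      \<le> (exp h - 1) * ((W2 (q \<tau>) \<eta>)\<^sup>2 / 2 + phi \<sigma> \<eta> - phi \<sigma> (q \<tau>)) + C * h\<^sup>2"
  shows "r T = q T"
proof -
  define B where "B = 2 * L * T + W2 (r 0) \<sigma>"
  have LT: "L * \<bar>a - b\<bar> \<le> L * T" if "a \<in> {0..T}" "b \<in> {0..T}" for a b
    using that L by (intro mult_left_mono) auto
  have r0: "W2 (r a) (r 0) \<le> L * T" and q0: "W2 (q a) (q 0) \<le> L * T" if "a \<in> {0..T}" for a
    using lipr[of a 0] lipq[of a 0] LT[of a 0] that T by auto
  have B0: "0 \<le> B" using L T W2_nonneg[of "r 0" \<sigma>] by (simp add: B_def)
  have rq: "W2 (r a) (q b) \<le> B" if "a \<in> {0..T}" "b \<in> {0..T}" for a b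
  proof -
    have "W2 (r a) (q b) \<le> W2 (r a) (r 0) + W2 (q 0) (q b)"
      using W2_triangle[of "r a" "r 0" "q b"] that r q init by auto
    then show ?thesis using r0[OF that(1)] q0[OF that(2)] that q W2_commute[of "q b" "q 0"] W2_nonneg[of "r 0" \<sigma>]
      by (simp add: B_def)
  qed
  have rs: "W2 (r a) \<sigma> \<le> B" if "a \<in> {0..T}" for a
    using W2_triangle[OF r r s, of a 0] r0[OF that] that mult_nonneg_nonneg[OF L T] by (simp add: B_def)
  have qs: "W2 (q a) \<sigma> \<le> B" if "a \<in> {0..T}" for a
    using W2_triangle[OF q q s, of a 0] q0[OF that] that mult_nonneg_nonneg[OF L T] by (simp add: B_def init)
  define F where "F = (\<lambda>t. (W2 (r t) (q t))\<^sup>2 / 2)"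
  define C' where "C' = C + 4 * B * L + 2 * B\<^sup>2"
  have C'0: "0 \<le> C'" using C B0 L by (simp add: C'_def)
  have "F T = 0"
  proof (rule quadratic_gronwall[OF T _ _ C'0])
    show "F 0 = 0" using init q[of 0] by (simp add: F_def W2_self)
    show "0 \<le> F T" by (simp add: F_def)
    fix \<tau> h :: real assume h: "0 \<le> \<tau>" "0 \<le> h" "h \<le> 1" "\<tau> + h \<le> T"
    let ?r = "r \<tau>" and ?q = "q \<tau>" and ?r' = "r (\<tau> + h)" and ?q' = "q (\<tau> + h)"
    have P: "?r \<in> P2" "?q \<in> P2" "?r' \<in> P2" "?q' \<in> P2" using h r q by auto
    define m where "m = (W2 ?r ?q')\<^sup>2 / 2"
    define p where "p = phi \<sigma> ?r" define p0 where "p0 = phi \<sigma> ?q" define p1 where "p1 = phi \<sigma> ?q'"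
    have 1: "F (\<tau> + h) - m \<le> h * (m + p1 - p) + 2 * B * L * h\<^sup>2"
      unfolding F_def m_def p1_def p_def using h L P(4)
      by (intro EVI_increment_le[where T = T]) (auto intro!: evi s r lipr rq rs)
    have 2: "m - F \<tau> \<le> (exp h - 1) * (F \<tau> + p - p0) + C * h\<^sup>2"
      using eviq[OF h P(1)] P unfolding F_def m_def p_def p0_def by (simp add: W2_commute[of _ ?r])
    have q: "W2 ?q' ?q \<le> L * h" using lipq[of "\<tau> + h" \<tau>] h by simp
    have close: "B * W2 ?q' ?q \<le> B * (L * h)" using q B0 by (intro mult_left_mono) auto
    have "\<bar>(W2 ?q' ?r)\<^sup>2 / 2 - (W2 ?q ?r)\<^sup>2 / 2\<bar> \<le> B * W2 ?q' ?q"
      using rq[of \<tau> \<tau>] rq[of \<tau> "\<tau> + h"] h P by (intro half_square_W2_diff_le) (auto simp: W2_commute[of _ ?r])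
    then have 3: "m - F \<tau> \<le> B * (L * h)"
      using close P unfolding m_def F_def by (simp add: W2_commute[of _ ?r] abs_le_iff)
    have "\<bar>(W2 ?q' \<sigma>)\<^sup>2 / 2 - (W2 ?q \<sigma>)\<^sup>2 / 2\<bar> \<le> B * W2 ?q' ?q"
      using qs[of \<tau>] qs[of "\<tau> + h"] h P s by (intro half_square_W2_diff_le) auto
    then have 4: "p1 - p0 \<le> B * (L * h)"
      using close unfolding p1_def p0_def phi_def by (simp add: abs_le_iff)
    have 5: "(exp h - 1) * (F \<tau> + p - p0) \<le> h * (F \<tau> + p - p0) + h\<^sup>2 * (2 * B\<^sup>2)"
    proof -
      have a: "0 \<le> exp h - 1 - h" "exp h - 1 - h \<le> h\<^sup>2"
        using exp_ge_add_one_self[of h] exp_bound[OF h(2,3)] by linarith+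
      have "(W2 ?r ?q)\<^sup>2 \<le> B\<^sup>2" "(W2 ?q \<sigma>)\<^sup>2 \<le> B\<^sup>2"
        using rq[of \<tau> \<tau>] qs[of \<tau>] h by (auto intro!: power_mono W2_nonneg)
      then have "F \<tau> \<le> B\<^sup>2 / 2" "- p0 \<le> B\<^sup>2 / 2" "p \<le> 0" by (auto simp: F_def p0_def p_def phi_def)
      moreover have "0 \<le> B\<^sup>2" by simp
      ultimately have b: "F \<tau> + p - p0 \<le> 2 * B\<^sup>2" by linarith
      have "(exp h - 1 - h) * (F \<tau> + p - p0) \<le> (exp h - 1 - h) * (2 * B\<^sup>2)" using a b by (intro mult_left_mono) auto
      also have "\<dots> \<le> h\<^sup>2 * (2 * B\<^sup>2)" using a by (intro mult_right_mono) auto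
      finally show ?thesis by (simp add: algebra_simps)
    qed
    have 6: "h * (m + p1 - p) \<le> h * (F \<tau> + p0 - p + 2 * (B * (L * h)))"
      using 3 4 h by (intro mult_left_mono) auto
    have "F (\<tau> + h) \<le> F \<tau> + h * (F \<tau> + p0 - p + 2 * (B * (L * h))) + 2 * B * L * h\<^sup>2
        + (h * (F \<tau> + p - p0) + h\<^sup>2 * (2 * B\<^sup>2)) + C * h\<^sup>2"
      using 1 2 5 6 by linarith
    also have "\<dots> = (1 + 2 * h) * F \<tau> + C' * h\<^sup>2" by (simp add: C'_def power2_eq_square algebra_simps)
    finally show "F (\<tau> + h) \<le> (1 + 2 * h) * F \<tau> + C' * h\<^sup>2" .
  qed
  then have "W2 (r T) (q T) = 0" by (simp add: F_def)
  then show ?thesis using r q T by (intro W2_eq_0) auto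
qed

text \<open>In the time \<open>\<tau>\<close> with \<open>t = \<epsilon> exp \<tau>\<close>, increments \<open>t / s - 1\<close> become \<open>exp h - 1\<close>, and \<open>sticky_limit\<close>
  provides the hypotheses of \<open>EVI_uniqueness\<close>.\<close>

lemma sticky_eq_gradient_flow:
  assumes S: "sticky_semigroup S" and G: "gradient_flow_semigroup \<rho>0 G"
    and r0: "\<rho>0 \<in> P2" "v0 \<in> L2 \<rho>0" and eps: "0 < \<epsilon>" "\<epsilon> \<le> t"
  defines "\<rho> \<equiv> \<lambda>t. fst (S t (\<rho>0, momentum \<rho>0 v0))"
  shows "\<rho> t = G (ln (t / \<epsilon>)) (\<rho> \<epsilon>)"
proof -
  define T where "T = ln (t / \<epsilon>)"
  have T: "0 \<le> T" "\<epsilon> * exp T = t" using eps by (auto simp: T_def)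
  have "fst (S t (\<rho>0, momentum \<rho>0 v0)) = \<rho> t" for t by (simp add: \<rho>_def)
  note lim = sticky_limit[OF S r0, unfolded this]
  \<comment> \<open>the Lipschitz constant from \<open>sticky_limit\<close>\<close>
  define K where "K = L2_norm \<rho>0 v0 + 1"
  have K0: "0 \<le> K" using L2_norm_nonneg[of \<rho>0 v0] by (simp add: K_def)
  have P: "\<rho> \<epsilon> \<in> P2" using lim(1) eps by simp
  define r q where "r = (\<lambda>\<tau>. G \<tau> (\<rho> \<epsilon>))" and "q = (\<lambda>\<tau>. \<rho> (\<epsilon> * exp \<tau>))"
  note rq = r_def q_def
  obtain L0 where L0: "\<forall>s\<in>{0..T}. \<forall>\<tau>\<in>{0..T}. W2 (r s) (r \<tau>) \<le> L0 * \<bar>s - \<tau>\<bar>"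
    using G P unfolding gradient_flow_semigroup_def r_def by blast
  define L where "L = \<bar>L0\<bar> + K * t"
  have L: "0 \<le> L" using K0 eps by (simp add: L_def)
  have lipq: "W2 (q b) (q a) \<le> K * t * (b - a)" if ab: "0 \<le> a" "a \<le> b" "b \<le> T" for a b
  proof -
    have "W2 (q b) (q a) \<le> (\<epsilon> * exp b - \<epsilon> * exp a) * K"
      unfolding q_def K_def using eps ab by (intro lim(2)) auto
    also have "\<epsilon> * exp b - \<epsilon> * exp a = \<epsilon> * exp b * (1 - exp (a - b))" by (simp add: right_diff_distrib exp_diff)
    also have "\<dots> \<le> t * (b - a)"
    proof (rule mult_mono)
      show "\<epsilon> * exp b \<le> t" unfolding T(2)[symmetric] using eps ab by simp
      show "1 - exp (a - b) \<le> b - a" using exp_ge_add_one_self[of "a - b"] by linarith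
    qed (use eps ab in auto)
    finally show ?thesis using K0 by (simp add: mult.commute mult.left_commute mult_right_mono)
  qed
  have "r T = q T"
  proof (rule EVI_uniqueness)
    show "EVI \<rho>0 r" using G P unfolding gradient_flow_semigroup_def r_def by blast
    show "\<rho>0 \<in> P2" by fact
    show "r \<tau> \<in> P2" if "0 \<le> \<tau>" for \<tau> using G P that unfolding gradient_flow_semigroup_def r_def by blast
    show q: "q \<tau> \<in> P2" if "0 \<le> \<tau>" for \<tau> unfolding q_def using eps by (intro lim(1)) simp
    show "r 0 = q 0" using G P unfolding gradient_flow_semigroup_def rq by simp
    show "0 \<le> T" "0 \<le> L" by fact+
    show "0 \<le> 4 * (t * K)\<^sup>2" by simp
    show "W2 (r a) (r b) \<le> L * \<bar>a - b\<bar>" if "a \<in> {0..T}" "b \<in> {0..T}" for a b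
    proof -
      have "W2 (r a) (r b) \<le> L0 * \<bar>a - b\<bar>" using L0 that by blast
      also have "\<dots> \<le> L * \<bar>a - b\<bar>" using K0 eps by (intro mult_right_mono) (auto simp: L_def intro: add_increasing2)
      finally show ?thesis .
    qed
    show "W2 (q a) (q b) \<le> L * \<bar>a - b\<bar>" if ab: "a \<in> {0..T}" "b \<in> {0..T}" for a b
    proof -
      have "W2 (q a) (q b) \<le> K * t * \<bar>a - b\<bar>"
      proof (cases "a \<le> b")
        case True
        then show ?thesis using lipq[of a b] ab W2_commute[OF q q, of a b] by simp
      next
        case False
        then show ?thesis using lipq[of b a] ab by simp
      qed
      also have "\<dots> \<le> L * \<bar>a - b\<bar>" by (intro mult_right_mono) (auto simp: L_def)
      finally show ?thesis .
    qed
    fix \<tau> h \<eta> assume h: "0 \<le> \<tau>" "0 \<le> h" "h \<le> 1" "\<tau> + h \<le> T" and eta: "\<eta> \<in> P2"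
    let ?s = "\<epsilon> * exp \<tau>"
    have quot: "\<epsilon> * exp (\<tau> + h) / ?s = exp h" using eps by (simp add: exp_add)
    have "(W2 (q (\<tau> + h)) \<eta>)\<^sup>2 / 2 - (W2 (q \<tau>) \<eta>)\<^sup>2 / 2
      \<le> (exp h - 1) * ((W2 (q \<tau>) \<eta>)\<^sup>2 / 2 + (W2 (q \<tau>) \<rho>0)\<^sup>2 / 2 - (W2 \<rho>0 \<eta>)\<^sup>2 / 2) + (exp h - 1)\<^sup>2 * (?s * K)\<^sup>2"
      using lim(4)[of ?s "\<epsilon> * exp (\<tau> + h)" \<eta>] eps h eta unfolding quot q_def K_def by simp
    \<comment> \<open>as \<open>exp h - 1 \<le> 2 h\<close> for \<open>h \<le> 1\<close>\<close>
    also have "(exp h - 1)\<^sup>2 * (?s * K)\<^sup>2 \<le> (2 * h)\<^sup>2 * (t * K)\<^sup>2"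
    proof (intro mult_mono power_mono)
      have "h\<^sup>2 \<le> h" using h by (simp add: power2_eq_square mult_left_le)
      then show "exp h - 1 \<le> 2 * h" using exp_bound[of h] h by simp
      show "?s \<le> t" unfolding T(2)[symmetric] using eps h by simp
    qed (use h eps K0 in auto)
    also have "(2 * h)\<^sup>2 * (t * K)\<^sup>2 = 4 * (t * K)\<^sup>2 * h\<^sup>2" by (simp add: power_mult_distrib)
    also have "(W2 (q \<tau>) \<eta>)\<^sup>2 / 2 + (W2 (q \<tau>) \<rho>0)\<^sup>2 / 2 - (W2 \<rho>0 \<eta>)\<^sup>2 / 2
      = (W2 (q \<tau>) \<eta>)\<^sup>2 / 2 + phi \<rho>0 \<eta> - phi \<rho>0 (q \<tau>)"
      by (simp add: phi_def W2_commute[OF eta r0(1)])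
    finally show "(W2 (q (\<tau> + h)) \<eta>)\<^sup>2 / 2 - (W2 (q \<tau>) \<eta>)\<^sup>2 / 2
      \<le> (exp h - 1) * ((W2 (q \<tau>) \<eta>)\<^sup>2 / 2 + phi \<rho>0 \<eta> - phi \<rho>0 (q \<tau>)) + 4 * (t * K)\<^sup>2 * h\<^sup>2" by simp
  qed
  then show ?thesis unfolding rq T(2) T_def[symmetric] by simp
qed


section \<open>Sticky particles as a limit of gradient flows\<close>

lemma displacement_P2:
  assumes "\<rho>0 \<in> P2" "v \<in> L2 \<rho>0"
  shows "square_integrable \<rho>0 (\<lambda>x. x + \<epsilon> * v x)"
    and "distr \<rho>0 borel (\<lambda>x. x + \<epsilon> * v x) \<in> P2"
proof -
  have id: "square_integrable \<rho>0 (\<lambda>x. x)" using P2D[OF assms(1)] by (simp add: square_integrable_def)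
  show sq: "square_integrable \<rho>0 (\<lambda>x. x + \<epsilon> * v x)"
    by (rule square_integrable_add[OF id square_integrable_cmult[OF L2_square_integrable(1)[OF assms]]])
  show "distr \<rho>0 borel (\<lambda>x. x + \<epsilon> * v x) \<in> P2"
    by (rule distr_in_P2[OF P2D(1)[OF assms(1)] sq])
qed

text \<open>If \<open>\<epsilon> L \<le> 1\<close>, the slope of \<open>\<epsilon> v\<close> is at least \<open>-1\<close>.\<close>

lemma ess_nondecreasing_lipschitz:
  assumes "L-lipschitz_on UNIV v" and "0 \<le> \<epsilon>" "\<epsilon> * L \<le> 1"
  shows "ess_nondecreasing \<rho> (\<lambda>x::real. x + \<epsilon> * v x)"
proof -
  have "x + \<epsilon> * v x \<le> y + \<epsilon> * v y" if "x \<le> y" for x y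
  proof -
    have "\<bar>v x - v y\<bar> \<le> L * (y - x)" using lipschitz_onD[OF assms(1), of x y] that by (simp add: dist_real_def)
    then have "\<epsilon> * (v x - v y) \<le> \<epsilon> * (L * (y - x))" using assms(2) by (intro mult_left_mono) auto
    also have "\<dots> = (\<epsilon> * L) * (y - x)" by simp
    also have "\<dots> \<le> 1 * (y - x)" using assms(3) that by (intro mult_right_mono) auto
    finally show ?thesis by (simp add: algebra_simps)
  qed
  then have "mono_on (- {}) (\<lambda>x. x + \<epsilon> * v x)" by (intro mono_onI) auto
  then show ?thesis unfolding ess_nondecreasing_def by (intro bexI[of _ "{}"]) auto
qed

theorem theorem2p5:
  fixes \<rho>0 :: "real measure" and v0 :: "real \<Rightarrow> real"
    and G :: "real \<Rightarrow> real measure \<Rightarrow> real measure"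
    and S :: "real \<Rightarrow> state \<Rightarrow> state"
    and \<rho> \<rho>' :: "real \<Rightarrow> real measure"
  assumes "\<rho>0 \<in> P2" and "v0 \<in> L2 \<rho>0"
    and "gradient_flow_semigroup \<rho>0 G"
    and "sticky_semigroup S"
    and "\<And>t. t \<ge> 0 \<Longrightarrow> \<rho> t = fst (S t (\<rho>0, momentum \<rho>0 v0))"
    and "\<And>\<epsilon>. \<epsilon> > 0 \<Longrightarrow> \<rho>' \<epsilon> = distr \<rho>0 borel (\<lambda>x. x + \<epsilon> * v0 x)"
  shows "(\<forall>t>0. ((\<lambda>\<epsilon>. W2 (G (ln (t / \<epsilon>)) (\<rho>' \<epsilon>)) (\<rho> t)) \<longlongrightarrow> 0) (at_right 0)) \<and>
    (\<forall>\<epsilon>0>0. ess_nondecreasing \<rho>0 (\<lambda>x. x + \<epsilon>0 * v0 x) \<longrightarrow>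
      (\<forall>\<epsilon>\<in>{0<..\<epsilon>0}. \<rho> \<epsilon> = \<rho>' \<epsilon> \<and> (\<forall>t\<ge>\<epsilon>. \<rho> t = G (ln (t / \<epsilon>)) (\<rho>' \<epsilon>))))"
proof (intro conjI allI impI ballI)
  note r0 = assms(1,2) and G = assms(3) and S = assms(4) and \<rho> = assms(5) and \<rho>' = assms(6)
  {
    fix \<epsilon>0 \<epsilon> :: real
    assume "\<epsilon>0 > 0" "ess_nondecreasing \<rho>0 (\<lambda>x. x + \<epsilon>0 * v0 x)" "\<epsilon> \<in> {0<..\<epsilon>0}"
    then show *: "\<rho> \<epsilon> = \<rho>' \<epsilon>"
      using sticky_eq_free_transport[OF S r0, of \<epsilon> \<epsilon>0] \<rho> \<rho>' by simp
    fix t assume "\<epsilon> \<le> t"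
    then show "\<rho> t = G (ln (t / \<epsilon>)) (\<rho>' \<epsilon>)"
      using sticky_eq_gradient_flow[OF S G r0, of \<epsilon> t] \<open>\<epsilon> \<in> {0<..\<epsilon>0}\<close> \<rho> *[symmetric] by simp
  }
  fix t :: real assume t: "0 < t"
  show "((\<lambda>\<epsilon>. W2 (G (ln (t / \<epsilon>)) (\<rho>' \<epsilon>)) (\<rho> t)) \<longlongrightarrow> 0) (at_right 0)"
  proof (rule tendstoI)
    fix e :: real assume "e > 0"
    have fm: "finite_measure \<rho>0" using P2D(1)[OF r0(1)] by (simp add: prob_space_def)
    have "\<exists>v L. L-lipschitz_on UNIV v \<and> bounded (range v) \<and> L2_norm \<rho>0 (\<lambda>x. v0 x - v x) < 1 / (real n + 1)" for n
      by (rule lipschitz_dense_in_L2[OF fm P2D(2)[OF r0(1)] L2_square_integrable(1)[OF r0], of "1 / (real n + 1)"]) auto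
    then obtain v L where v: "\<And>n. (L n)-lipschitz_on UNIV (v n)" "\<And>n. bounded (range (v n))"
      "\<And>n. L2_norm \<rho>0 (\<lambda>x. v0 x - v n x) < 1 / (real n + 1)" by metis
    have vL2: "v n \<in> L2 \<rho>0" for n by (rule L2_lipschitz[OF r0(1) v(1,2)])
    define \<rho>n where "\<rho>n = (\<lambda>n t. fst (S t (\<rho>0, momentum \<rho>0 (v n))))"
    have inv0: "(\<lambda>n. 1 / (real n + 1)) \<longlonglongrightarrow> 0"
      using LIMSEQ_inverse_real_of_nat by (simp add: inverse_eq_divide add.commute)
    have "(\<lambda>n. W2 (\<rho>n n t) (\<rho> t)) \<longlonglongrightarrow> 0"
    proof -
      have D: "D2 (\<rho>0, momentum \<rho>0 (v n)) (\<rho>0, momentum \<rho>0 v0) = L2_norm \<rho>0 (\<lambda>x. v0 x - v n x)" for n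
      proof -
        have "L2_norm unif (\<lambda>w. v n (X_of \<rho>0 w) - v0 (X_of \<rho>0 w)) = L2_norm \<rho>0 (\<lambda>x. v n x - v0 x)"
          using square_integrable_comp_X_of(2)[OF r0(1), of "\<lambda>x. v n x - v0 x"] r0 vL2[of n] by (auto simp: L2_iff)
        then show ?thesis
          using D2_momentum[OF r0(1) vL2[of n] r0]
          by (simp add: W2_self[OF r0(1)] L2_norm_nonneg L2_norm_diff_commute[of \<rho>0 v0])
      qed
      have "(\<lambda>n. D2 (\<rho>0, momentum \<rho>0 (v n)) (\<rho>0, momentum \<rho>0 v0)) \<longlonglongrightarrow> 0"
        unfolding D
      proof (rule Lim_null_comparison[OF _ inv0], intro always_eventually allI)
        fix n
        show "norm (L2_norm \<rho>0 (\<lambda>x. v0 x - v n x)) \<le> 1 / (real n + 1)"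
          using v(3)[of n] by (simp add: L2_norm_nonneg)
      qed
      then have "(\<lambda>n. W2 (\<rho>n n t) (fst (S t (\<rho>0, momentum \<rho>0 v0)))) \<longlonglongrightarrow> 0"
        unfolding \<rho>n_def using t r0 vL2 by (intro sticky_continuous[OF S] momentum_in_V2) auto
      then show ?thesis using \<rho>[of t] t by simp
    qed
    then have "eventually (\<lambda>n. W2 (\<rho>n n t) (\<rho> t) < e / 2) sequentially"
      using \<open>e > 0\<close> by (intro order_tendstoD) auto
    moreover have "(\<lambda>n. t * (1 / (real n + 1))) \<longlonglongrightarrow> t * 0" by (intro tendsto_intros inv0)
    then have "eventually (\<lambda>n. t * (1 / (real n + 1)) < e / 2) sequentially"
      using \<open>e > 0\<close> by (intro order_tendstoD) auto
    ultimately have "eventually (\<lambda>n. W2 (\<rho>n n t) (\<rho> t) < e / 2 \<and> t * (1 / (real n + 1)) < e / 2) sequentially"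
      by (rule eventually_conj)
    then obtain n where n: "W2 (\<rho>n n t) (\<rho> t) < e / 2" "t * (1 / (real n + 1)) < e / 2"
      by (auto simp: eventually_sequentially)
    have L0: "0 \<le> L n" by (rule lipschitz_on_nonneg[OF v(1)])
    \<comment> \<open>up to time \<open>\<epsilon>1\<close> the free motion with velocity \<open>v n\<close> stays ordered\<close>
    define \<epsilon>1 where "\<epsilon>1 = min t (1 / (L n + 1))"
    have "0 < \<epsilon>1" using t L0 by (simp add: \<epsilon>1_def)
    then have "eventually (\<lambda>\<epsilon>. \<epsilon> \<in> {0<..<\<epsilon>1}) (at_right 0)" by (rule eventually_at_right_real)
    then show "eventually (\<lambda>\<epsilon>. dist (W2 (G (ln (t / \<epsilon>)) (\<rho>' \<epsilon>)) (\<rho> t)) 0 < e) (at_right 0)"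
    proof eventually_elim
      case (elim \<epsilon>)
      then have eps: "0 < \<epsilon>" "\<epsilon> \<le> t" "\<epsilon> \<le> 1 / (L n + 1)" by (auto simp: \<epsilon>1_def)
      let ?\<tau> = "ln (t / \<epsilon>)" and ?\<rho>' = "distr \<rho>0 borel (\<lambda>x. x + \<epsilon> * v n x)"
      have tau: "0 \<le> ?\<tau>" "exp ?\<tau> = t / \<epsilon>" using eps t by auto
      have "\<epsilon> * (L n + 1) \<le> 1" using eps L0 by (simp add: le_divide_eq)
      then have "\<epsilon> * L n \<le> 1" using eps by (simp add: distrib_left)
      then have "\<rho>n n \<epsilon> = ?\<rho>'" unfolding \<rho>n_def using eps v(1)[of n]
        by (intro sticky_eq_free_transport[OF S r0(1) vL2 _ _ ess_nondecreasing_lipschitz]) auto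
      then have flow: "G ?\<tau> ?\<rho>' = \<rho>n n t"
        using sticky_eq_gradient_flow[OF S G r0(1) vL2[of n] eps(1,2)] by (simp add: \<rho>n_def)
      have P: "\<rho>' \<epsilon> \<in> P2" "?\<rho>' \<in> P2" using displacement_P2(2)[OF r0] displacement_P2(2)[OF r0(1) vL2] \<rho>' eps by auto
      have PG: "G ?\<tau> (\<rho>' \<epsilon>) \<in> P2" "\<rho>n n t \<in> P2" "\<rho> t \<in> P2"
      proof -
        show "G ?\<tau> (\<rho>' \<epsilon>) \<in> P2" using G P tau unfolding gradient_flow_semigroup_def by blast
        show "\<rho>n n t \<in> P2" "\<rho> t \<in> P2"
          unfolding \<rho>n_def using t \<rho>[of t] sticky_law_P2[OF S momentum_in_V2[OF r0(1) vL2]] sticky_law_P2[OF S momentum_in_V2[OF r0]] by auto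
      qed
      have "W2 (G ?\<tau> (\<rho>' \<epsilon>)) (\<rho>n n t) \<le> exp ?\<tau> * W2 (\<rho>' \<epsilon>) ?\<rho>'"
        unfolding flow[symmetric] using G P tau unfolding gradient_flow_semigroup_def by blast
      also have "W2 (\<rho>' \<epsilon>) ?\<rho>' \<le> L2_norm \<rho>0 (\<lambda>x. (x + \<epsilon> * v0 x) - (x + \<epsilon> * v n x))"
        unfolding \<rho>'[OF eps(1)] by (intro W2_le_L2_norm P2D(1) displacement_P2(1) r0 vL2)
      also have "\<dots> = \<epsilon> * L2_norm \<rho>0 (\<lambda>x. v0 x - v n x)"
        using L2_norm_cmult[of \<rho>0 \<epsilon> "\<lambda>x. v0 x - v n x"] eps by (simp add: right_diff_distrib)
      also have "exp ?\<tau> * (\<epsilon> * L2_norm \<rho>0 (\<lambda>x. v0 x - v n x)) = t * L2_norm \<rho>0 (\<lambda>x. v0 x - v n x)"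
        using eps tau(2) by simp
      also have "\<dots> \<le> t * (1 / (real n + 1))" using v(3)[of n] t by (intro mult_left_mono) auto
      also have "\<dots> < e / 2" by (rule n(2))
      finally have "W2 (G ?\<tau> (\<rho>' \<epsilon>)) (\<rho>n n t) < e / 2" by simp
      then have "W2 (G ?\<tau> (\<rho>' \<epsilon>)) (\<rho> t) < e"
        using W2_triangle[OF PG] n(1) by linarith
      then show ?case using W2_nonneg[of "G ?\<tau> (\<rho>' \<epsilon>)" "\<rho> t"] by simp
    qed
  qed
qed

end
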